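(* Let $\mathbf{A}$ be a real $n\times d$ matrix and let $\epsilon>0$. There is a distribution over matrices $\mathbf{S}$ with $O(d\log d\,\epsilon^{-2})$ rows and exactly one nonzero entry per row such that, with high probability, $$\|\mathbf{S}\mathbf{A}x\|_1 \approx_{1+\epsilon} \|\mathbf{A}x\|_1 \quad\text{for all } x\in\mathbb{R}^d.$$ Furthermore, one can sample from this distribution using $O(\log\log n)$ calls to a routine computing $2$-approximate statistical leverage scores of matrices of the form $\mathbf{W}\mathbf{A}$, where $\mathbf{W}$ is a nonnegative diagonal matrix.
   Context: For $\alpha\ge 1$ and nonnegative reals $x,y$, write $x\approx_\alpha y$ if $\frac{1}{\alpha}x\le y\le \alpha x$. The statistical leverage score of the $i$-th row $a_i$ (viewed as a column vector) of a matrix $\mathbf{M}$ of full column rank is $\tau_i(\mathbf{M})=a_i^T(\mathbf{M}^T\mathbf{M})^{-1}a_i$; a $2$-approximation of the leverage scores is a vector $\tilde\tau$ with $\tilde\tau_i\approx_2\tau_i(\mathbf{M})$ for all $i$. Matrices are assumed of full column rank (otherwise pseudo-inverses are used).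
   Formalization: The row bound is O(d log(max(2,d)) max(1, ε^-2)), since the literal O(d log d ε^-2) fails for large ε and for d = 1 (A = I would need S with no rows); log log n is read as log log max(3,n). *)

theory Defs
  imports "HOL-Probability.Probability" "Jordan_Normal_Form.Matrix"
begin

unbundle no vec_syntax and no inner_syntax

definition approx_factor :: "real \<Rightarrow> real \<Rightarrow> real \<Rightarrow> bool" where
  "approx_factor \<alpha> x y \<longleftrightarrow> (1 / \<alpha>) * x \<le> y \<and> y \<le> \<alpha> * x"

definition l1_norm :: "real vec \<Rightarrow> real" where
  "l1_norm v = (\<Sum>i<dim_vec v. \<bar>v $ i\<bar>)"

text \<open>The Moore--Penrose pseudo-inverse, given by the four Penrose equations. It agrees with the
  inverse where there is one (lemma \<open>pseudo_inverse_eq_inverse\<close>), so the leverage scores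
  below are the usual ones for a matrix of full column rank.\<close>

definition is_pseudo_inverse :: "real mat \<Rightarrow> real mat \<Rightarrow> bool" where
  "is_pseudo_inverse G P \<longleftrightarrow>
     P \<in> carrier_mat (dim_col G) (dim_row G) \<and>
     G * P * G = G \<and> P * G * P = P \<and>
     transpose_mat (G * P) = G * P \<and> transpose_mat (P * G) = P * G"

definition pseudo_inverse :: "real mat \<Rightarrow> real mat" where
  "pseudo_inverse G = (THE P. is_pseudo_inverse G P)"

lemma pseudo_inverse_eq_inverse:
  assumes G: "G \<in> carrier_mat n n" and H: "H \<in> carrier_mat n n"
    and GH: "G * H = 1\<^sub>m n" and HG: "H * G = 1\<^sub>m n"
  shows "pseudo_inverse G = H"
  unfolding pseudo_inverse_def
proof (rule the_equality)
  show "is_pseudo_inverse G H"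
    using assms by (simp add: is_pseudo_inverse_def)
next
  fix P assume P: "is_pseudo_inverse G P"
  then have Pc: "P \<in> carrier_mat n n" and eq: "G * P * G = G"
    using G by (auto simp: is_pseudo_inverse_def)
  have "P = (H * G) * P * (G * H)"
    using Pc by (simp add: GH HG)
  also have "\<dots> = H * (G * P * G) * H"
    using G H Pc by (simp add: assoc_mult_mat[of _ n n _ n _ n])
  also have "\<dots> = H"
    using H by (simp add: eq HG)
  finally show "P = H" .
qed

definition leverage_score :: "real mat \<Rightarrow> nat \<Rightarrow> real" where
  "leverage_score M i =
     row M i \<bullet> (pseudo_inverse (transpose_mat M * M) *\<^sub>v row M i)"

definition leverage_approx2 :: "real mat \<Rightarrow> real vec \<Rightarrow> bool" where
  "leverage_approx2 M \<tau> \<longleftrightarrow> \<tau> \<in> carrier_vec (dim_row M) \<and>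
     (\<forall>i<dim_row M. approx_factor 2 (\<tau> $ i) (leverage_score M i))"

definition nonneg_diagonal :: "nat \<Rightarrow> real mat \<Rightarrow> bool" where
  "nonneg_diagonal n W \<longleftrightarrow>
     W \<in> carrier_mat n n \<and> diagonal_mat W \<and> (\<forall>i<n. W $$ (i,i) \<ge> 0)"

text \<open>A routine for \<open>A\<close> is handed only the weights \<open>W\<close>. It may return any 2-approximation of
  the leverage scores of \<open>W * A\<close>, and is unconstrained on other inputs.\<close>

definition leverage_routine :: "real mat \<Rightarrow> (real mat \<Rightarrow> real vec) \<Rightarrow> bool" where
  "leverage_routine A T \<longleftrightarrow>
     (\<forall>W. nonneg_diagonal (dim_row A) W \<longrightarrow> leverage_approx2 (W * A) (T W))"

definition one_nonzero_per_row :: "real mat \<Rightarrow> bool" where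
  "one_nonzero_per_row S \<longleftrightarrow>
     (\<forall>i<dim_row S. \<exists>!j. j < dim_col S \<and> S $$ (i,j) \<noteq> 0)"

definition l1_preserving :: "real \<Rightarrow> real mat \<Rightarrow> real mat \<Rightarrow> bool" where
  "l1_preserving \<epsilon> A S \<longleftrightarrow>
     (\<forall>x\<in>carrier_vec (dim_col A).
        approx_factor (1 + \<epsilon>) (l1_norm ((S * A) *\<^sub>v x)) (l1_norm (A *\<^sub>v x)))"

text \<open>Randomized adaptive programs that make calls to an external routine: \<open>Call q f\<close> queries
  the routine at \<open>q\<close> and continues with \<open>f\<close> applied to the answer.\<close>

datatype ('q, 'r, 'a) routine_program =
    Return 'a
  | Random "('q, 'r, 'a) routine_program pmf"
  | Call 'q "'r \<Rightarrow> ('q, 'r, 'a) routine_program"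

primrec output_distribution :: "('q \<Rightarrow> 'r) \<Rightarrow> ('q, 'r, 'a) routine_program \<Rightarrow> 'a pmf" where
  "output_distribution T (Return a) = return_pmf a"
| "output_distribution T (Random P) = join_pmf (map_pmf (output_distribution T) P)"
| "output_distribution T (Call q f) = output_distribution T (f (T q))"

text \<open>Every run against \<open>T\<close>, whatever the random choices, makes at most \<open>k\<close> calls, all of them
  at queries satisfying \<open>Q\<close>.\<close>

inductive calls_at_most ::
  "('q \<Rightarrow> bool) \<Rightarrow> ('q \<Rightarrow> 'r) \<Rightarrow> nat \<Rightarrow> ('q, 'r, 'a) routine_program \<Rightarrow> bool"
  for Q T where
  "calls_at_most Q T k (Return a)"
| "(\<And>p. p \<in> set_pmf P \<Longrightarrow> calls_at_most Q T k p) \<Longrightarrow> calls_at_most Q T k (Random P)"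
| "Q q \<Longrightarrow> calls_at_most Q T k (f (T q)) \<Longrightarrow> calls_at_most Q T (Suc k) (Call q f)"

end

theory Submission
  imports Defs "Jordan_Normal_Form.Determinant"
begin

text \<open>Let \<open>w\<close> be approximate \<open>\<ell>\<^sub>1\<close> Lewis weights, i.e. \<open>w\<^sub>i\<^sup>2\<close> is within a constant factor of
  \<open>a\<^sub>i\<^sup>T (A\<^sup>T W\<^sup>-\<^sup>1 A)\<^sup>+ a\<^sub>i\<close>. The map \<open>w \<mapsto> (a\<^sub>i\<^sup>T (A\<^sup>T W\<^sup>-\<^sup>1 A)\<^sup>+ a\<^sub>i)\<^sup>1\<^sup>/\<^sup>2\<close> contracts the logarithm of
  ratios of weights by a factor 2, and costs one leverage score call. Started at \<open>w = 1\<close>, consecutive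
  iterates are within \<open>O(\<surd>n)\<close> of each other after the first step, hence within a constant factor after
  \<open>O(log log n)\<close> steps; this is all that is needed, and exact Lewis weights never appear.

  Rows are sampled independently with probability proportional to \<open>w\<close>. The exponential moment of the
  largest deviation of \<open>\<parallel>SAx\<parallel>\<^sub>1\<close> over \<open>\<parallel>Ax\<parallel>\<^sub>1 \<le> 1\<close> is symmetrized and the absolute values are removed by
  contraction, which leaves a linear functional of \<open>x\<close> with random signs. A union bound over the rows of
  \<open>SA\<close> would cost a factor \<open>log (d/\<epsilon>)\<close>. Instead the unit ball \<open>\<parallel>Ax\<parallel>\<^sub>1 \<le> 1\<close> is enclosed in twice the
  symmetric convex hull of \<open>O(d\<^sup>2)\<close> points of bounded energy \<open>\<Sum> (a\<^sub>i\<^sup>T x)\<^sup>2 / w\<^sub>i\<close>, which come from a sample of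
  \<open>O(d\<^sup>2)\<close> rows and second moments alone; the union bound over these points costs only \<open>log d\<close>.\<close>

section \<open>Pseudo-inverses and leverage scores\<close>

text \<open>The points of the hull come from a crude argument: the error of a sampled quadratic form
  is measured in the Frobenius norm, whose mean square is a sum of variances. Sharper matrix
  concentration would use fewer rows, but only the logarithm of the number of points enters the
  final sample size, so a quadratic number is harmless. Weights are compared through a variational
  principle: \<open>quad A n w i\<close> is the largest \<open>(f i)\<^sup>2\<close> over functions
  of energy at most 1. Comparisons of pseudo-inverses become comparisons of sums, and rank
  deficiency and zero rows need no separate treatment. The answers of the routine at different
  weights are unrelated, each with its own error, so convergence is never claimed and only ratios of
  consecutive iterates are tracked. The square of an updated weight is within a factor 2 of
  \<open>quad\<close> at the old weights; once the two iterates agree within 8, the old weights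
  satisfy the Lewis inequality with constant \<open>2 * 8\<^sup>2 = 128\<close>.\<close>

lemma power2_le_self_imp_le_one:
  assumes "(x::real)\<^sup>2 \<le> x"
  shows "x \<le> 1"
proof (rule ccontr)
  assume "\<not> ?thesis"
  then have "x * 1 < x * x" by (intro mult_strict_left_mono) auto
  then show False using assms by (simp add: power2_eq_square)
qed

lemma scalar_prod_self_eq_0:
  assumes "v \<in> carrier_vec n" and "(v::real vec) \<bullet> v = 0"
  shows "v = 0\<^sub>v n"
proof (rule eq_vecI)
  fix i assume i: "i < dim_vec (0\<^sub>v n :: real vec)"
  have "(\<Sum>i\<in>{0..<n}. v $ i * v $ i) = 0"
    using assms by (auto simp: scalar_prod_def)
  then have "\<forall>i\<in>{0..<n}. v $ i * v $ i = 0"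
    by (subst (asm) sum_nonneg_eq_0_iff) auto
  then show "v $ i = 0\<^sub>v n $ i" using i by auto
qed (use assms in auto)

text \<open>The vectors become the columns of a square matrix with a zero row at the bottom. Its
  transpose kills the last unit vector, so the determinant vanishes and a kernel vector gives the
  coefficients.\<close>

lemma vectors_dependent:
  fixes v :: "nat \<Rightarrow> real vec"
  obtains c where "\<exists>k\<le>d. c k \<noteq> 0" and "\<And>i. i < d \<Longrightarrow> (\<Sum>k<Suc d. c k * v k $ i) = 0"
proof -
  define B where "B = mat (Suc d) (Suc d) (\<lambda>(i,k). if i < d then v k $ i else 0)"
  have B: "B \<in> carrier_mat (Suc d) (Suc d)" by (simp add: B_def)
  have "transpose_mat B *\<^sub>v unit_vec (Suc d) d = 0\<^sub>v (Suc d)"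
    by (rule eq_vecI) (auto simp: B_def row_def scalar_prod_def unit_vec_def intro!: sum.neutral)
  moreover have "unit_vec (Suc d) d \<noteq> (0\<^sub>v (Suc d) :: real vec)"
    by (metis index_unit_vec(2) index_zero_vec(1) lessI zero_neq_one)
  ultimately have "det (transpose_mat B) = 0"
    using det_0_iff_vec_prod_zero[of "transpose_mat B" "Suc d"] B
    by (meson transpose_carrier_mat unit_vec_carrier)
  then have "det B = 0" using det_transpose[OF B] by simp
  then obtain x where x: "x \<in> carrier_vec (Suc d)" "x \<noteq> 0\<^sub>v (Suc d)" "B *\<^sub>v x = 0\<^sub>v (Suc d)"
    using det_0_iff_vec_prod_zero[OF B] by auto
  show thesis
  proof (rule that[of "\<lambda>k. x $ k"])
    show "\<exists>k\<le>d. x $ k \<noteq> 0"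
    proof (rule ccontr)
      assume "\<not> ?thesis"
      then have "x = 0\<^sub>v (Suc d)" using x(1) by (intro eq_vecI) auto
      with x(2) show False by simp
    qed
    fix i assume i: "i < d"
    have "0 = (B *\<^sub>v x) $ i" using x(3) i by simp
    also have "\<dots> = (\<Sum>k<Suc d. x $ k * v k $ i)"
      using i x(1) by (simp add: B_def row_def scalar_prod_def lessThan_atLeast0 mult.commute)
    finally show "(\<Sum>k<Suc d. x $ k * v k $ i) = 0" by simp
  qed
qed

text \<open>For symmetric \<open>G\<close>, \<open>G (G y) = 0\<close> gives
  \<open>(G y) \<bullet> (G y) = (G (G y)) \<bullet> y = 0\<close>. Powers of \<open>G\<close> are
  cancelled one at a time in this way.\<close>

lemma symmetric_kernel_power:
  fixes G :: "real mat"
  assumes G: "G \<in> carrier_mat d d" "transpose_mat G = G"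
    and x: "x \<in> carrier_vec d" and k: "((*\<^sub>v) G ^^ k) x = 0\<^sub>v d"
  shows "G *\<^sub>v x = 0\<^sub>v d"
  using k
proof (induction k)
  case 0
  then show ?case using G by auto
next
  case (Suc k)
  show ?case
  proof (cases k)
    case 0
    then show ?thesis using Suc by simp
  next
    case (Suc l)
    define y where "y = ((*\<^sub>v) G ^^ l) x"
    have c: "((*\<^sub>v) G ^^ j) x \<in> carrier_vec d" for j
      by (induction j) (use G x in auto)
    have y: "y \<in> carrier_vec d" "G *\<^sub>v y \<in> carrier_vec d"
      using c[of l] G by (auto simp: y_def)
    have "G *\<^sub>v (G *\<^sub>v y) = 0\<^sub>v d"
      using Suc.prems by (simp add: Suc y_def)
    then have "(G *\<^sub>v y) \<bullet> (G *\<^sub>v y) = 0"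
      using transpose_vec_mult_scalar[OF G(1) y(1) y(2)] y G
        by (simp)
    then have "G *\<^sub>v y = 0\<^sub>v d" using scalar_prod_self_eq_0 y by blast
    then show ?thesis using Suc.IH Suc by (simp add: y_def)
  qed
qed

text \<open>A substitute for diagonalization. The vectors \<open>e\<close>, \<open>G e\<close>, ...,
  \<open>G^d e\<close> are dependent, so \<open>p(G) e = 0\<close> for a nonzero polynomial
  \<open>p\<close>. Leading powers of \<open>G\<close> can be cancelled down to a single one, after
  which the constant term is nonzero; solving for \<open>G e\<close> leaves \<open>G\<close> applied
  twice to a vector.\<close>

lemma symmetric_range_square:
  fixes G :: "real mat"
  assumes G: "G \<in> carrier_mat d d" "transpose_mat G = G" and e: "e \<in> carrier_vec d"
  shows "\<exists>y\<in>carrier_vec d. G *\<^sub>v (G *\<^sub>v y) = G *\<^sub>v e"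
proof -
  \<comment> \<open>\<open>pe as\<close> is the polynomial with coefficient list \<open>as\<close>,
    constant term first, evaluated at \<open>G\<close> by Horner's scheme and applied to
    \<open>e\<close>.\<close>
  define pe where "pe = rec_list (0\<^sub>v d) (\<lambda>a _ r. a \<cdot>\<^sub>v e + G *\<^sub>v r)"
  have pe: "pe [] = 0\<^sub>v d" "pe (a # as) = a \<cdot>\<^sub>v e + G *\<^sub>v pe as" for a as
    by (simp_all add: pe_def)
  have pec: "pe as \<in> carrier_vec d" for as
    by (induction as) (use G e in \<open>auto simp: pe\<close>)
  have c: "((*\<^sub>v) G ^^ j) x \<in> carrier_vec d" if "x \<in> carrier_vec d" for j x
    by (induction j) (use G that in auto)
  define v where "v k = ((*\<^sub>v) G ^^ k) e" for k
  have vc: "v k \<in> carrier_vec d" for k using c e by (simp add: v_def)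
  have pe_sum: "pe as $ i = (\<Sum>k<length as. as ! k * v k $ i)" if "i < d" for as i
    using that
  proof (induction as arbitrary: i)
    case (Cons a as)
    have "(G *\<^sub>v pe as) $ i = (\<Sum>j<d. G $$ (i,j) * pe as $ j)"
      using Cons.prems G pec[of as]
      by (auto simp: scalar_prod_def lessThan_atLeast0 row_def intro!: sum.cong)
    also have "\<dots> = (\<Sum>j<d. \<Sum>k<length as. as ! k * (G $$ (i,j) * v k $ j))"
      using Cons.IH by (simp add: sum_distrib_left mult.left_commute)
    also have "\<dots> = (\<Sum>k<length as. as ! k * (\<Sum>j<d. G $$ (i,j) * v k $ j))"
      by (subst sum.swap) (simp add: sum_distrib_left)
    also have "\<dots> = (\<Sum>k<length as. as ! k * (v (Suc k) $ i))"
      using Cons.prems G vc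
      by (intro sum.cong refl)
        (auto simp: v_def scalar_prod_def lessThan_atLeast0 row_def carrier_vecD[OF c[OF e]])
    finally have "(G *\<^sub>v pe as) $ i = (\<Sum>k<length as. as ! k * (v (Suc k) $ i))" .
    then show ?case using Cons.prems e G pec[of as]
      by (simp add: pe sum.lessThan_Suc_shift v_def del: sum.lessThan_Suc)
  qed (simp add: pe)
  obtain cf where cf: "\<exists>k\<le>d. cf k \<noteq> 0" "\<And>i. i < d \<Longrightarrow> (\<Sum>k<Suc d. cf k * v k $ i) = 0"
    using vectors_dependent[of d v] by blast
  have "pe (map cf [0..<Suc d]) = 0\<^sub>v d"
  proof (rule eq_vecI)
    fix i assume "i < dim_vec (0\<^sub>v d :: real vec)"
    then have i: "i < d" by simp
    have "pe (map cf [0..<Suc d]) $ i = (\<Sum>k<Suc d. cf k * v k $ i)"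
      unfolding pe_sum[OF i] by (intro sum.cong) (auto simp del: upt_Suc)
    then show "pe (map cf [0..<Suc d]) $ i = 0\<^sub>v d $ i" using cf(2)[OF i] i by simp
  qed (use pec[of "map cf [0..<Suc d]"] in \<open>simp del: upt_Suc\<close>)
  moreover have "\<exists>a\<in>set (map cf [0..<Suc d]). a \<noteq> 0"
    using cf(1) by (auto simp del: upt_Suc simp: less_Suc_eq_le)
  \<comment> \<open>\<open>k\<close> counts the zero low-order coefficients already stripped off;
    each leaves one power of \<open>G\<close> in front.\<close>
  moreover have main: "\<exists>y\<in>carrier_vec d. G *\<^sub>v (G *\<^sub>v y) = G *\<^sub>v e"
    if "((*\<^sub>v) G ^^ k) (pe as) = 0\<^sub>v d" "\<exists>a\<in>set as. a \<noteq> 0" for k as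
    using that
  proof (induction as arbitrary: k)
    case (Cons a as)
    show ?case
    proof (cases "a = 0")
      case True
      have "pe (a # as) = G *\<^sub>v pe as"
        using True e G pec[of as] by (auto simp: pe intro!: eq_vecI)
      then have "((*\<^sub>v) G ^^ Suc k) (pe as) = 0\<^sub>v d" using Cons.prems
        by (simp add: funpow_swap1)
      moreover have "\<exists>b\<in>set as. b \<noteq> 0" using Cons.prems(2) True by auto
      ultimately show ?thesis by (rule Cons.IH)
    next
      case False
      let ?p = "pe as"
      have "G *\<^sub>v pe (a # as) = 0\<^sub>v d"
        using symmetric_kernel_power[OF G pec Cons.prems(1)] .
      then have eq: "a \<cdot>\<^sub>v (G *\<^sub>v e) + G *\<^sub>v (G *\<^sub>v ?p) = 0\<^sub>v d"
        using G e pec[of as] by (simp add: pe mult_add_distrib_mat_vec[of _ d d] mult_mat_vec[of _ d d])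
      have "G *\<^sub>v (G *\<^sub>v ((- 1 / a) \<cdot>\<^sub>v ?p)) = (- 1 / a) \<cdot>\<^sub>v (G *\<^sub>v (G *\<^sub>v ?p))"
        using G pec[of as] by (simp add: mult_mat_vec[of _ d d])
      also have "\<dots> = G *\<^sub>v e"
      proof (rule eq_vecI)
        fix i assume "i < dim_vec (G *\<^sub>v e)"
        then have i: "i < d" using G by simp
        have "(a \<cdot>\<^sub>v (G *\<^sub>v e) + G *\<^sub>v (G *\<^sub>v ?p)) $ i = 0" using eq i by simp
        then have "a * (G *\<^sub>v e) $ i + (G *\<^sub>v (G *\<^sub>v ?p)) $ i = 0"
          using G i by simp
        then show "((- 1 / a) \<cdot>\<^sub>v (G *\<^sub>v (G *\<^sub>v ?p))) $ i = (G *\<^sub>v e) $ i"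
          using False G i by (simp add: field_simps del: index_mult_mat_vec)
      qed (use G in auto)
      finally show ?thesis
        by (intro bexI[of _ "(- 1 / a) \<cdot>\<^sub>v ?p"]) (use pec[of as] in auto)
    qed
  qed simp
  ultimately show ?thesis using main[of 0 "map cf [0..<Suc d]"] by (simp del: upt_Suc)
qed

text \<open>\<open>G * P\<close> and \<open>G * R\<close> are symmetric and each absorbs the other,
  so transposing makes them equal; likewise with \<open>G\<close> on the right. Uniqueness gives the
  definite description in \<open>pseudo_inverse\<close> its meaning.\<close>

lemma pseudo_inverse_unique:
  assumes G: "G \<in> carrier_mat n n" and P: "is_pseudo_inverse G P" and R: "is_pseudo_inverse G R"
  shows "P = R"
proof -
  have c: "P \<in> carrier_mat n n" "R \<in> carrier_mat n n"
    using P R G by (auto simp: is_pseudo_inverse_def)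
  have pr: "transpose_mat (G * P) = G * P" "transpose_mat (G * R) = G * R"
    "transpose_mat (P * G) = P * G" "transpose_mat (R * G) = R * G"
    "G * P * G = G" "G * R * G = G" "P * G * P = P" "R * G * R = R"
    using P R by (auto simp: is_pseudo_inverse_def)
  have "(G * R) * (G * P) = G * P" "(G * P) * (G * R) = G * R"
    using assoc_mult_mat[of "G * R" n n G n P n] assoc_mult_mat[of "G * P" n n G n R n] G c
    by (auto simp: pr)
  then have 1: "G * P = G * R"
    using transpose_mult[of "G * R" n n "G * P" n] G c by (simp add: pr)
  have "(P * G) * (R * G) = P * G" "(R * G) * (P * G) = R * G"
    using assoc_mult_mat[of P n n G n "R * G" n] assoc_mult_mat[of G n n R n G n]
      assoc_mult_mat[of R n n G n "P * G" n] assoc_mult_mat[of G n n P n G n] G c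
    by (auto simp: pr)
  then have 2: "P * G = R * G"
    using transpose_mult[of "P * G" n n "R * G" n] G c by (simp add: pr)
  have "P = P * G * P" using P by (simp add: is_pseudo_inverse_def)
  also have "\<dots> = R * (G * P)" using G c by (simp add: 2 assoc_mult_mat[of _ n n _ n _ n])
  also have "\<dots> = R * G * R" using G c by (simp add: 1 assoc_mult_mat[of _ n n _ n _ n])
  also have "\<dots> = R" using R by (simp add: is_pseudo_inverse_def)
  finally show ?thesis .
qed

text \<open>Solving \<open>G (G y) = G e\<close> for every unit vector \<open>e\<close> yields
  \<open>Y\<close> with \<open>G * (G * Y) = G\<close>. Then \<open>E = G * Y\<close> is a symmetric
  idempotent, the projection onto the range of \<open>G\<close>, and \<open>P = E * Y\<close>
  satisfies \<open>G * P = E = P * G\<close>.\<close>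

lemma symmetric_pseudo_inverse:
  assumes G: "G \<in> carrier_mat d d" and sym: "transpose_mat G = G"
  shows "is_pseudo_inverse G (pseudo_inverse G)"
    and "transpose_mat (pseudo_inverse G) = pseudo_inverse G"
proof -
  have "\<forall>j. \<exists>y\<in>carrier_vec d. G *\<^sub>v (G *\<^sub>v y) = G *\<^sub>v unit_vec d j"
    using symmetric_range_square[OF G sym] by auto
  then obtain y where y: "\<And>j. y j \<in> carrier_vec d"
    "\<And>j. G *\<^sub>v (G *\<^sub>v y j) = G *\<^sub>v unit_vec d j" by metis
  define Y where "Y = mat d d (\<lambda>(i,j). y j $ i)"
  have Y: "Y \<in> carrier_mat d d" by (simp add: Y_def)
  have GGY: "G * (G * Y) = G"
  proof (rule mat_col_eqI)
    fix j assume "j < dim_col G"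
    then have j: "j < d" using G by simp
    have cy: "col Y j = y j" using j y(1)[of j] by (auto simp: Y_def intro!: eq_vecI)
    have "col (G * (G * Y)) j = G *\<^sub>v (G *\<^sub>v col Y j)"
      using j G Y by (simp add: col_mult2[of _ d d _ d])
    also have "\<dots> = G *\<^sub>v unit_vec d j" by (simp add: y cy)
    also have "\<dots> = col G j" using G j by (auto intro!: eq_vecI simp: scalar_prod_right_unit[of _ d])
    finally show "col (G * (G * Y)) j = col G j" .
  qed (use G Y in auto)
  note assoc = assoc_mult_mat[of _ d d _ d _ d]
  define E where "E = G * Y"
  define P where "P = transpose_mat Y * E"
  have E: "E \<in> carrier_mat d d" and P: "P \<in> carrier_mat d d" and Yt: "transpose_mat Y \<in> carrier_mat d d"
    using G Y by (auto simp: E_def P_def)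
  have Et: "transpose_mat E = transpose_mat Y * G"
    using transpose_mult[OF G Y] sym by (simp add: E_def)
  have GE: "G * E = G" using GGY by (simp add: E_def)
  have EG: "transpose_mat E * G = G" using transpose_mult[OF G E] GE sym by simp
  have "transpose_mat E * E = E" using EG G E Y by (metis E_def assoc transpose_carrier_mat)
  then have Es: "transpose_mat E = E" using transpose_mult[of "transpose_mat E" d d E d] E by simp
  then have EE: "E * E = E" using \<open>transpose_mat E * E = E\<close> by simp
  have PEY: "P = E * Y" using Et Es assoc[OF Yt G Y] by (simp add: P_def E_def)
  have Ps: "transpose_mat P = P"
    using transpose_mult[OF Yt E] Es by (simp add: P_def PEY[unfolded P_def])
  have GP: "G * P = E" using assoc[OF G E Y] GE by (simp add: PEY E_def)
  have PG: "P * G = E" using transpose_mult[OF G P] GP Ps Es sym by simp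
  have EP: "E * P = P" using assoc[OF E E Y] EE by (simp add: PEY)
  have "is_pseudo_inverse G P"
    using G P GP PG Es EG EP by (simp add: is_pseudo_inverse_def)
  then have "pseudo_inverse G = P"
    unfolding pseudo_inverse_def using pseudo_inverse_unique[OF G] by blast
  then show "is_pseudo_inverse G (pseudo_inverse G)"
    and "transpose_mat (pseudo_inverse G) = pseudo_inverse G"
    using \<open>is_pseudo_inverse G P\<close> Ps by auto
qed

section \<open>The hat matrix \<open>M (M^T M)^+ M^T\<close> as a reproducing kernel of the column
  space of \<open>M\<close>\<close>

definition kern :: "real mat \<Rightarrow> nat \<Rightarrow> nat \<Rightarrow> real" where
  "kern M i j = row M i \<bullet> (pseudo_inverse (transpose_mat M * M) *\<^sub>v row M j)"

lemma leverage_score_kern: "leverage_score M i = kern M i i"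
  by (simp add: leverage_score_def kern_def)

context
  fixes M :: "real mat" and n d :: nat and P G :: "real mat"
  assumes M: "M \<in> carrier_mat n d"
  defines "G \<equiv> transpose_mat M * M" and "P \<equiv> pseudo_inverse G"
begin

lemma gram: "G \<in> carrier_mat d d" "transpose_mat G = G"
  using M transpose_mult[of "transpose_mat M" d n M d] by (auto simp: G_def)

lemma gram_pseudo_inverse:
  "P \<in> carrier_mat d d" "G * P * G = G" "P * G * P = P" "transpose_mat (P * G) = P * G"
  "transpose_mat P = P"
  using symmetric_pseudo_inverse[OF gram] gram(1) by (auto simp: is_pseudo_inverse_def P_def)

lemma kern_sym:
  assumes "i < n" "j < n"
  shows "kern M i j = kern M j i"
proof -
  have r: "row M i \<in> carrier_vec d" "row M j \<in> carrier_vec d" using M assms by auto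
  have "kern M i j = (P *\<^sub>v row M i) \<bullet> row M j"
    using transpose_vec_mult_scalar[OF gram_pseudo_inverse(1) r(2) r(1)] gram_pseudo_inverse(5)
    by (simp add: kern_def P_def G_def)
  also have "\<dots> = kern M j i"
    using comm_scalar_prod[of "P *\<^sub>v row M i" d "row M j"] r gram_pseudo_inverse(1)
    by (simp add: kern_def P_def G_def)
  finally show ?thesis .
qed

text \<open>For \<open>z = P G x - x\<close> one has \<open>G z = 0\<close>, and since
  \<open>G = M^T M\<close> this forces \<open>M z = 0\<close>. Hence \<open>M x = M P G x\<close>
  whatever the rank of \<open>M\<close>.\<close>

lemma kern_reproducing:
  assumes i: "i < n" and x: "x \<in> carrier_vec d"
  shows "row M i \<bullet> x = (\<Sum>j<n. kern M i j * (row M j \<bullet> x))"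
proof -
  note P = gram_pseudo_inverse(1)
  note G = gram(1)
  define z where "z = P *\<^sub>v (G *\<^sub>v x) - x"
  have Px: "P *\<^sub>v (G *\<^sub>v x) \<in> carrier_vec d" using P G x by auto
  have z: "z \<in> carrier_vec d" using Px x by (simp add: z_def)
  have "G *\<^sub>v z = G *\<^sub>v (P *\<^sub>v (G *\<^sub>v x)) - G *\<^sub>v x"
    unfolding z_def by (rule mult_minus_distrib_mat_vec[OF G Px x])
  also have "G *\<^sub>v (P *\<^sub>v (G *\<^sub>v x)) = G *\<^sub>v x"
    using gram_pseudo_inverse(2) assoc_mult_mat_vec[of "G * P" d d G d x]
      assoc_mult_mat_vec[of G d d P d "G *\<^sub>v x"] G P x by simp
  finally have Gz: "G *\<^sub>v z = 0\<^sub>v d" using G x by auto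
  have Mz: "M *\<^sub>v z \<in> carrier_vec n" using M z by auto
  have "(M *\<^sub>v z) \<bullet> (M *\<^sub>v z) = (transpose_mat M *\<^sub>v (M *\<^sub>v z)) \<bullet> z"
    using transpose_vec_mult_scalar[OF M z Mz] by simp
  also have "transpose_mat M *\<^sub>v (M *\<^sub>v z) = 0\<^sub>v d"
    using Gz assoc_mult_mat_vec[of "transpose_mat M" d n M d z] M z by (simp add: G_def)
  finally have "M *\<^sub>v z = 0\<^sub>v n" using scalar_prod_self_eq_0[OF Mz] z by simp
  moreover have "M *\<^sub>v z = M *\<^sub>v (P *\<^sub>v (G *\<^sub>v x)) - M *\<^sub>v x"
    unfolding z_def by (rule mult_minus_distrib_mat_vec[OF M Px x])
  ultimately have "(M *\<^sub>v (P *\<^sub>v (G *\<^sub>v x)) - M *\<^sub>v x) $ i = 0" using i by simp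
  then have "row M i \<bullet> x = row M i \<bullet> (P *\<^sub>v (G *\<^sub>v x))" using i M by simp
  also have "\<dots> = (P *\<^sub>v row M i) \<bullet> (G *\<^sub>v x)"
    using transpose_vec_mult_scalar[of P d d "G *\<^sub>v x" "row M i"] P G M x i gram_pseudo_inverse(5)
    by simp
  also have "G *\<^sub>v x = transpose_mat M *\<^sub>v (M *\<^sub>v x)"
    using assoc_mult_mat_vec[of "transpose_mat M" d n M d x] M x by (simp add: G_def)
  also have "(P *\<^sub>v row M i) \<bullet> \<dots> = (M *\<^sub>v (P *\<^sub>v row M i)) \<bullet> (M *\<^sub>v x)"
    using transpose_vec_mult_scalar[of "transpose_mat M" d n "M *\<^sub>v x" "P *\<^sub>v row M i"] P M x i
    by simp
  also have "\<dots> = (\<Sum>j<n. (row M j \<bullet> (P *\<^sub>v row M i)) * (row M j \<bullet> x))"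
    using M by (simp add: scalar_prod_def[of "M *\<^sub>v _"] lessThan_atLeast0)
  also have "\<dots> = (\<Sum>j<n. kern M i j * (row M j \<bullet> x))"
    using i by (intro sum.cong refl) (simp only: kern_sym[of i] lessThan_iff, simp add: kern_def P_def G_def)
  finally show ?thesis .
qed

lemma kern_vec: "pseudo_inverse (transpose_mat M * M) *\<^sub>v row M j \<in> carrier_vec d"
  using gram_pseudo_inverse(1) unfolding P_def G_def by (intro carrier_vecI) simp

text \<open>By cyclicity the hat matrix has the trace of the \<open>d\<close> by \<open>d\<close>
  matrix \<open>P * G\<close>. The latter is a symmetric idempotent, so each diagonal entry
  \<open>t\<close> satisfies \<open>t\<^sup>2 \<le> t\<close> and is at most 1.\<close>

lemma kern_trace: "(\<Sum>i<n. kern M i i) \<le> real d"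
proof -
  note P = gram_pseudo_inverse(1)
  note G = gram(1)
  define E where "E = P * G"
  have E: "E \<in> carrier_mat d d" using P G by (simp add: E_def)
  have EE: "E * E = E"
    using assoc_mult_mat[of P d d G d "P * G" d] assoc_mult_mat[of G d d P d G d] P G
      gram_pseudo_inverse(2) by (simp add: E_def)
  have Et: "transpose_mat E = E" using gram_pseudo_inverse(4) by (simp add: E_def)
  have Es: "E $$ (k,l) = E $$ (l,k)" if "k < d" "l < d" for k l
    using Et E that by (metis carrier_matD index_transpose_mat(1))
  have E1: "E $$ (l,l) \<le> 1" if l: "l < d" for l
  proof -
    have "E $$ (l,l) = (E * E) $$ (l,l)" by (simp add: EE)
    also have "\<dots> = (\<Sum>k<d. E $$ (l,k) * E $$ (k,l))"
      using E l by (auto simp: scalar_prod_def lessThan_atLeast0)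
    also have "\<dots> = (\<Sum>k<d. (E $$ (l,k))\<^sup>2)"
      using l by (intro sum.cong refl) (simp add: Es power2_eq_square)
    also have "\<dots> \<ge> (E $$ (l,l))\<^sup>2"
      using l member_le_sum[of l "{..<d}" "\<lambda>k. (E $$ (l,k))\<^sup>2"] by simp
    finally have "(E $$ (l,l))\<^sup>2 \<le> E $$ (l,l)" by simp
    then show ?thesis by (rule power2_le_self_imp_le_one)
  qed
  have "(\<Sum>i<n. kern M i i) = (\<Sum>i<n. \<Sum>k<d. \<Sum>l<d. M $$ (i,k) * (P $$ (k,l) * M $$ (i,l)))"
    using M P by (intro sum.cong refl)
      (simp add: kern_def P_def[symmetric] G_def[symmetric] scalar_prod_def lessThan_atLeast0 sum_distrib_left)
  also have "\<dots> = (\<Sum>k<d. \<Sum>l<d. P $$ (k,l) * (\<Sum>i<n. M $$ (i,l) * M $$ (i,k)))"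
  proof -
    have "(\<Sum>i<n. \<Sum>k<d. \<Sum>l<d. M $$ (i,k) * (P $$ (k,l) * M $$ (i,l))) =
        (\<Sum>k<d. \<Sum>i<n. \<Sum>l<d. M $$ (i,k) * (P $$ (k,l) * M $$ (i,l)))"
      by (rule sum.swap)
    also have "\<dots> = (\<Sum>k<d. \<Sum>l<d. \<Sum>i<n. M $$ (i,k) * (P $$ (k,l) * M $$ (i,l)))"
      by (intro sum.cong refl sum.swap)
    finally show ?thesis by (simp add: sum_distrib_left mult_ac)
  qed
  also have "\<dots> = (\<Sum>k<d. E $$ (k,k))"
    using M P G by (intro sum.cong refl)
      (simp add: E_def scalar_prod_def lessThan_atLeast0 G_def)
  also have "\<dots> \<le> (\<Sum>k<d. 1)" by (intro sum_mono E1) auto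
  finally show ?thesis by simp
qed

end

section \<open>Symmetrization\<close>

text \<open>The mean of \<open>F\<close> over \<open>N\<close> independent draws as nested finite
  sums: no question of integrability arises, and a draw is split off by definition. The link to
  \<open>replicate_pmf\<close> is made only at the end.\<close>

primrec iter_mean :: "'i set \<Rightarrow> ('i \<Rightarrow> real) \<Rightarrow> nat \<Rightarrow> ('i list \<Rightarrow> real) \<Rightarrow> real" where
  "iter_mean J q 0 F = F []"
| "iter_mean J q (Suc N) F = (\<Sum>i\<in>J. q i * iter_mean J q N (\<lambda>l. F (i # l)))"

definition samples :: "'i set \<Rightarrow> nat \<Rightarrow> 'i list set" where
  "samples J N = {l. set l \<subseteq> J \<and> length l = N}"

lemma samples_Cons: "i # l \<in> samples J (Suc N) \<longleftrightarrow> i \<in> J \<and> l \<in> samples J N"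
  by (auto simp: samples_def)

lemma finite_samples: "finite J \<Longrightarrow> finite (samples J N)"
  unfolding samples_def by (rule finite_lists_length_eq)

lemma iter_mean_cong:
  "(\<And>l. l \<in> samples J N \<Longrightarrow> F l = G l) \<Longrightarrow> iter_mean J q N F = iter_mean J q N G"
proof (induction N arbitrary: F G)
  case (Suc N)
  have "iter_mean J q N (\<lambda>l. F (i # l)) = iter_mean J q N (\<lambda>l. G (i # l))" if "i \<in> J" for i
    by (rule Suc.IH) (simp add: Suc.prems samples_Cons that)
  then show ?case by simp
qed (simp add: samples_def)

lemma iter_mean_add: "iter_mean J q N (\<lambda>l. F l + G l) = iter_mean J q N F + iter_mean J q N G"
  by (induction N arbitrary: F G) (simp_all add: distrib_left sum.distrib)

lemma iter_mean_cmult: "iter_mean J q N (\<lambda>l. c * F l) = c * iter_mean J q N F"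
  by (induction N arbitrary: F) (simp_all add: sum_distrib_left mult.left_commute)

lemma iter_mean_sum:
  "iter_mean J q N (\<lambda>l. \<Sum>a\<in>A. F a l) = (\<Sum>a\<in>A. iter_mean J q N (F a))"
proof (induction N arbitrary: F)
  case (Suc N)
  then show ?case by (simp add: sum_distrib_left sum.swap[of _ A])
qed simp

locale prob_weights =
  fixes J :: "'i set" and q :: "'i \<Rightarrow> real"
  assumes finite_J: "finite J" and q_nonneg: "i \<in> J \<Longrightarrow> 0 \<le> q i" and q_sum: "sum q J = 1"
begin

lemma iter_mean_mono:
  "(\<And>l. l \<in> samples J N \<Longrightarrow> F l \<le> G l) \<Longrightarrow> iter_mean J q N F \<le> iter_mean J q N G"
proof (induction N arbitrary: F G)
  case (Suc N)
  have "iter_mean J q N (\<lambda>l. F (i # l)) \<le> iter_mean J q N (\<lambda>l. G (i # l))" if "i \<in> J" for i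
    by (rule Suc.IH) (simp add: Suc.prems samples_Cons that)
  then show ?case by (auto intro!: sum_mono mult_left_mono q_nonneg)
qed (simp add: samples_def)

lemma q_avg: "(\<Sum>i\<in>J. q i * c) = c"
  by (simp add: q_sum flip: sum_distrib_right)

lemma q_avg_add: "(\<Sum>i\<in>J. q i * (c + f i)) = c + (\<Sum>i\<in>J. q i * f i)"
  by (simp add: distrib_left sum.distrib q_avg)

lemma iter_mean_const: "iter_mean J q N (\<lambda>l. c) = c"
  by (induction N) (simp_all add: q_avg)

text \<open>The probabilistic method: it fixes one sample that meets several requirements whose
  combined mean is small.\<close>

lemma iter_mean_ex_le: "\<exists>l\<in>samples J N. F l \<le> iter_mean J q N F"
proof (rule ccontr)
  assume "\<not> ?thesis"
  then have lt: "\<And>l. l \<in> samples J N \<Longrightarrow> iter_mean J q N F < F l" by force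
  have "J \<noteq> {}" using q_sum by auto
  then obtain i where "i \<in> J" by auto
  then have "replicate N i \<in> samples J N" by (auto simp: samples_def)
  then have ne: "samples J N \<noteq> {}" by auto
  define m where "m = Min (F ` samples J N)"
  have "m \<in> F ` samples J N" unfolding m_def
    using ne finite_samples[OF finite_J] by (intro Min_in) auto
  then have m: "iter_mean J q N F < m" using lt by auto
  have "iter_mean J q N (\<lambda>l. m) \<le> iter_mean J q N F"
    by (intro iter_mean_mono) (auto simp: m_def finite_samples[OF finite_J])
  then show False using m by (simp add: iter_mean_const)
qed

lemma iter_mean_prod: "iter_mean J q N (\<lambda>l. prod_list (map g l)) = (\<Sum>i\<in>J. q i * g i) ^ N"
proof (induction N)
  case (Suc N)
  then show ?case by (simp add: iter_mean_cmult sum_distrib_right mult.assoc)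
qed simp

lemma iter_mean_sum_list:
  "iter_mean J q N (\<lambda>l. sum_list (map g l)) = real N * (\<Sum>i\<in>J. q i * g i)"
  by (induction N) (simp_all add: iter_mean_add iter_mean_const distrib_left sum.distrib q_avg distrib_right)

lemma iter_mean_sum_list_sq:
  assumes "(\<Sum>i\<in>J. q i * g i) = 0"
  shows "iter_mean J q N (\<lambda>l. (sum_list (map g l))\<^sup>2) = real N * (\<Sum>i\<in>J. q i * (g i)\<^sup>2)"
proof (induction N)
  case (Suc N)
  have "iter_mean J q N (\<lambda>l. (g i + sum_list (map g l))\<^sup>2) =
      (g i)\<^sup>2 + iter_mean J q N (\<lambda>l. (sum_list (map g l))\<^sup>2)" for i
  proof -
    have "iter_mean J q N (\<lambda>l. (g i + sum_list (map g l))\<^sup>2) =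
      iter_mean J q N (\<lambda>l. ((g i)\<^sup>2 + 2 * g i * sum_list (map g l)) + (sum_list (map g l))\<^sup>2)"
      by (simp add: power2_sum algebra_simps)
    then show ?thesis
      by (simp add: iter_mean_add iter_mean_cmult iter_mean_const iter_mean_sum_list assms)
  qed
  then show ?case using Suc
    by (simp add: distrib_left sum.distrib q_avg distrib_right)
qed simp

lemma iter_mean_sum_list_sq_le:
  "iter_mean J q N (\<lambda>l. (sum_list (map (\<lambda>i. g i - (\<Sum>i\<in>J. q i * g i)) l))\<^sup>2)
    \<le> real N * (\<Sum>i\<in>J. q i * (g i)\<^sup>2)"
proof -
  define m where "m = (\<Sum>i\<in>J. q i * g i)"
  have z: "(\<Sum>i\<in>J. q i * (g i - m)) = 0"
    by (simp add: right_diff_distrib sum_subtractf q_sum m_def flip: sum_distrib_right)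
  have "(\<Sum>i\<in>J. q i * (g i - m)\<^sup>2) = (\<Sum>i\<in>J. q i * (g i)\<^sup>2 - 2 * m * (q i * g i) + q i * m\<^sup>2)"
    by (intro sum.cong refl) (simp add: power2_eq_square algebra_simps)
  also have "\<dots> = (\<Sum>i\<in>J. q i * (g i)\<^sup>2) - 2 * m * m + m\<^sup>2"
    by (simp add: sum.distrib sum_subtractf q_sum m_def flip: sum_distrib_right sum_distrib_left)
  also have "\<dots> \<le> (\<Sum>i\<in>J. q i * (g i)\<^sup>2)" by (simp add: power2_eq_square)
  finally show ?thesis unfolding m_def[symmetric] iter_mean_sum_list_sq[OF z]
    by (intro mult_left_mono) auto
qed

text \<open>Each draw carries its own fair sign, so a signed sample is again an independent sample,
  now of pairs, and all facts on \<open>iter_mean\<close> apply to it.\<close>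

lemma signed_prob_weights: "prob_weights (J \<times> {1, -1::real}) (\<lambda>(i,\<sigma>). q i / 2)"
proof
  show "(\<Sum>p\<in>J \<times> {1, -1::real}. case p of (i,\<sigma>) \<Rightarrow> q i / 2) = 1"
    using q_sum sum.cartesian_product[of "\<lambda>i \<sigma>. q i / 2" "{1, -1::real}" J] by (simp add: case_prod_unfold)
qed (auto simp: finite_J q_nonneg)

lemma signed_sum:
  "(\<Sum>(i,\<sigma>)\<in>J \<times> {1, -1::real}. q i / 2 * F i \<sigma>) = (\<Sum>i\<in>J. q i * ((F i 1 + F i (-1)) / 2))"
  using sum.cartesian_product[of "\<lambda>i \<sigma>. q i / 2 * F i \<sigma>" "{1, -1::real}" J]
  by (simp add: add_divide_distrib distrib_left)

text \<open>Centring by an independent copy (Jensen) and splitting the two copies by convexity leaves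
  only \<open>\<Psi> (h + 2\<bar>u\<bar>) + \<Psi> (h - 2\<bar>u\<bar>)\<close>; for functionals of maximum type the absolute values can then
  be dropped, since \<open>\<bar>u\<bar>\<close> is pointwise one of \<open>\<plusminus>u\<close> while \<open>-\<bar>u\<bar>\<close> is below both.\<close>

lemma symmetrization_step:
  fixes \<Psi> :: "('x \<Rightarrow> real) \<Rightarrow> real" and u :: "'i \<Rightarrow> 'x \<Rightarrow> real"
  assumes jensen: "\<And>g. \<Psi> (\<lambda>x. \<Sum>i\<in>J. q i * g i x) \<le> (\<Sum>i\<in>J. q i * \<Psi> (g i))"
    and mid: "\<And>a b. \<Psi> (\<lambda>x. (a x + b x) / 2) \<le> (\<Psi> a + \<Psi> b) / 2"
    and fold: "\<And>h v. \<Psi> (\<lambda>x. h x + \<bar>v x\<bar>) + \<Psi> (\<lambda>x. h x - \<bar>v x\<bar>) \<le> \<Psi> (\<lambda>x. h x + v x) + \<Psi> (\<lambda>x. h x - v x)"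
    and s: "s \<in> {1, -1}"
  shows "(\<Sum>i\<in>J. q i * \<Psi> (\<lambda>x. h x + s * (\<bar>u i x\<bar> - (\<Sum>i\<in>J. q i * \<bar>u i x\<bar>))))
    \<le> (\<Sum>(i,\<sigma>)\<in>J \<times> {1, -1::real}. q i / 2 * \<Psi> (\<lambda>x. h x + 2 * \<sigma> * u i x))"
proof -
  define g where "g c i = \<Psi> (\<lambda>x. h x + 2 * c * \<bar>u i x\<bar>)" for c i
  have abs_diff: "(\<Sum>j\<in>J. q j * (h x + s * (\<bar>u i x\<bar> - \<bar>u j x\<bar>))) =
      h x + s * (\<bar>u i x\<bar> - (\<Sum>j\<in>J. q j * \<bar>u j x\<bar>))" for i x
  proof -
    have "(\<Sum>j\<in>J. q j * (h x + s * (\<bar>u i x\<bar> - \<bar>u j x\<bar>))) =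
        (\<Sum>j\<in>J. q j * ((h x + s * \<bar>u i x\<bar>) + - s * \<bar>u j x\<bar>))"
      by (simp add: algebra_simps)
    also have "\<dots> = (h x + s * \<bar>u i x\<bar>) + - s * (\<Sum>j\<in>J. q j * \<bar>u j x\<bar>)"
      unfolding q_avg_add sum_distrib_left by (simp add: mult.left_commute)
    finally show ?thesis by (simp add: algebra_simps)
  qed
  have eq: "h x + s * (\<bar>u i x\<bar> - (\<Sum>i\<in>J. q i * \<bar>u i x\<bar>)) =
      (\<Sum>j\<in>J. q j * (h x + s * (\<bar>u i x\<bar> - \<bar>u j x\<bar>)))" for i x
    by (simp only: abs_diff)
  have "(\<Sum>i\<in>J. q i * \<Psi> (\<lambda>x. h x + s * (\<bar>u i x\<bar> - (\<Sum>i\<in>J. q i * \<bar>u i x\<bar>))))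
      \<le> (\<Sum>i\<in>J. q i * (\<Sum>j\<in>J. q j * \<Psi> (\<lambda>x. h x + s * (\<bar>u i x\<bar> - \<bar>u j x\<bar>))))"
    unfolding eq by (intro sum_mono mult_left_mono jensen q_nonneg)
  also have "\<dots> \<le> (\<Sum>i\<in>J. q i * (\<Sum>j\<in>J. q j * ((g s i + g (- s) j) / 2)))"
  proof (intro sum_mono mult_left_mono q_nonneg)
    fix i j
    \<comment> \<open>The difference of the two copies is the midpoint of two expressions involving
      one copy each, which doubles their coefficients.\<close>
    have "\<Psi> (\<lambda>x. ((h x + 2 * s * \<bar>u i x\<bar>) + (h x + 2 * (- s) * \<bar>u j x\<bar>)) / 2) \<le> (g s i + g (- s) j) / 2"
      unfolding g_def by (rule mid)
    also have "(\<lambda>x. ((h x + 2 * s * \<bar>u i x\<bar>) + (h x + 2 * (- s) * \<bar>u j x\<bar>)) / 2) =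
        (\<lambda>x. h x + s * (\<bar>u i x\<bar> - \<bar>u j x\<bar>))"
      by (auto simp: field_simps)
    finally show "\<Psi> (\<lambda>x. h x + s * (\<bar>u i x\<bar> - \<bar>u j x\<bar>)) \<le> (g s i + g (- s) j) / 2" .
  qed
  also have "\<dots> = (\<Sum>i\<in>J. q i * (g s i / 2 + (\<Sum>j\<in>J. q j * g (- s) j) / 2))"
    unfolding add_divide_distrib q_avg_add
    by (simp add: sum_divide_distrib)
  also have "\<dots> = (\<Sum>i\<in>J. q i * g s i) / 2 + (\<Sum>j\<in>J. q j * g (- s) j) / 2"
    unfolding distrib_left sum.distrib q_avg by (simp add: sum_divide_distrib)
  \<comment> \<open>\<open>s\<close> and \<open>- s\<close> are the signs 1 and -1 in some order, so
    the averages over \<open>i\<close> and over \<open>j\<close> merge into one.\<close>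
  also have "\<dots> = (\<Sum>i\<in>J. q i * ((g 1 i + g (-1) i) / 2))"
    using s by (auto simp: distrib_left sum.distrib sum_divide_distrib add_divide_distrib)
  also have "\<dots> \<le> (\<Sum>i\<in>J. q i * ((\<Psi> (\<lambda>x. h x + 2 * 1 * u i x) + \<Psi> (\<lambda>x. h x + 2 * (-1) * u i x)) / 2))"
  proof (intro sum_mono mult_left_mono q_nonneg divide_right_mono)
    fix i
    show "g 1 i + g (- 1) i \<le> \<Psi> (\<lambda>x. h x + 2 * 1 * u i x) + \<Psi> (\<lambda>x. h x + 2 * (-1) * u i x)"
      using fold[of h "\<lambda>x. 2 * u i x"] by (simp add: g_def abs_mult)
  qed auto
  finally show ?thesis by (simp only: signed_sum)
qed

text \<open>Draws are exchanged one at a time. With \<open>h\<close> arbitrary in the induction, the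
  offset first holds the centred term of the draw split off while the others are replaced, then the
  signed terms of the others while that draw is replaced.\<close>

lemma symmetrization:
  fixes \<Psi> :: "('x \<Rightarrow> real) \<Rightarrow> real" and u :: "'i \<Rightarrow> 'x \<Rightarrow> real"
  assumes jensen: "\<And>g. \<Psi> (\<lambda>x. \<Sum>i\<in>J. q i * g i x) \<le> (\<Sum>i\<in>J. q i * \<Psi> (g i))"
    and mid: "\<And>a b. \<Psi> (\<lambda>x. (a x + b x) / 2) \<le> (\<Psi> a + \<Psi> b) / 2"
    and fold: "\<And>h v. \<Psi> (\<lambda>x. h x + \<bar>v x\<bar>) + \<Psi> (\<lambda>x. h x - \<bar>v x\<bar>) \<le> \<Psi> (\<lambda>x. h x + v x) + \<Psi> (\<lambda>x. h x - v x)"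
    and s: "s \<in> {1, -1}"
  shows "iter_mean J q N (\<lambda>l. \<Psi> (\<lambda>x. h x + sum_list (map (\<lambda>i. s * (\<bar>u i x\<bar> - (\<Sum>i\<in>J. q i * \<bar>u i x\<bar>))) l)))
    \<le> iter_mean (J \<times> {1, -1::real}) (\<lambda>(i,\<sigma>). q i / 2) N
        (\<lambda>l. \<Psi> (\<lambda>x. h x + sum_list (map (\<lambda>(i,\<sigma>). 2 * \<sigma> * u i x) l)))"
proof (induction N arbitrary: h)
  case (Suc N)
  let ?c = "\<lambda>i x. s * (\<bar>u i x\<bar> - (\<Sum>i\<in>J. q i * \<bar>u i x\<bar>))"
  let ?S = "\<lambda>l x. sum_list (map (\<lambda>(i,\<sigma>). 2 * \<sigma> * u i x) l)"
  let ?E = "iter_mean (J \<times> {1, -1::real}) (\<lambda>(i,\<sigma>). q i / 2)"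
  interpret sg: prob_weights "J \<times> {1, -1::real}" "\<lambda>(i,\<sigma>). q i / 2" by (rule signed_prob_weights)
  have "iter_mean J q (Suc N) (\<lambda>l. \<Psi> (\<lambda>x. h x + sum_list (map (\<lambda>i. ?c i x) l)))
      = (\<Sum>i\<in>J. q i * iter_mean J q N (\<lambda>l. \<Psi> (\<lambda>x. (h x + ?c i x) + sum_list (map (\<lambda>i. ?c i x) l))))"
    by (simp add: add.assoc)
  also have "\<dots> \<le> (\<Sum>i\<in>J. q i * ?E N (\<lambda>l. \<Psi> (\<lambda>x. (h x + ?c i x) + ?S l x)))"
    by (intro sum_mono mult_left_mono q_nonneg Suc.IH)
  also have "\<dots> = ?E N (\<lambda>l. \<Sum>i\<in>J. q i * \<Psi> (\<lambda>x. (h x + ?S l x) + ?c i x))"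
    by (simp add: iter_mean_sum iter_mean_cmult add_ac)
  also have "\<dots> \<le> ?E N (\<lambda>l. \<Sum>(i,\<sigma>)\<in>J \<times> {1, -1::real}. q i / 2 * \<Psi> (\<lambda>x. (h x + ?S l x) + 2 * \<sigma> * u i x))"
    by (intro sg.iter_mean_mono symmetrization_step assms)
  also have "\<dots> = ?E (Suc N) (\<lambda>l. \<Psi> (\<lambda>x. h x + ?S l x))"
    unfolding case_prod_unfold iter_mean_sum iter_mean_cmult by (simp add: add_ac)
  finally show ?case .
qed simp

end

text \<open>Supplies the three hypotheses of \<open>symmetrization\<close>. In the third, one
  maximum on the left is at most the larger and the other at most the smaller of the two terms on
  the right. Applied with \<open>\<phi>\<close> the identity for mean deviations and an exponential
  for tails.\<close>

lemma finite_Max_functional: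
  fixes \<phi> :: "real \<Rightarrow> real"
  assumes X: "finite X" "X \<noteq> {}" and mono: "mono \<phi>" and conv: "convex_on UNIV \<phi>"
  defines "\<Psi> \<equiv> \<lambda>h. Max ((\<lambda>x. \<phi> (h x)) ` X)"
  shows "finite J \<Longrightarrow> (\<And>i. i \<in> J \<Longrightarrow> 0 \<le> q i) \<Longrightarrow> sum q J = (1::real) \<Longrightarrow>
      \<Psi> (\<lambda>x. \<Sum>i\<in>J. q i * g i x) \<le> (\<Sum>i\<in>J. q i * \<Psi> (g i))"
    and "\<Psi> (\<lambda>x. (a x + b x) / 2) \<le> (\<Psi> a + \<Psi> b) / 2"
    and "\<Psi> (\<lambda>x. h x + \<bar>v x\<bar>) + \<Psi> (\<lambda>x. h x - \<bar>v x\<bar>) \<le> \<Psi> (\<lambda>x. h x + v x) + \<Psi> (\<lambda>x. h x - v x)"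
proof -
  have ub: "\<phi> (h x) \<le> \<Psi> h" if "x \<in> X" for h x
    using that X by (auto simp: \<Psi>_def)
  have lub: "\<Psi> h \<le> c" if "\<And>x. x \<in> X \<Longrightarrow> \<phi> (h x) \<le> c" for h c
    using that X by (auto simp: \<Psi>_def)
  show "\<Psi> (\<lambda>x. \<Sum>i\<in>J. q i * g i x) \<le> (\<Sum>i\<in>J. q i * \<Psi> (g i))"
    if "finite J" "\<And>i. i \<in> J \<Longrightarrow> 0 \<le> q i" "sum q J = (1::real)"
  proof (rule lub)
    fix x assume x: "x \<in> X"
    have "J \<noteq> {}" using that by auto
    then have "\<phi> (\<Sum>i\<in>J. q i * g i x) \<le> (\<Sum>i\<in>J. q i * \<phi> (g i x))"
      using convex_on_sum[of J UNIV \<phi> q "\<lambda>i. g i x"] that conv by simp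
    also have "\<dots> \<le> (\<Sum>i\<in>J. q i * \<Psi> (g i))"
      by (intro sum_mono mult_left_mono ub x that)
    finally show "\<phi> (\<Sum>i\<in>J. q i * g i x) \<le> (\<Sum>i\<in>J. q i * \<Psi> (g i))" .
  qed
  show "\<Psi> (\<lambda>x. (a x + b x) / 2) \<le> (\<Psi> a + \<Psi> b) / 2"
  proof (rule lub)
    fix x assume x: "x \<in> X"
    have "\<phi> ((1 - 1/2) *\<^sub>R a x + (1/2) *\<^sub>R b x) \<le> (1 - 1/2) * \<phi> (a x) + (1/2) * \<phi> (b x)"
      by (rule convex_onD[OF conv]) auto
    then have "\<phi> ((a x + b x) / 2) \<le> (\<phi> (a x) + \<phi> (b x)) / 2" by (simp add: add_divide_distrib)
    also have "\<dots> \<le> (\<Psi> a + \<Psi> b) / 2" using ub[OF x, of a] ub[OF x, of b] by simp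
    finally show "\<phi> ((a x + b x) / 2) \<le> (\<Psi> a + \<Psi> b) / 2" .
  qed
  have "\<Psi> (\<lambda>x. h x + \<bar>v x\<bar>) \<le> max (\<Psi> (\<lambda>x. h x + v x)) (\<Psi> (\<lambda>x. h x - v x))"
  proof (rule lub)
    fix x assume x: "x \<in> X"
    show "\<phi> (h x + \<bar>v x\<bar>) \<le> max (\<Psi> (\<lambda>x. h x + v x)) (\<Psi> (\<lambda>x. h x - v x))"
      using ub[OF x, of "\<lambda>x. h x + v x"] ub[OF x, of "\<lambda>x. h x - v x"] by (cases "v x \<ge> 0") auto
  qed
  moreover have "\<Psi> (\<lambda>x. h x - \<bar>v x\<bar>) \<le> min (\<Psi> (\<lambda>x. h x + v x)) (\<Psi> (\<lambda>x. h x - v x))"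
  proof (rule lub)
    fix x assume x: "x \<in> X"
    have "\<phi> (h x - \<bar>v x\<bar>) \<le> \<phi> (h x + v x)" "\<phi> (h x - \<bar>v x\<bar>) \<le> \<phi> (h x - v x)"
      using mono by (auto intro!: monoD[OF mono])
    then show "\<phi> (h x - \<bar>v x\<bar>) \<le> min (\<Psi> (\<lambda>x. h x + v x)) (\<Psi> (\<lambda>x. h x - v x))"
      using ub[OF x, of "\<lambda>x. h x + v x"] ub[OF x, of "\<lambda>x. h x - v x"] by auto
  qed
  ultimately show "\<Psi> (\<lambda>x. h x + \<bar>v x\<bar>) + \<Psi> (\<lambda>x. h x - \<bar>v x\<bar>) \<le> \<Psi> (\<lambda>x. h x + v x) + \<Psi> (\<lambda>x. h x - v x)"
    by linarith
qed

section \<open>Sampling by approximate Lewis weights\<close>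

lemma cosh_le_one_plus_square:
  assumes "\<bar>t::real\<bar> \<le> 1"
  shows "(exp t + exp (- t)) / 2 \<le> 1 + t\<^sup>2"
proof -
  have *: "(exp x + exp (- x)) / 2 \<le> 1 + x\<^sup>2" if x: "0 \<le> x" "x \<le> 1" for x :: real
  proof -
    have "exp x \<le> 1 + x + x\<^sup>2" using x by (rule exp_bound)
    moreover have "exp (- x) \<le> 1 - x + x\<^sup>2"
    proof -
      have "exp (- x) = 1 / exp x" by (simp add: exp_minus field_simps)
      also have "\<dots> \<le> 1 / (1 + x)" using x by (intro divide_left_mono) (auto simp: exp_ge_add_one_self)
      also have "\<dots> \<le> 1 - x + x\<^sup>2"
      proof -
        have "1 \<le> (1 - x + x\<^sup>2) * (1 + x)" using x by (simp add: power2_eq_square algebra_simps)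
        then show ?thesis using x by (simp add: pos_divide_le_eq)
      qed
      finally show ?thesis .
    qed
    ultimately show ?thesis by simp
  qed
  show ?thesis using *[of "\<bar>t\<bar>"] assms by (cases "0 \<le> t") (auto simp: add.commute)
qed

text \<open>\<open>V\<close> is the column space as functions of the row index, and \<open>w\<close>
  are approximate Lewis weights up to \<open>\<kappa>\<close>. In \<open>reproducing\<close> the
  rows are picked by \<open>idx\<close>, possibly with repetition, and rescaled by \<open>c\<close>;
  it is used once for all rows in \<open>J\<close>, scaled by \<open>1 / sqrt (w k)\<close>, and
  once for a sample.\<close>

locale lewis_space =
  fixes J :: "nat set" and w :: "nat \<Rightarrow> real" and V :: "(nat \<Rightarrow> real) set" and \<kappa> :: real
  assumes fin: "finite J" and ne: "J \<noteq> {}" and w_pos: "i \<in> J \<Longrightarrow> 0 < w i" and \<kappa>: "1 \<le> \<kappa>"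
    and lin: "f \<in> V \<Longrightarrow> g \<in> V \<Longrightarrow> (\<lambda>i. a * f i + b * g i) \<in> V" and zero: "(\<lambda>i. 0) \<in> V"
    and reproducing: "\<And>(m::nat) (c::nat \<Rightarrow> real) (idx::nat \<Rightarrow> nat). \<exists>\<mu>. (\<forall>k<m. \<mu> k \<in> V) \<and>
      (\<forall>f\<in>V. \<forall>k<m. c k * f (idx k) = (\<Sum>l<m. (c k * \<mu> l (idx k)) * (c l * f (idx l)))) \<and>
      (\<forall>k<m. \<forall>l<m. c k * \<mu> l (idx k) = c l * \<mu> k (idx l))"
    and leverage: "f \<in> V \<Longrightarrow> i \<in> J \<Longrightarrow> (f i)\<^sup>2 \<le> \<kappa> * (w i)\<^sup>2 * (\<Sum>j\<in>J. (f j)\<^sup>2 / w j)"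
begin

definition Q :: "(nat \<Rightarrow> real) \<Rightarrow> real" where "Q f = (\<Sum>j\<in>J. (f j)\<^sup>2 / w j)"

definition nrm :: "(nat \<Rightarrow> real) \<Rightarrow> real" where "nrm f = (\<Sum>j\<in>J. \<bar>f j\<bar>)"

definition D :: real where "D = sum w J"

definition q :: "nat \<Rightarrow> real" where "q i = w i / D"

lemma D_pos: "0 < D"
  unfolding D_def using fin ne w_pos by (intro sum_pos) auto

sublocale prob_weights J q
proof
  show "0 \<le> q i" if "i \<in> J" for i using w_pos[OF that] D_pos by (simp add: q_def)
  have "sum q J = sum w J / D" unfolding q_def by (simp add: sum_divide_distrib)
  then show "sum q J = 1" using D_pos by (simp add: D_def)
qed (rule fin)

lemma Q_nonneg: "0 \<le> Q f"
  unfolding Q_def by (intro sum_nonneg divide_nonneg_nonneg) (auto intro: less_imp_le[OF w_pos])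

lemma nrm_nonneg: "0 \<le> nrm f"
  by (simp add: nrm_def sum_nonneg)

lemma scale: "f \<in> V \<Longrightarrow> (\<lambda>i. a * f i) \<in> V"
  using lin[of f f a 0] by simp

lemma lincomb: "finite A \<Longrightarrow> (\<And>k. k \<in> A \<Longrightarrow> p k \<in> V) \<Longrightarrow> (\<lambda>i. \<Sum>k\<in>A. a k * p k i) \<in> V"
proof (induction A rule: finite_induct)
  case (insert x A)
  then show ?case using lin[of "p x" "\<lambda>i. \<Sum>k\<in>A. a k * p k i" "a x" 1] by simp
qed (use zero in simp)

lemma Q_scale: "Q (\<lambda>i. a * f i) = a\<^sup>2 * Q f"
  by (simp add: Q_def sum_distrib_left power_mult_distrib)

lemma nrm_scale: "nrm (\<lambda>i. a * f i) = \<bar>a\<bar> * nrm f"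
  by (simp add: nrm_def sum_distrib_left abs_mult)

lemma leverage_Q: "f \<in> V \<Longrightarrow> i \<in> J \<Longrightarrow> (f i)\<^sup>2 \<le> \<kappa> * (w i)\<^sup>2 * Q f"
  using leverage by (simp add: Q_def)

lemma Q_0:
  assumes "f \<in> V" "Q f \<le> 0" "i \<in> J"
  shows "f i = 0"
proof -
  have "\<kappa> * (w i)\<^sup>2 * Q f \<le> 0"
    using \<kappa> assms(2) by (intro mult_nonneg_nonpos) auto
  then have "(f i)\<^sup>2 \<le> 0" using leverage_Q[OF assms(1,3)] by linarith
  then show ?thesis by simp
qed

lemma leverage_sqrt:
  assumes "f \<in> V" "i \<in> J"
  shows "\<bar>f i\<bar> / w i \<le> sqrt (\<kappa> * Q f)"
proof (rule real_le_rsqrt)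
  show "(\<bar>f i\<bar> / w i)\<^sup>2 \<le> \<kappa> * Q f"
    using leverage_Q[OF assms] w_pos[OF assms(2)] by (simp add: power_divide field_simps)
qed

text \<open>\<open>Q f\<close> is at most \<open>nrm f\<close> times the maximum of
  \<open>\<bar>f j\<bar> / w j\<close>, and this maximum is itself at most
  \<open>sqrt (\<kappa> * Q f)\<close>; one factor \<open>sqrt (Q f)\<close> cancels.\<close>

lemma sqrt_Q_le:
  assumes f: "f \<in> V"
  shows "sqrt (Q f) \<le> sqrt \<kappa> * nrm f"
proof (cases "Q f = 0")
  case False
  then have Qp: "0 < Q f" using Q_nonneg[of f] by simp
  have "Q f = (\<Sum>j\<in>J. \<bar>f j\<bar> * (\<bar>f j\<bar> / w j))"
    by (simp add: Q_def power2_eq_square flip: abs_mult)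
  also have "\<dots> \<le> (\<Sum>j\<in>J. \<bar>f j\<bar> * sqrt (\<kappa> * Q f))"
    by (intro sum_mono mult_left_mono leverage_sqrt f) auto
  also have "\<dots> = nrm f * sqrt \<kappa> * sqrt (Q f)"
    by (simp add: nrm_def sum_distrib_right real_sqrt_mult mult.assoc)
  finally have "sqrt (Q f) * sqrt (Q f) \<le> (sqrt \<kappa> * nrm f) * sqrt (Q f)" using Qp by (simp add: mult_ac)
  then show ?thesis by (rule mult_right_le_imp_le) (simp add: Qp)
qed (use nrm_nonneg \<kappa> in simp)

lemma nrm_0: "f \<in> V \<Longrightarrow> nrm f = 0 \<Longrightarrow> i \<in> J \<Longrightarrow> f i = 0"
  using fin by (simp add: nrm_def sum_nonneg_eq_0_iff)

text \<open>The coordinates \<open>f l / sqrt (w l)\<close> turn the energy into a Euclidean square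
  norm, and \<open>h i\<close> represents evaluation at \<open>i\<close>. The norm bound is the
  leverage inequality tested on the kernel column \<open>\<mu> i\<close>, whose energy and diagonal
  value are both multiples of the square norm of \<open>h i\<close>.\<close>

lemma reproducing_rows:
  obtains h where "\<And>f i. f \<in> V \<Longrightarrow> i \<in> J \<Longrightarrow> f i = (\<Sum>l\<in>J. h i l * (f l / sqrt (w l)))"
    and "\<And>i. i \<in> J \<Longrightarrow> (\<Sum>l\<in>J. (h i l)\<^sup>2) \<le> \<kappa> * (w i)\<^sup>2"
proof -
  define m where "m = Suc (Max J)"
  have Jm: "J \<subseteq> {..<m}" using fin by (auto simp: m_def less_Suc_eq_le)
  \<comment> \<open>\<open>reproducing\<close> ranges over the initial segment
    \<open>{..<m}\<close>; the coefficient 0 removes the indices outside \<open>J\<close>.\<close>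
  define c where "c k = (if k \<in> J then 1 / sqrt (w k) else 0)" for k
  obtain \<mu> where \<mu>: "\<And>k. k < m \<Longrightarrow> \<mu> k \<in> V"
    and rep: "\<And>f k. f \<in> V \<Longrightarrow> k < m \<Longrightarrow> c k * f k = (\<Sum>l<m. (c k * \<mu> l k) * (c l * f l))"
    and sym: "\<And>k l. k < m \<Longrightarrow> l < m \<Longrightarrow> c k * \<mu> l k = c l * \<mu> k l"
    using reproducing[of m c "\<lambda>k. k"] by blast
  define h where "h i l = \<mu> l i" for i l
  have rJ: "f i = (\<Sum>l\<in>J. h i l * (f l / sqrt (w l)))" if f: "f \<in> V" and i: "i \<in> J" for f i
  proof -
    have im: "i < m" using i Jm by auto
    have "c i * f i = (\<Sum>l<m. (c i * \<mu> l i) * (c l * f l))" by (rule rep[OF f im])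
    also have "\<dots> = (\<Sum>l\<in>J. (c i * \<mu> l i) * (c l * f l))"
      using Jm by (intro sum.mono_neutral_right) (auto simp: c_def)
    also have "\<dots> = c i * (\<Sum>l\<in>J. h i l * (f l / sqrt (w l)))"
      by (simp add: sum_distrib_left c_def h_def)
    finally show ?thesis using i w_pos[OF i] by (simp add: c_def)
  qed
  have hJ: "(\<Sum>l\<in>J. (h i l)\<^sup>2) \<le> \<kappa> * (w i)\<^sup>2" if i: "i \<in> J" for i
  proof -
    have V: "\<mu> i \<in> V" using \<mu> i Jm by auto
    have wi: "0 < w i" by (rule w_pos[OF i])
    have eq: "\<mu> i l / sqrt (w l) = h i l / sqrt (w i)" if l: "l \<in> J" for l
      using sym[of i l] i l Jm by (auto simp: c_def h_def subset_iff)
    have "(\<Sum>l\<in>J. (h i l)\<^sup>2) / sqrt (w i) = (\<Sum>l\<in>J. h i l * (\<mu> i l / sqrt (w l)))"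
      unfolding sum_divide_distrib by (intro sum.cong refl) (simp add: eq power2_eq_square)
    also have "\<dots> = \<mu> i i" by (rule rJ[OF V i, symmetric])
    finally have 1: "\<mu> i i = (\<Sum>l\<in>J. (h i l)\<^sup>2) / sqrt (w i)" by simp
    have "Q (\<mu> i) = (\<Sum>l\<in>J. (\<mu> i l / sqrt (w l))\<^sup>2)"
      unfolding Q_def by (intro sum.cong refl) (simp add: power_divide w_pos less_imp_le)
    also have "\<dots> = (\<Sum>l\<in>J. (h i l)\<^sup>2) / w i"
      unfolding sum_divide_distrib using wi by (intro sum.cong refl) (simp add: eq power_divide)
    finally have 2: "Q (\<mu> i) = (\<Sum>l\<in>J. (h i l)\<^sup>2) / w i" .
    define s where "s = (\<Sum>l\<in>J. (h i l)\<^sup>2)"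
    have s0: "0 \<le> s" by (simp add: s_def sum_nonneg)
    have "(s / sqrt (w i))\<^sup>2 \<le> \<kappa> * (w i)\<^sup>2 * (s / w i)"
      using leverage_Q[OF V i] by (simp add: 1 2 s_def)
    then have "s * s \<le> (\<kappa> * (w i)\<^sup>2) * s"
      using wi by (simp add: power_divide field_simps power2_eq_square)
    then have "s \<le> \<kappa> * (w i)\<^sup>2"
      using s0 \<kappa> by (cases "s = 0") auto
    then show ?thesis by (simp add: s_def)
  qed
  show thesis using that rJ hJ by blast
qed

lemma sum_list_samples: "l \<in> samples J m \<Longrightarrow> (\<And>i. i \<in> J \<Longrightarrow> g i = g' i) \<Longrightarrow>
    sum_list (map g l) = sum_list (map g' l)"
  by (auto simp: samples_def intro!: arg_cong[of _ _ sum_list] map_cong)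

text \<open>In the coordinates \<open>f j / sqrt (w j)\<close> the sampled energy is a random
  quadratic form with mean \<open>Q\<close> on \<open>V\<close>, and \<open>Z\<close> is the squared
  Frobenius norm of its error matrix. Cauchy-Schwarz over pairs of indices bounds the error for all
  \<open>f\<close> at once, and the mean of \<open>Z\<close> is a sum of entrywise
  variances.\<close>

lemma spectral_deviation:
  assumes m: "0 < m"
  obtains Z where "\<And>l. 0 \<le> Z l" and "iter_mean J q m Z \<le> D\<^sup>2 * \<kappa>\<^sup>2 / real m"
    and "\<And>f l. f \<in> V \<Longrightarrow> l \<in> samples J m \<Longrightarrow>
      (sum_list (map (\<lambda>i. D * (f i)\<^sup>2 / (real m * (w i)\<^sup>2)) l) - Q f)\<^sup>2 \<le> (Q f)\<^sup>2 * Z l"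
proof -
  obtain h where h: "\<And>f i. f \<in> V \<Longrightarrow> i \<in> J \<Longrightarrow> f i = (\<Sum>l\<in>J. h i l * (f l / sqrt (w l)))"
    and hn: "\<And>i. i \<in> J \<Longrightarrow> (\<Sum>l\<in>J. (h i l)\<^sup>2) \<le> \<kappa> * (w i)\<^sup>2"
    using reproducing_rows by blast
  let ?E = "iter_mean J q m"
  have mp: "0 < real m" using m by simp
  \<comment> \<open>Entry \<open>(j, j')\<close> of the rank-one form contributed by a drawn row
    \<open>i\<close>; its factor is \<open>1 / (m * q i * w i)\<close>.\<close>
  define X where "X j j' i = D / (real m * (w i)\<^sup>2) * (h i j * h i j')" for j j' i
  define F where "F l j j' = sum_list (map (\<lambda>i. X j j' i - (\<Sum>i\<in>J. q i * X j j' i)) l)" for l j j'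
  define Z2 where "Z2 l = (\<Sum>j\<in>J. \<Sum>j'\<in>J. (F l j j')\<^sup>2)" for l
  have EZ2: "?E Z2 \<le> D\<^sup>2 * \<kappa>\<^sup>2 / real m"
  proof -
    have "?E Z2 = (\<Sum>j\<in>J. \<Sum>j'\<in>J. ?E (\<lambda>l. (F l j j')\<^sup>2))"
      unfolding Z2_def by (simp add: iter_mean_sum)
    also have "\<dots> \<le> (\<Sum>j\<in>J. \<Sum>j'\<in>J. real m * (\<Sum>i\<in>J. q i * (X j j' i)\<^sup>2))"
      unfolding F_def by (intro sum_mono iter_mean_sum_list_sq_le)
    also have "\<dots> = real m * (\<Sum>i\<in>J. \<Sum>j\<in>J. \<Sum>j'\<in>J. q i * (X j j' i)\<^sup>2)"
    proof -
      have "(\<Sum>j\<in>J. \<Sum>j'\<in>J. \<Sum>i\<in>J. q i * (X j j' i)\<^sup>2) = (\<Sum>j\<in>J. \<Sum>i\<in>J. \<Sum>j'\<in>J. q i * (X j j' i)\<^sup>2)"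
        by (intro sum.cong refl sum.swap)
      also have "\<dots> = (\<Sum>i\<in>J. \<Sum>j\<in>J. \<Sum>j'\<in>J. q i * (X j j' i)\<^sup>2)" by (rule sum.swap)
      finally show ?thesis by (simp flip: sum_distrib_left)
    qed
    also have "\<dots> = real m * (\<Sum>i\<in>J. q i * ((D / (real m * (w i)\<^sup>2))\<^sup>2 * (\<Sum>l\<in>J. (h i l)\<^sup>2)\<^sup>2))"
    proof -
      have "(\<Sum>j\<in>J. \<Sum>j'\<in>J. q i * (X j j' i)\<^sup>2) =
          q i * ((D / (real m * (w i)\<^sup>2))\<^sup>2 * (\<Sum>l\<in>J. (h i l)\<^sup>2)\<^sup>2)" for i
        unfolding X_def power_mult_distrib power2_eq_square[of "sum _ _"] sum_product
        unfolding sum_distrib_left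
        by (simp add: mult_ac)
      then show ?thesis by simp
    qed
    also have "\<dots> \<le> real m * (\<Sum>i\<in>J. q i * ((D / (real m * (w i)\<^sup>2))\<^sup>2 * (\<kappa> * (w i)\<^sup>2)\<^sup>2))"
      by (intro mult_left_mono sum_mono power_mono hn q_nonneg) (auto simp: sum_nonneg)
    also have "\<dots> = real m * (\<Sum>i\<in>J. q i * (D\<^sup>2 * \<kappa>\<^sup>2 / (real m)\<^sup>2))"
    proof (intro arg_cong2[of _ _ _ _ "(*)"] sum.cong refl)
      fix i assume "i \<in> J"
      then show "(D / (real m * (w i)\<^sup>2))\<^sup>2 * (\<kappa> * (w i)\<^sup>2)\<^sup>2 = D\<^sup>2 * \<kappa>\<^sup>2 / (real m)\<^sup>2"
        using w_pos[of i] by (simp add: power_mult_distrib power_divide)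
    qed
    also have "\<dots> = D\<^sup>2 * \<kappa>\<^sup>2 / real m" unfolding q_avg using mp by (simp add: power2_eq_square)
    finally show ?thesis .
  qed

  have Qhat: "(sum_list (map (\<lambda>i. D * (f i)\<^sup>2 / (real m * (w i)\<^sup>2)) l) - Q f)\<^sup>2 \<le> (Q f)\<^sup>2 * Z2 l"
    if f: "f \<in> V" and l: "l \<in> samples J m" for f l
  proof -
    define y where "y j = f j / sqrt (w j)" for j
    have fy: "f i = (\<Sum>l\<in>J. h i l * y l)" if "i \<in> J" for i using h[OF f that] by (simp add: y_def)
    have Qy: "Q f = (\<Sum>j\<in>J. (y j)\<^sup>2)"
      unfolding Q_def y_def by (intro sum.cong refl) (simp add: power_divide w_pos less_imp_le)
    have sq: "D * (f i)\<^sup>2 / (real m * (w i)\<^sup>2) = (\<Sum>j\<in>J. \<Sum>j'\<in>J. y j * y j' * X j j' i)" if i: "i \<in> J" for i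
      unfolding X_def fy[OF i] power2_eq_square sum_product
      by (simp add: sum_distrib_left sum_divide_distrib mult_ac)
    have qX: "Q f = real m * (\<Sum>j\<in>J. \<Sum>j'\<in>J. y j * y j' * (\<Sum>i\<in>J. q i * X j j' i))"
    proof -
      have "(\<Sum>j\<in>J. \<Sum>j'\<in>J. y j * y j' * (\<Sum>i\<in>J. q i * X j j' i)) =
          (\<Sum>j\<in>J. \<Sum>j'\<in>J. \<Sum>i\<in>J. q i * (y j * y j' * X j j' i))"
        by (simp add: sum_distrib_left mult_ac)
      also have "\<dots> = (\<Sum>j\<in>J. \<Sum>i\<in>J. \<Sum>j'\<in>J. q i * (y j * y j' * X j j' i))"
        by (intro sum.cong refl sum.swap)
      also have "\<dots> = (\<Sum>i\<in>J. \<Sum>j\<in>J. \<Sum>j'\<in>J. q i * (y j * y j' * X j j' i))" by (rule sum.swap)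
      also have "\<dots> = (\<Sum>i\<in>J. q i * (D * (f i)\<^sup>2 / (real m * (w i)\<^sup>2)))"
        by (intro sum.cong refl) (simp add: sq flip: sum_distrib_left)
      also have "\<dots> = Q f / real m"
        unfolding Q_def sum_divide_distrib using w_pos D_pos mp
        by (intro sum.cong refl) (force simp: q_def power2_eq_square field_simps)
      finally show ?thesis using mp by simp
    qed
    have len: "length l = m" using l by (simp add: samples_def)
    have sl: "sum_list (map (\<lambda>i. g i - c) l) = sum_list (map g l) - real m * c" for g :: "nat \<Rightarrow> real" and c
      using len by (simp add: sum_list_subtractf sum_list_triv)
    have "sum_list (map (\<lambda>i. D * (f i)\<^sup>2 / (real m * (w i)\<^sup>2)) l) =
        sum_list (map (\<lambda>i. \<Sum>j\<in>J. \<Sum>j'\<in>J. y j * y j' * X j j' i) l)"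
      by (rule sum_list_samples[OF l sq])
    also have "\<dots> = (\<Sum>j\<in>J. \<Sum>j'\<in>J. y j * y j' * sum_list (map (X j j') l))"
      by (induction l) (simp_all add: sum.distrib distrib_left)
    finally have "sum_list (map (\<lambda>i. D * (f i)\<^sup>2 / (real m * (w i)\<^sup>2)) l) - Q f =
        (\<Sum>j\<in>J. \<Sum>j'\<in>J. (y j * y j') * F l j j')"
      unfolding F_def sl qX by (simp add: sum_subtractf right_diff_distrib sum_distrib_left mult_ac)
    also have "\<dots> = (\<Sum>(j,j')\<in>J \<times> J. (y j * y j') * F l j j')" by (simp add: sum.cartesian_product)
    finally have "(sum_list (map (\<lambda>i. D * (f i)\<^sup>2 / (real m * (w i)\<^sup>2)) l) - Q f)\<^sup>2 =
        (\<Sum>p\<in>J \<times> J. (y (fst p) * y (snd p)) * F l (fst p) (snd p))\<^sup>2" by (simp add: case_prod_unfold)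
    also have "\<dots> \<le> (\<Sum>p\<in>J \<times> J. (y (fst p) * y (snd p))\<^sup>2) * (\<Sum>p\<in>J \<times> J. (F l (fst p) (snd p))\<^sup>2)"
      by (rule Cauchy_Schwarz_ineq_sum)
    also have "(\<Sum>p\<in>J \<times> J. (y (fst p) * y (snd p))\<^sup>2) = (Q f)\<^sup>2"
      unfolding Qy power2_eq_square[of "sum _ _"] sum_product sum.cartesian_product
      by (simp add: case_prod_unfold power_mult_distrib)
    also have "(\<Sum>p\<in>J \<times> J. (F l (fst p) (snd p))\<^sup>2) = Z2 l"
      unfolding Z2_def sum.cartesian_product by (simp add: case_prod_unfold)
    finally show ?thesis .
  qed

  have "0 \<le> Z2 l" for l by (simp add: Z2_def sum_nonneg)
  then show thesis using that EZ2 Qhat by blast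
qed

section \<open>Mean deviation of the sampled l1 norm on the energy ball\<close>

definition dev :: "nat \<Rightarrow> nat list \<Rightarrow> (nat \<Rightarrow> real) \<Rightarrow> real" where
  "dev m l f = sum_list (map (\<lambda>i. D * \<bar>f i\<bar> / (real m * w i)) l) - nrm f"

lemma abs_weight: "i \<in> J \<Longrightarrow> \<bar>D * f i / (real m * w i)\<bar> = D * \<bar>f i\<bar> / (real m * w i)"
  using w_pos[of i] D_pos by (simp add: abs_mult)

text \<open>\<open>D / (real m * w i)\<close> is \<open>1 / (real m * q i)\<close>, so the rescaled
  sample sum estimates \<open>nrm f\<close> without bias.\<close>

lemma mean_abs_weight:
  assumes "0 < m"
  shows "(\<Sum>i\<in>J. q i * \<bar>D * f i / (real m * w i)\<bar>) = nrm f / real m"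
proof -
  have "(\<Sum>i\<in>J. q i * \<bar>D * f i / (real m * w i)\<bar>) = (\<Sum>i\<in>J. \<bar>f i\<bar> / real m)"
  proof (intro sum.cong refl)
    fix i assume i: "i \<in> J"
    show "q i * \<bar>D * f i / (real m * w i)\<bar> = \<bar>f i\<bar> / real m"
      unfolding abs_weight[OF i] using w_pos[OF i] D_pos assms by (simp add: q_def)
  qed
  then show ?thesis by (simp add: nrm_def sum_divide_distrib)
qed

lemma dev_eq:
  assumes "0 < m" "l \<in> samples J m"
  shows "sum_list (map (\<lambda>i. s * (\<bar>D * f i / (real m * w i)\<bar> -
      (\<Sum>i\<in>J. q i * \<bar>D * f i / (real m * w i)\<bar>))) l) = s * dev m l f"
proof -
  have "sum_list (map (\<lambda>i. s * (\<bar>D * f i / (real m * w i)\<bar> - nrm f / real m)) l) =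
      s * (sum_list (map (\<lambda>i. \<bar>D * f i / (real m * w i)\<bar>) l) - real (length l) * (nrm f / real m))"
    by (induction l) (simp_all only: list.map sum_list.Cons sum_list.Nil length_Cons of_nat_Suc, simp_all add: algebra_simps add_divide_distrib)
  then show ?thesis
    using assms sum_list_samples[OF assms(2) abs_weight[of _ f m]]
    unfolding mean_abs_weight[OF assms(1)] by (simp add: dev_def samples_def)
qed

text \<open>After symmetrization the maximum is that of a linear functional over functions of energy
  at most 1. It is controlled by the Euclidean norm of a random vector \<open>Z\<close> whose mean
  square is at most \<open>m * \<kappa>\<close>.\<close>

lemma l1_deviation:
  assumes m: "0 < m" and Y: "finite Y" "Y \<noteq> {}" "\<And>f. f \<in> Y \<Longrightarrow> f \<in> V \<and> Q f \<le> 1"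
  shows "iter_mean J q m (\<lambda>l. Max (dev m l ` Y)) \<le> 2 * D * sqrt (\<kappa> / real m)"
proof -
  obtain h where h: "\<And>f i. f \<in> V \<Longrightarrow> i \<in> J \<Longrightarrow> f i = (\<Sum>l\<in>J. h i l * (f l / sqrt (w l)))"
    and hn: "\<And>i. i \<in> J \<Longrightarrow> (\<Sum>l\<in>J. (h i l)\<^sup>2) \<le> \<kappa> * (w i)\<^sup>2"
    using reproducing_rows by blast
  interpret sg: prob_weights "J \<times> {1, -1::real}" "\<lambda>(i,\<sigma>). q i / 2" by (rule signed_prob_weights)
  let ?E = "iter_mean J q m"
  let ?E2 = "iter_mean (J \<times> {1, -1::real}) (\<lambda>(i,\<sigma>). q i / 2) m"
  have mp: "0 < real m" using m by simp
  define u where "u i f = D * f i / (real m * w i)" for i and f :: "nat \<Rightarrow> real"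
    define S where "S l f = sum_list (map (\<lambda>(i,\<sigma>). 2 * \<sigma> * u i f) l)" for l f
    define Z where "Z l j = sum_list (map (\<lambda>(i,\<sigma>). \<sigma> * h i j / w i) l)" for l :: "(nat \<times> real) list" and j
    \<comment> \<open>The inequality \<open>y * z \<le> (s * y\<^sup>2 + z\<^sup>2 / s) / 2\<close>
      replaces Cauchy-Schwarz, so that no mean of a square root arises. With
      \<open>s\<^sup>2\<close> the bound on the mean square of \<open>Z\<close>, both terms
      contribute equally.\<close>
    define s where "s = sqrt (real m * \<kappa>)"
    have s: "0 < s" using mp \<kappa> by (simp add: s_def)
    let ?d = "\<lambda>l f. sum_list (map (\<lambda>i. 1 * (\<bar>u i f\<bar> - (\<Sum>i\<in>J. q i * \<bar>u i f\<bar>))) l)"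
    have "?E (\<lambda>l. Max (dev m l ` Y)) = ?E (\<lambda>l. Max ((\<lambda>f. 0 + ?d l f) ` Y))"
      by (intro iter_mean_cong) (simp only: u_def dev_eq[OF m, of _ 1, unfolded mult_1] add_0 mult_1)
    also have "\<dots> \<le> ?E2 (\<lambda>l. Max ((\<lambda>f. 0 + S l f) ` Y))"
      unfolding S_def
    proof (rule symmetrization[where \<Psi> = "\<lambda>h. Max (h ` Y)" and h = "\<lambda>x. 0"])
      have id: "mono (\<lambda>x::real. x)" "convex_on UNIV (\<lambda>x::real. x)"
        by (auto simp: mono_def convex_on_def)
      note M = finite_Max_functional[OF Y(1,2) id]
      show "Max ((\<lambda>x. \<Sum>i\<in>J. q i * g i x) ` Y) \<le> (\<Sum>i\<in>J. q i * Max (g i ` Y))" for g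
        using M(1)[OF finite_J q_nonneg q_sum] by simp
      show "Max ((\<lambda>x. (a x + b x) / 2) ` Y) \<le> (Max (a ` Y) + Max (b ` Y)) / 2" for a b :: "(nat \<Rightarrow> real) \<Rightarrow> real"
        using M(2) by simp
      show "Max ((\<lambda>x. h x + \<bar>v x\<bar>) ` Y) + Max ((\<lambda>x. h x - \<bar>v x\<bar>) ` Y)
          \<le> Max ((\<lambda>x. h x + v x) ` Y) + Max ((\<lambda>x. h x - v x) ` Y)" for h v :: "(nat \<Rightarrow> real) \<Rightarrow> real"
        using M(3) by simp
    qed simp
    also have "\<dots> \<le> ?E2 (\<lambda>l. D / real m * s + D / (real m * s) * (\<Sum>j\<in>J. (Z l j)\<^sup>2))"
    proof (rule sg.iter_mean_mono)
      fix l assume l: "l \<in> samples (J \<times> {1, -1::real}) m"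
      have "S l f \<le> D / real m * s + D / (real m * s) * (\<Sum>j\<in>J. (Z l j)\<^sup>2)" if "f \<in> Y" for f
      proof -
        have f: "f \<in> V" "Q f \<le> 1" using Y that by auto
        define y where "y j = f j / sqrt (w j)" for j
        have fy: "f i = (\<Sum>l\<in>J. h i l * y l)" if "i \<in> J" for i using h[OF f(1) that] by (simp add: y_def)
        have Qy: "Q f = (\<Sum>j\<in>J. (y j)\<^sup>2)"
          unfolding Q_def y_def by (intro sum.cong refl) (simp add: power_divide w_pos less_imp_le)
        have "S l f = sum_list (map (\<lambda>(i,\<sigma>). 2 * D / real m * (\<Sum>j\<in>J. y j * (\<sigma> * h i j / w i))) l)"
          unfolding S_def
        proof (intro arg_cong[of _ _ sum_list] map_cong refl)
          fix p assume "p \<in> set l"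
          then have "fst p \<in> J" using l by (auto simp: samples_def)
          then show "(case p of (i,\<sigma>) \<Rightarrow> 2 * \<sigma> * u i f) =
              (case p of (i,\<sigma>) \<Rightarrow> 2 * D / real m * (\<Sum>j\<in>J. y j * (\<sigma> * h i j / w i)))"
            by (simp add: case_prod_unfold u_def fy sum_distrib_left sum_divide_distrib mult_ac)
        qed
        also have "\<dots> = 2 * D / real m * (\<Sum>j\<in>J. y j * Z l j)"
          unfolding Z_def by (induction l) (simp_all add: case_prod_unfold sum.distrib distrib_left)
        also have "(\<Sum>j\<in>J. y j * Z l j) \<le> (\<Sum>j\<in>J. (s * (y j)\<^sup>2 + (Z l j)\<^sup>2 / s) / 2)"
        proof (rule sum_mono)
          fix j
          have "0 \<le> (s * y j - Z l j)\<^sup>2 / s" using s by simp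
          then show "y j * Z l j \<le> (s * (y j)\<^sup>2 + (Z l j)\<^sup>2 / s) / 2"
            using s by (simp add: power2_eq_square field_simps)
        qed
        also have "\<dots> = (s * Q f + (\<Sum>j\<in>J. (Z l j)\<^sup>2) / s) / 2"
          by (simp add: Qy sum.distrib sum_distrib_left flip: sum_divide_distrib)
        also have "2 * D / real m * \<dots> \<le> 2 * D / real m * ((s * 1 + (\<Sum>j\<in>J. (Z l j)\<^sup>2) / s) / 2)"
          using D_pos mp s f by (intro mult_left_mono divide_right_mono add_right_mono) auto
        also have "\<dots> = D / real m * s + D / (real m * s) * (\<Sum>j\<in>J. (Z l j)\<^sup>2)"
          using mp s by (simp add: field_simps)
        \<comment> \<open>The last steps bound a subterm only; the monotonicity of its context is
          collected as a premise and discharged next.\<close>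
        finally have "(\<And>x y. x \<le> y \<Longrightarrow> 2 * D / real m * x \<le> 2 * D / real m * y) \<Longrightarrow> ?thesis" .
        moreover have "2 * D / real m * x \<le> 2 * D / real m * y" if "x \<le> y" for x y
          using that D_pos mp by (intro mult_left_mono) auto
        ultimately show ?thesis by blast
      qed
      then show "Max ((\<lambda>f. 0 + S l f) ` Y) \<le> D / real m * s + D / (real m * s) * (\<Sum>j\<in>J. (Z l j)\<^sup>2)"
        using Y by (auto simp: Max_le_iff)
    qed
    also have "\<dots> = D / real m * s + D / (real m * s) * (\<Sum>j\<in>J. ?E2 (\<lambda>l. (Z l j)\<^sup>2))"
      by (simp only: iter_mean_add iter_mean_cmult iter_mean_sum sg.iter_mean_const)
    also have "(\<Sum>j\<in>J. ?E2 (\<lambda>l. (Z l j)\<^sup>2)) = (\<Sum>j\<in>J. real m * (\<Sum>i\<in>J. q i * (h i j / w i)\<^sup>2))"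
    proof (intro sum.cong refl)
      fix j
      have z: "(\<Sum>p\<in>J \<times> {1, -1::real}. (case p of (i,\<sigma>) \<Rightarrow> q i / 2) * (case p of (i,\<sigma>) \<Rightarrow> \<sigma> * h i j / w i)) = 0"
        using signed_sum[of "\<lambda>i \<sigma>. \<sigma> * h i j / w i"] by (simp add: case_prod_unfold)
      have "?E2 (\<lambda>l. (Z l j)\<^sup>2) = real m *
          (\<Sum>p\<in>J \<times> {1, -1::real}. (case p of (i,\<sigma>) \<Rightarrow> q i / 2) * (case p of (i,\<sigma>) \<Rightarrow> \<sigma> * h i j / w i)\<^sup>2)"
        unfolding Z_def by (rule sg.iter_mean_sum_list_sq[OF z])
      then show "?E2 (\<lambda>l. (Z l j)\<^sup>2) = real m * (\<Sum>i\<in>J. q i * (h i j / w i)\<^sup>2)"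
        using signed_sum[of "\<lambda>i \<sigma>. (\<sigma> * h i j / w i)\<^sup>2"] by (simp add: case_prod_unfold power_divide)
    qed
    also have "\<dots> = real m * (\<Sum>i\<in>J. \<Sum>j\<in>J. q i * (h i j / w i)\<^sup>2)"
      by (subst sum.swap) (simp add: sum_distrib_left)
    also have "\<dots> = real m * (\<Sum>i\<in>J. q i * ((\<Sum>j\<in>J. (h i j)\<^sup>2) / (w i)\<^sup>2))"
      by (simp add: sum_distrib_left power_divide sum_divide_distrib)
    also have "\<dots> \<le> real m * (\<Sum>i\<in>J. q i * \<kappa>)"
    proof (intro mult_left_mono sum_mono q_nonneg)
      fix i assume "i \<in> J"
      then show "(\<Sum>j\<in>J. (h i j)\<^sup>2) / (w i)\<^sup>2 \<le> \<kappa>"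
        using hn[of i] w_pos[of i] by (simp add: field_simps)
    qed auto
    also have "\<dots> = s\<^sup>2" unfolding q_avg using mp \<kappa> by (simp add: s_def)
    finally have "(\<And>x y. x \<le> y \<Longrightarrow> D / real m * s + D / (real m * s) * x \<le> D / real m * s + D / (real m * s) * y)
        \<Longrightarrow> ?E (\<lambda>l. Max (dev m l ` Y)) \<le> D / real m * s + D / (real m * s) * s\<^sup>2" .
    moreover have "D / real m * s + D / (real m * s) * x \<le> D / real m * s + D / (real m * s) * y" if "x \<le> y" for x y
      using that D_pos mp s by (intro add_left_mono mult_left_mono) auto
    ultimately have "?E (\<lambda>l. Max (dev m l ` Y)) \<le> D / real m * s + D / (real m * s) * s\<^sup>2" by blast
    also have "\<dots> = 2 * D * (s / real m)" using s by (simp add: power2_eq_square field_simps)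
    also have "s / real m = sqrt (\<kappa> / real m)"
      using mp by (simp add: s_def real_sqrt_mult real_sqrt_divide real_div_sqrt field_simps)
    finally show ?thesis .
  qed

text \<open>One sample meets both requirements because a single mean, \<open>sqrt \<kappa>\<close>
  times the largest deviation plus four times the Frobenius error, is at most 1 and both terms are
  nonnegative. The deviation of \<open>f\<close> is then at most
  \<open>sqrt (Q f) / sqrt \<kappa>\<close>, which \<open>sqrt_Q_le\<close> turns into
  \<open>nrm f\<close>.\<close>

lemma ex_good_sample:
  assumes m: "16 * D\<^sup>2 * \<kappa>\<^sup>2 \<le> real m" "0 < m"
  shows "\<exists>l\<in>samples J m.
    (\<forall>f\<in>V. sum_list (map (\<lambda>i. D * \<bar>f i\<bar> / (real m * w i)) l) \<le> 2 * nrm f) \<and>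
    (\<forall>f\<in>V. Q f \<le> 2 * sum_list (map (\<lambda>i. D * (f i)\<^sup>2 / (real m * (w i)\<^sup>2)) l))"
proof -
  let ?E = "iter_mean J q m"
  have mp: "0 < real m" using m by simp
  obtain Z2 where Z0: "\<And>l. 0 \<le> Z2 l" and EZ2: "?E Z2 \<le> D\<^sup>2 * \<kappa>\<^sup>2 / real m"
    and Qhat: "\<And>f l. f \<in> V \<Longrightarrow> l \<in> samples J m \<Longrightarrow>
      (sum_list (map (\<lambda>i. D * (f i)\<^sup>2 / (real m * (w i)\<^sup>2)) l) - Q f)\<^sup>2 \<le> (Q f)\<^sup>2 * Z2 l"
    using spectral_deviation[OF m(2)] by blast
  \<comment> \<open>One witness per bad sample suffices, so that suprema are only needed over the finite set \<open>Y\<close>.\<close>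
  define bad where "bad l f \<longleftrightarrow> f \<in> V \<and> Q f \<le> 1 \<and> 1 < sqrt \<kappa> * dev m l f" for l f
  define Y where "Y = insert (\<lambda>_. 0) ((\<lambda>l. SOME f. bad l f) ` {l \<in> samples J m. \<exists>f. bad l f})"
  have Y: "finite Y" "Y \<noteq> {}" unfolding Y_def using finite_samples[OF fin] by auto
  have YV: "f \<in> V \<and> Q f \<le> 1" if "f \<in> Y" for f
  proof -
    have "bad l (SOME f. bad l f)" if "\<exists>f. bad l f" for l by (rule someI_ex[OF that])
    then have "f = (\<lambda>_. 0) \<or> (\<exists>l. bad l f)" using that unfolding Y_def by blast
    then show ?thesis using zero by (auto simp: bad_def Q_def)
  qed
  \<comment> \<open>The two means are bounded by \<open>2 * t\<close> and
    \<open>4 * t\<^sup>2\<close>; the hypothesis on \<open>m\<close> says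
    \<open>t \<le> 1/4\<close>, so together they stay below 1.\<close>
  define t where "t = D * \<kappa> / sqrt (real m)"
  have t0: "0 \<le> t" using D_pos \<kappa> by (simp add: t_def)
  have t2: "t\<^sup>2 = D\<^sup>2 * \<kappa>\<^sup>2 / real m" using mp by (simp add: t_def power_divide power_mult_distrib)
  have "16 * t\<^sup>2 \<le> 1" using m mp by (simp add: t2 field_simps)
  then have "(4 * t)\<^sup>2 \<le> 1\<^sup>2" by (simp add: power_mult_distrib)
  then have t: "4 * t \<le> 1" by (rule power2_le_imp_le) simp
  have "?E (\<lambda>l. sqrt \<kappa> * Max (dev m l ` Y) + 4 * Z2 l) =
      sqrt \<kappa> * ?E (\<lambda>l. Max (dev m l ` Y)) + 4 * ?E Z2"
    by (simp add: iter_mean_add iter_mean_cmult)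
  also have "\<dots> \<le> sqrt \<kappa> * (2 * D * sqrt (\<kappa> / real m)) + 4 * (D\<^sup>2 * \<kappa>\<^sup>2 / real m)"
    by (intro add_mono mult_left_mono l1_deviation[OF m(2)] EZ2 Y YV) (use \<kappa> in auto)
  also have "\<dots> = 2 * t + 4 * t\<^sup>2"
    unfolding t2 using \<kappa> by (simp add: t_def real_sqrt_divide)
  also have "\<dots> \<le> 1"
  proof -
    have "t * t \<le> t * (1/4)" using t t0 by (intro mult_left_mono) auto
    then show ?thesis using t by (simp add: power2_eq_square)
  qed
  finally have E1: "?E (\<lambda>l. sqrt \<kappa> * Max (dev m l ` Y) + 4 * Z2 l) \<le> 1" .
  obtain l where l: "l \<in> samples J m" and
    "sqrt \<kappa> * Max (dev m l ` Y) + 4 * Z2 l \<le> ?E (\<lambda>l. sqrt \<kappa> * Max (dev m l ` Y) + 4 * Z2 l)"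
    using iter_mean_ex_le[of m "\<lambda>l. sqrt \<kappa> * Max (dev m l ` Y) + 4 * Z2 l"] by blast
  then have le1: "sqrt \<kappa> * Max (dev m l ` Y) + 4 * Z2 l \<le> 1" using E1 by simp
  \<comment> \<open>The zero function was put into \<open>Y\<close> so that the maximum is
    nonnegative.\<close>
  have "0 = dev m l (\<lambda>_. 0)" by (simp add: dev_def nrm_def)
  also have "\<dots> \<le> Max (dev m l ` Y)" using Y by (intro Max_ge) (auto simp: Y_def)
  finally have "0 \<le> sqrt \<kappa> * Max (dev m l ` Y)" using \<kappa> by simp
  moreover have "0 \<le> Z2 l" by (rule Z0)
  ultimately have Z: "Z2 l \<le> 1/4" "sqrt \<kappa> * Max (dev m l ` Y) \<le> 1" using le1 by auto
  have nb: "\<not> bad l f" for f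
  proof
    assume "bad l f"
    then have ex: "\<exists>f. bad l f" by blast
    define g where "g = (SOME f. bad l f)"
    have g: "bad l g" unfolding g_def by (rule someI_ex[OF ex])
    have "g \<in> Y" using ex l unfolding Y_def g_def by blast
    then have "dev m l g \<le> Max (dev m l ` Y)" using Y by auto
    then have "sqrt \<kappa> * dev m l g \<le> sqrt \<kappa> * Max (dev m l ` Y)" using \<kappa> by (intro mult_left_mono) auto
    then show False using g Z(2) by (simp add: bad_def)
  qed
  have "sum_list (map (\<lambda>i. D * \<bar>f i\<bar> / (real m * w i)) l) \<le> 2 * nrm f" if f: "f \<in> V" for f
  proof (cases "Q f = 0")
    case True
    have "D * \<bar>f i\<bar> / (real m * w i) = 0" if "i \<in> J" for i using Q_0[OF f _ that] True by simp
    then have "sum_list (map (\<lambda>i. D * \<bar>f i\<bar> / (real m * w i)) l) = sum_list (map (\<lambda>i. 0) l)"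
      by (rule sum_list_samples[OF l])
    then show ?thesis using nrm_nonneg[of f] by simp
  next
    case False
    define r where "r = sqrt (Q f)"
    have r: "0 < r" using False Q_nonneg[of f] by (simp add: r_def)
    define g where "g = (\<lambda>i. (1 / r) * f i)"
    have "g \<in> V" unfolding g_def by (rule scale[OF f])
    moreover have "Q g \<le> 1" unfolding g_def Q_scale using r False Q_nonneg[of f]
      by (simp add: r_def power_divide)
    ultimately have "sqrt \<kappa> * dev m l g \<le> 1" using nb[of g] by (auto simp: bad_def)
    moreover have "dev m l g = dev m l f / r"
    proof -
      have "sum_list (map (\<lambda>i. D * \<bar>g i\<bar> / (real m * w i)) l) =
          sum_list (map (\<lambda>i. D * \<bar>f i\<bar> / (real m * w i)) l) / r"
        using r by (induction l) (simp_all add: g_def abs_mult add_divide_distrib)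
      then show ?thesis using r unfolding dev_def g_def nrm_scale by (simp add: diff_divide_distrib)
    qed
    ultimately have "sqrt \<kappa> * dev m l f \<le> r" using r by (simp add: field_simps)
    also have "\<dots> \<le> sqrt \<kappa> * nrm f" unfolding r_def by (rule sqrt_Q_le[OF f])
    finally have "dev m l f \<le> nrm f" using \<kappa> by simp
    then show ?thesis unfolding dev_def by simp
  qed
  moreover have "Q f \<le> 2 * sum_list (map (\<lambda>i. D * (f i)\<^sup>2 / (real m * (w i)\<^sup>2)) l)" if f: "f \<in> V" for f
  proof -
    define a where "a = sum_list (map (\<lambda>i. D * (f i)\<^sup>2 / (real m * (w i)\<^sup>2)) l)"
    have "(a - Q f)\<^sup>2 \<le> (Q f)\<^sup>2 * Z2 l" unfolding a_def by (rule Qhat[OF f l])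
    also have "\<dots> \<le> (Q f)\<^sup>2 * (1/4)" using Z(1) by (intro mult_left_mono) auto
    also have "\<dots> = (Q f / 2)\<^sup>2" by (simp add: power_divide)
    finally have "\<bar>a - Q f\<bar> \<le> Q f / 2" using Q_nonneg[of f] by (simp add: abs_le_square_iff[symmetric])
    then show ?thesis unfolding a_def by linarith
  qed
  ultimately show ?thesis using l by blast
qed

text \<open>The points are the reproducing kernel columns of a good sample. Their number does not depend
  on the accuracy \<open>\<epsilon>\<close> of the final sample, which keeps \<open>log (1/\<epsilon>)\<close> out of the sample size.\<close>

lemma spanning_net:
  assumes m: "16 * D\<^sup>2 * \<kappa>\<^sup>2 \<le> real m" "0 < m"
  obtains p where "\<And>k. k < m \<Longrightarrow> p k \<in> V" and "\<And>k. k < m \<Longrightarrow> Q (p k) \<le> 4 * \<kappa>"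
    and "\<And>f. f \<in> V \<Longrightarrow> \<exists>a. (\<forall>i\<in>J. f i = (\<Sum>k<m. a k * p k i)) \<and> (\<Sum>k<m. \<bar>a k\<bar>) \<le> 2 * nrm f"
proof -
  obtain l where l: "l \<in> samples J m"
    and l1: "\<And>f. f \<in> V \<Longrightarrow> sum_list (map (\<lambda>i. D * \<bar>f i\<bar> / (real m * w i)) l) \<le> 2 * nrm f"
    and l2: "\<And>f. f \<in> V \<Longrightarrow> Q f \<le> 2 * sum_list (map (\<lambda>i. D * (f i)\<^sup>2 / (real m * (w i)\<^sup>2)) l)"
    using ex_good_sample[OF m] by blast
  have len: "length l = m" and lJ: "\<And>k. k < m \<Longrightarrow> l ! k \<in> J"
    using l by (auto simp: samples_def)
  have mp: "0 < real m" using m by simp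
  \<comment> \<open>The square of \<open>c k = b / w (l ! k)\<close> is the coefficient in the
    sampled energy, while \<open>b * c k\<close> is the one in the sampled l1 norm. Dividing the
    kernel columns by \<open>b\<close> thus moves the expansion coefficients to the l1
    scale.\<close>
  define b where "b = sqrt (D / real m)"
  have b: "0 < b" "b\<^sup>2 = D / real m" using D_pos mp by (auto simp: b_def)
  define c where "c k = b / w (l ! k)" for k
  have c2: "(c k)\<^sup>2 = D / (real m * (w (l ! k))\<^sup>2)" for k
    using b(2) by (simp add: c_def power_divide)
  have Qhat: "Q f \<le> 2 * (\<Sum>k<m. (c k * f (l ! k))\<^sup>2)" if f: "f \<in> V" for f
  proof -
    have "sum_list (map (\<lambda>i. D * (f i)\<^sup>2 / (real m * (w i)\<^sup>2)) l) = (\<Sum>k<m. (c k * f (l ! k))\<^sup>2)"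
      unfolding sum_list_sum_nth by (simp add: len lessThan_atLeast0 power_mult_distrib c2)
    then show ?thesis using l2[OF f] by simp
  qed
  obtain \<mu> where \<mu>: "\<And>k. k < m \<Longrightarrow> \<mu> k \<in> V"
    and rep: "\<And>f k. f \<in> V \<Longrightarrow> k < m \<Longrightarrow> c k * f (l ! k) = (\<Sum>j<m. (c k * \<mu> j (l ! k)) * (c j * f (l ! j)))"
    and sym: "\<And>k j. k < m \<Longrightarrow> j < m \<Longrightarrow> c k * \<mu> j (l ! k) = c j * \<mu> k (l ! j)"
    using reproducing[of m c "\<lambda>k. l ! k"] by blast
  define p where "p k i = (1 / b) * \<mu> k i" for k i
  show thesis
  proof (rule that[of p])
    fix k assume k: "k < m"
    show "p k \<in> V" unfolding p_def by (rule scale[OF \<mu>[OF k]])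
    \<comment> \<open>The diagonal value \<open>t\<close> equals the sampled energy of the kernel
      column. The leverage bound and the good sample bound \<open>t\<^sup>2\<close> by a constant
      times \<open>t\<close>, hence \<open>t\<close> and with it the true energy.\<close>
    define t where "t = c k * \<mu> k (l ! k)"
    have "(\<Sum>j<m. (c j * \<mu> k (l ! j))\<^sup>2) = (\<Sum>j<m. (c k * \<mu> j (l ! k)) * (c j * \<mu> k (l ! j)))"
      by (intro sum.cong refl) (simp add: sym[OF k] power2_eq_square)
    also have "\<dots> = t" using rep[OF \<mu>[OF k] k] by (simp add: t_def)
    finally have t: "(\<Sum>j<m. (c j * \<mu> k (l ! j))\<^sup>2) = t" .
    have t0: "0 \<le> t" unfolding t[symmetric] by (simp add: sum_nonneg)
    have Qt: "Q (\<mu> k) \<le> 2 * t" using Qhat[OF \<mu>[OF k]] t by simp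
    have "t * t = (c k)\<^sup>2 * (\<mu> k (l ! k))\<^sup>2" by (simp add: t_def power2_eq_square)
    also have "\<dots> \<le> (c k)\<^sup>2 * (\<kappa> * (w (l ! k))\<^sup>2 * Q (\<mu> k))"
      by (intro mult_left_mono leverage_Q \<mu> k lJ) auto
    also have "\<dots> = D / real m * \<kappa> * Q (\<mu> k)"
      using w_pos[OF lJ[OF k]] by (simp add: c2)
    also have "\<dots> \<le> D / real m * \<kappa> * (2 * t)"
      using Qt D_pos mp \<kappa> by (intro mult_left_mono) auto
    finally have tt: "t * t \<le> (2 * \<kappa> * D / real m) * t" by (simp add: mult_ac)
    have "t \<le> 2 * \<kappa> * D / real m"
    proof (cases "t = 0")
      case True
      then show ?thesis using D_pos mp \<kappa> by simp
    next
      case False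
      then have "0 < t" using t0 by simp
      with tt show ?thesis by (rule mult_right_le_imp_le)
    qed
    then have "Q (\<mu> k) \<le> 4 * \<kappa> * (D / real m)" using Qt by simp
    moreover have "Q (p k) = Q (\<mu> k) / (D / real m)"
      unfolding p_def Q_scale b(2)[symmetric] by (simp add: power_divide)
    moreover have "0 < D / real m" using D_pos mp by simp
    ultimately show "Q (p k) \<le> 4 * \<kappa>" by (simp only: pos_divide_le_eq)
  next
    fix f assume f: "f \<in> V"
    define a where "a k = c k * f (l ! k)" for k
    \<comment> \<open>The residual of the expansion in kernel columns vanishes on all sampled rows.
      Its sampled energy is 0, so the good sample makes its true energy 0 as well.\<close>
    define g where "g i = 1 * f i + (-1) * (\<Sum>k<m. a k * \<mu> k i)" for i
    have g: "g \<in> V" unfolding g_def by (intro lin f lincomb \<mu>) auto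
    have "c k * g (l ! k) = 0" if k: "k < m" for k
    proof -
      have "c k * g (l ! k) = c k * f (l ! k) - c k * (\<Sum>j<m. a j * \<mu> j (l ! k))"
        by (simp add: g_def algebra_simps)
      also have "c k * (\<Sum>j<m. a j * \<mu> j (l ! k)) = c k * f (l ! k)"
        unfolding rep[OF f k] by (simp add: a_def sum_distrib_left mult_ac)
      finally show ?thesis by simp
    qed
    then have "(\<Sum>k<m. (c k * g (l ! k))\<^sup>2) = 0" by (intro sum.neutral) (simp del: mult_eq_0_iff)
    then have "Q g \<le> 0" using Qhat[OF g] by simp
    then have "f i = (\<Sum>k<m. a k * \<mu> k i)" if "i \<in> J" for i
      using Q_0[OF g _ that] by (simp add: g_def)
    then have "\<forall>i\<in>J. f i = (\<Sum>k<m. (b * a k) * p k i)"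
      using b by (simp add: p_def)
    moreover have "(\<Sum>k<m. \<bar>b * a k\<bar>) \<le> 2 * nrm f"
    proof -
      have "(\<Sum>k<m. \<bar>b * a k\<bar>) = (\<Sum>k<m. D * \<bar>f (l ! k)\<bar> / (real m * w (l ! k)))"
      proof (intro sum.cong refl)
        fix k assume "k \<in> {..<m}"
        then have "0 < w (l ! k)" using w_pos lJ by auto
        then have "\<bar>b * a k\<bar> = b\<^sup>2 * (\<bar>f (l ! k)\<bar> / w (l ! k))"
          using b(1) by (simp add: a_def c_def abs_mult power2_eq_square)
        then show "\<bar>b * a k\<bar> = D * \<bar>f (l ! k)\<bar> / (real m * w (l ! k))" by (simp add: b(2))
      qed
      also have "\<dots> = sum_list (map (\<lambda>i. D * \<bar>f i\<bar> / (real m * w i)) l)"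
        unfolding sum_list_sum_nth by (simp add: len lessThan_atLeast0)
      finally show ?thesis using l1[OF f] by simp
    qed
    ultimately show "\<exists>a. (\<forall>i\<in>J. f i = (\<Sum>k<m. a k * p k i)) \<and> (\<Sum>k<m. \<bar>a k\<bar>) \<le> 2 * nrm f"
      by (intro exI[of _ "\<lambda>k. b * a k"]) blast
  qed
qed

section \<open>Exponential moments and tails of the final sample\<close>

lemma signed_mgf:
  assumes N: "0 < N" and p: "p \<in> V" "Q p \<le> 4 * \<kappa>" and \<theta>: "\<bar>\<theta>\<bar> * (2 * \<kappa> * D) \<le> real N"
  shows "iter_mean (J \<times> {1, -1::real}) (\<lambda>(i,\<sigma>). q i / 2) N
      (\<lambda>l. exp (\<theta> * sum_list (map (\<lambda>(i,\<sigma>). \<sigma> * (D * p i / (real N * w i))) l)))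
    \<le> exp (4 * \<kappa> * \<theta>\<^sup>2 * D / real N)"
proof -
  interpret sg: prob_weights "J \<times> {1, -1::real}" "\<lambda>(i,\<sigma>). q i / 2" by (rule signed_prob_weights)
  let ?E2 = "iter_mean (J \<times> {1, -1::real}) (\<lambda>(i,\<sigma>). q i / 2) N"
  have Np: "0 < real N" using N by simp
  define u where "u i = D * p i / (real N * w i)" for i
  define g where "g = (\<lambda>(i,\<sigma>). exp (\<theta> * (\<sigma> * u i)))"
  \<comment> \<open>Energy at most \<open>4 * \<kappa>\<close> gives
    \<open>\<bar>p i\<bar> / w i \<le> 2 * \<kappa>\<close>; the hypothesis on
    \<open>\<theta>\<close> then keeps the exponent in the range of
    \<open>cosh_le_one_plus_square\<close>.\<close>
  have u1: "\<bar>\<theta> * u i\<bar> \<le> 1" if i: "i \<in> J" for i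
  proof -
    have "sqrt (\<kappa> * Q p) \<le> sqrt ((2 * \<kappa>)\<^sup>2)"
      using p(2) \<kappa> by (intro real_sqrt_le_mono) (simp add: power2_eq_square)
    also have "sqrt ((2 * \<kappa>)\<^sup>2) = 2 * \<kappa>" using \<kappa> by (intro real_sqrt_unique) auto
    finally have "\<bar>p i\<bar> / w i \<le> 2 * \<kappa>" using leverage_sqrt[OF p(1) i] by simp
    then have "\<bar>\<theta>\<bar> * D / real N * (\<bar>p i\<bar> / w i) \<le> \<bar>\<theta>\<bar> * D / real N * (2 * \<kappa>)"
      using D_pos Np by (intro mult_left_mono) auto
    also have "\<dots> \<le> 1" using \<theta> Np by (simp add: field_simps)
    finally show ?thesis using w_pos[OF i] D_pos by (simp add: u_def abs_mult)
  qed
  have "(\<Sum>x\<in>J \<times> {1, -1::real}. (case x of (i,\<sigma>) \<Rightarrow> q i / 2) * g x) =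
      (\<Sum>i\<in>J. q i * ((exp (\<theta> * u i) + exp (- (\<theta> * u i))) / 2))"
    using signed_sum[of "\<lambda>i \<sigma>. exp (\<theta> * (\<sigma> * u i))"] by (simp add: case_prod_unfold g_def)
  also have "\<dots> \<le> (\<Sum>i\<in>J. q i * (1 + (\<theta> * u i)\<^sup>2))"
    by (intro sum_mono mult_left_mono q_nonneg cosh_le_one_plus_square u1)
  also have "\<dots> = 1 + (\<Sum>i\<in>J. q i * (\<theta> * u i)\<^sup>2)" by (rule q_avg_add)
  \<comment> \<open>The second moment is a multiple of the energy. Compared with squaring the
    pointwise bound this gains a factor of order \<open>D\<close>, which makes the sample size
    linear in \<open>d\<close> up to the logarithm.\<close>
  also have "(\<Sum>i\<in>J. q i * (\<theta> * u i)\<^sup>2) = (\<Sum>i\<in>J. \<theta>\<^sup>2 * D / (real N)\<^sup>2 * ((p i)\<^sup>2 / w i))"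
  proof (intro sum.cong refl)
    fix i assume "i \<in> J"
    then show "q i * (\<theta> * u i)\<^sup>2 = \<theta>\<^sup>2 * D / (real N)\<^sup>2 * ((p i)\<^sup>2 / w i)"
      using w_pos[of i] D_pos Np by (simp add: q_def u_def power2_eq_square mult_ac)
  qed
  also have "\<dots> = \<theta>\<^sup>2 * D / (real N)\<^sup>2 * Q p" by (simp add: Q_def sum_distrib_left)
  also have "1 + \<dots> \<le> exp (\<theta>\<^sup>2 * D / (real N)\<^sup>2 * Q p)" by (rule exp_ge_add_one_self)
  also have "\<dots> \<le> exp (\<theta>\<^sup>2 * D / (real N)\<^sup>2 * (4 * \<kappa>))"
    using p(2) D_pos by (intro exp_le_cancel_iff[THEN iffD2] mult_left_mono) auto
  finally have 1: "(\<Sum>x\<in>J \<times> {1, -1::real}. (case x of (i,\<sigma>) \<Rightarrow> q i / 2) * g x)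
      \<le> exp (\<theta>\<^sup>2 * D / (real N)\<^sup>2 * (4 * \<kappa>))" .
  have "?E2 (\<lambda>l. exp (\<theta> * sum_list (map (\<lambda>(i,\<sigma>). \<sigma> * (D * p i / (real N * w i))) l))) =
      ?E2 (\<lambda>l. prod_list (map g l))"
  proof (intro iter_mean_cong)
    fix l :: "(nat \<times> real) list"
    show "exp (\<theta> * sum_list (map (\<lambda>(i,\<sigma>). \<sigma> * (D * p i / (real N * w i))) l)) = prod_list (map g l)"
      by (induction l) (simp_all add: g_def u_def case_prod_unfold distrib_left exp_add)
  qed
  also have "\<dots> = (\<Sum>x\<in>J \<times> {1, -1::real}. (case x of (i,\<sigma>) \<Rightarrow> q i / 2) * g x) ^ N"
    by (rule sg.iter_mean_prod)
  also have "\<dots> \<le> exp (\<theta>\<^sup>2 * D / (real N)\<^sup>2 * (4 * \<kappa>)) ^ N"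
    by (intro power_mono 1 sum_nonneg mult_nonneg_nonneg) (auto simp: g_def q_nonneg)
  also have "\<dots> = exp (real N * (\<theta>\<^sup>2 * D / (real N)\<^sup>2 * (4 * \<kappa>)))" by (rule exp_of_nat_mult[symmetric])
  also have "real N * (\<theta>\<^sup>2 * D / (real N)\<^sup>2 * (4 * \<kappa>)) = 4 * \<kappa> * \<theta>\<^sup>2 * D / real N"
    using Np by (simp add: power2_eq_square)
  finally show ?thesis .
qed

text \<open>Each \<open>f\<close> in \<open>Y\<close> combines the points \<open>p k\<close> with
  coefficients of total size at most 2. With the factor 2 from symmetrization, its exponent is at
  most \<open>4 * \<xi>\<close> times the largest \<open>\<bar>S l (p k)\<bar>\<close>. The sum over
  all points and both signs replaces the maximum; the constant is
  \<open>64 = 4 * 4\<^sup>2\<close>.\<close>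

lemma deviation_mgf:
  assumes N: "0 < N" and s: "s \<in> {1, -1}" and \<xi>: "0 < \<xi>" "\<xi> * (8 * \<kappa> * D) \<le> real N"
    and m: "16 * D\<^sup>2 * \<kappa>\<^sup>2 \<le> real m" "0 < m"
    and Y: "finite Y" "Y \<noteq> {}" "\<And>f. f \<in> Y \<Longrightarrow> f \<in> V \<and> nrm f \<le> 1"
  shows "iter_mean J q N (\<lambda>l. Max ((\<lambda>f. exp (\<xi> * (s * dev N l f))) ` Y))
    \<le> 2 * real m * exp (64 * \<kappa> * \<xi>\<^sup>2 * D / real N)"
proof -
  obtain p where p: "\<And>k. k < m \<Longrightarrow> p k \<in> V" "\<And>k. k < m \<Longrightarrow> Q (p k) \<le> 4 * \<kappa>"
    and net: "\<And>f. f \<in> V \<Longrightarrow> \<exists>a. (\<forall>i\<in>J. f i = (\<Sum>k<m. a k * p k i)) \<and> (\<Sum>k<m. \<bar>a k\<bar>) \<le> 2 * nrm f"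
    using spanning_net[OF m] by blast
  interpret sg: prob_weights "J \<times> {1, -1::real}" "\<lambda>(i,\<sigma>). q i / 2" by (rule signed_prob_weights)
  let ?E = "iter_mean J q N"
  let ?E2 = "iter_mean (J \<times> {1, -1::real}) (\<lambda>(i,\<sigma>). q i / 2) N"
  define u where "u i f = D * f i / (real N * w i)" for i and f :: "nat \<Rightarrow> real"
  define S where "S l f = sum_list (map (\<lambda>(i,\<sigma>). \<sigma> * u i f) l)" for l f
  let ?d = "\<lambda>l f. sum_list (map (\<lambda>i. s * (\<bar>u i f\<bar> - (\<Sum>i\<in>J. q i * \<bar>u i f\<bar>))) l)"
  have "?E (\<lambda>l. Max ((\<lambda>f. exp (\<xi> * (s * dev N l f))) ` Y)) = ?E (\<lambda>l. Max ((\<lambda>f. exp (\<xi> * (0 + ?d l f))) ` Y))"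
    by (intro iter_mean_cong) (simp only: u_def dev_eq[OF N] add_0)
  also have "\<dots> \<le> ?E2 (\<lambda>l. Max ((\<lambda>f. exp (\<xi> * (0 + sum_list (map (\<lambda>(i,\<sigma>). 2 * \<sigma> * u i f) l)))) ` Y))"
  proof (rule symmetrization[where \<Psi> = "\<lambda>h. Max ((\<lambda>f. exp (\<xi> * h f)) ` Y)" and h = "\<lambda>x. 0"])
    have mc: "mono (\<lambda>x. exp (\<xi> * x))" "convex_on UNIV (\<lambda>x. exp (\<xi> * x))"
    proof -
      show "mono (\<lambda>x. exp (\<xi> * x))" using \<xi> by (simp add: mono_def)
      show "convex_on UNIV (\<lambda>x. exp (\<xi> * x))" by (rule convex_on_exp) (use \<xi> in auto)
    qed
    note M = finite_Max_functional[OF Y(1,2) mc]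
    show "Max ((\<lambda>f. exp (\<xi> * (\<Sum>i\<in>J. q i * g i f))) ` Y) \<le> (\<Sum>i\<in>J. q i * Max ((\<lambda>f. exp (\<xi> * g i f)) ` Y))"
      for g :: "nat \<Rightarrow> (nat \<Rightarrow> real) \<Rightarrow> real"
      by (rule M(1)[OF finite_J q_nonneg q_sum])
    show "Max ((\<lambda>f. exp (\<xi> * ((a f + b f) / 2))) ` Y) \<le>
        (Max ((\<lambda>f. exp (\<xi> * a f)) ` Y) + Max ((\<lambda>f. exp (\<xi> * b f)) ` Y)) / 2"
      for a b :: "(nat \<Rightarrow> real) \<Rightarrow> real" by (rule M(2))
    show "Max ((\<lambda>f. exp (\<xi> * (h f + \<bar>v f\<bar>))) ` Y) + Max ((\<lambda>f. exp (\<xi> * (h f - \<bar>v f\<bar>))) ` Y)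
        \<le> Max ((\<lambda>f. exp (\<xi> * (h f + v f))) ` Y) + Max ((\<lambda>f. exp (\<xi> * (h f - v f))) ` Y)"
      for h v :: "(nat \<Rightarrow> real) \<Rightarrow> real" by (rule M(3))
  qed (rule s)
  also have "\<dots> \<le> ?E2 (\<lambda>l. \<Sum>k<m. exp (4 * \<xi> * S l (p k)) + exp (- 4 * \<xi> * S l (p k)))"
  proof (rule sg.iter_mean_mono)
    fix l assume l: "l \<in> samples (J \<times> {1, -1::real}) N"
    define R where "R = Max ((\<lambda>k. \<bar>S l (p k)\<bar>) ` {..<m})"
    have R: "\<bar>S l (p k)\<bar> \<le> R" if "k < m" for k
      unfolding R_def using that by (intro Max_ge) auto
    have "R \<in> (\<lambda>k. \<bar>S l (p k)\<bar>) ` {..<m}"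
      unfolding R_def using m by (intro Max_in) auto
    then obtain k0 where k0: "k0 < m" "R = \<bar>S l (p k0)\<bar>" by auto
    have "exp (\<xi> * (0 + sum_list (map (\<lambda>(i,\<sigma>). 2 * \<sigma> * u i f) l))) \<le> exp (4 * \<xi> * R)" if f: "f \<in> Y" for f
    proof -
      obtain a where a: "\<And>i. i \<in> J \<Longrightarrow> f i = (\<Sum>k<m. a k * p k i)" "(\<Sum>k<m. \<bar>a k\<bar>) \<le> 2 * nrm f"
        using net[of f] Y(3)[OF f] by blast
      have "sum_list (map (\<lambda>(i,\<sigma>). 2 * \<sigma> * u i f) l) =
          sum_list (map (\<lambda>(i,\<sigma>). 2 * (\<Sum>k<m. a k * (\<sigma> * u i (p k)))) l)"
      proof (intro arg_cong[of _ _ sum_list] map_cong refl)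
        fix x assume "x \<in> set l"
        then have "fst x \<in> J" using l by (auto simp: samples_def)
        then show "(case x of (i,\<sigma>) \<Rightarrow> 2 * \<sigma> * u i f) =
            (case x of (i,\<sigma>) \<Rightarrow> 2 * (\<Sum>k<m. a k * (\<sigma> * u i (p k))))"
          by (simp add: case_prod_unfold u_def a(1) sum_distrib_left sum_divide_distrib mult_ac)
      qed
      also have "\<dots> = 2 * (\<Sum>k<m. a k * S l (p k))"
        unfolding S_def by (induction l) (simp_all add: case_prod_unfold sum.distrib distrib_left)
      also have "\<dots> \<le> 2 * (\<Sum>k<m. \<bar>a k\<bar> * R)"
      proof (intro mult_left_mono sum_mono)
        fix k assume "k \<in> {..<m}"
        then have "\<bar>a k * S l (p k)\<bar> \<le> \<bar>a k\<bar> * R"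
          using R[of k] by (simp add: abs_mult mult_left_mono)
        then show "a k * S l (p k) \<le> \<bar>a k\<bar> * R" by linarith
      qed auto
      also have "\<dots> = 2 * (R * (\<Sum>k<m. \<bar>a k\<bar>))" by (simp add: sum_distrib_left mult_ac)
      also have "\<dots> \<le> 2 * (R * (2 * 1))"
        using a(2) Y(3)[OF f] k0 by (intro mult_left_mono) auto
      finally have "\<xi> * (0 + sum_list (map (\<lambda>(i,\<sigma>). 2 * \<sigma> * u i f) l)) \<le> \<xi> * (4 * R)"
        using \<xi> by (intro mult_left_mono) auto
      then show ?thesis by (simp add: mult_ac)
    qed
    then have "Max ((\<lambda>f. exp (\<xi> * (0 + sum_list (map (\<lambda>(i,\<sigma>). 2 * \<sigma> * u i f) l)))) ` Y) \<le> exp (4 * \<xi> * R)"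
      using Y by (intro Max.boundedI) auto
    also have "\<dots> \<le> exp (4 * \<xi> * S l (p k0)) + exp (- 4 * \<xi> * S l (p k0))"
      by (cases "0 \<le> S l (p k0)") (simp_all add: k0)
    also have "\<dots> \<le> (\<Sum>k<m. exp (4 * \<xi> * S l (p k)) + exp (- 4 * \<xi> * S l (p k)))"
      using k0(1) by (intro member_le_sum) (auto intro: add_nonneg_nonneg)
    finally show "Max ((\<lambda>f. exp (\<xi> * (0 + sum_list (map (\<lambda>(i,\<sigma>). 2 * \<sigma> * u i f) l)))) ` Y)
        \<le> (\<Sum>k<m. exp (4 * \<xi> * S l (p k)) + exp (- 4 * \<xi> * S l (p k)))" .
  qed
  also have "\<dots> = (\<Sum>k<m. ?E2 (\<lambda>l. exp (4 * \<xi> * S l (p k))) + ?E2 (\<lambda>l. exp (- 4 * \<xi> * S l (p k))))"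
    by (simp only: iter_mean_sum iter_mean_add)
  also have "\<dots> \<le> (\<Sum>k<m. 2 * exp (64 * \<kappa> * \<xi>\<^sup>2 * D / real N))"
  proof (rule sum_mono)
    fix k assume "k \<in> {..<m}"
    then have k: "k < m" by simp
    have "?E2 (\<lambda>l. exp (\<theta> * S l (p k))) \<le> exp (64 * \<kappa> * \<xi>\<^sup>2 * D / real N)" if "\<theta>\<^sup>2 = (4 * \<xi>)\<^sup>2" for \<theta>
    proof -
      have "\<bar>\<theta>\<bar> = 4 * \<xi>" using that[unfolded power2_eq_iff] \<xi>(1) by auto
      then have "\<bar>\<theta>\<bar> * (2 * \<kappa> * D) \<le> real N" using \<xi>(2) by simp
      from signed_mgf[OF N p(1)[OF k] p(2)[OF k] this]
      show ?thesis by (simp add: S_def u_def that power_mult_distrib mult_ac)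
    qed
    from this[of "4 * \<xi>"] this[of "- 4 * \<xi>"]
    show "?E2 (\<lambda>l. exp (4 * \<xi> * S l (p k))) + ?E2 (\<lambda>l. exp (- 4 * \<xi> * S l (p k)))
        \<le> 2 * exp (64 * \<kappa> * \<xi>\<^sup>2 * D / real N)" by simp
  qed
  also have "\<dots> = 2 * real m * exp (64 * \<kappa> * \<xi>\<^sup>2 * D / real N)" by simp
  finally show ?thesis .
qed

text \<open>Markov's inequality on the exponential moment. The event concerns an infinite ball, but
  there are finitely many samples, so one violating function chosen for each violating sample makes
  up a finite set \<open>Y\<close>.\<close>

lemma deviation_tail_one_sided:
  assumes N: "0 < N" and s: "s \<in> {1, -1}" and \<xi>: "0 < \<xi>" "\<xi> * (8 * \<kappa> * D) \<le> real N"
    and m: "16 * D\<^sup>2 * \<kappa>\<^sup>2 \<le> real m" "0 < m"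
  shows "iter_mean J q N (\<lambda>l. if \<exists>f\<in>V. nrm f \<le> 1 \<and> \<eta> < s * dev N l f then 1 else 0)
    \<le> 2 * real m * exp (64 * \<kappa> * \<xi>\<^sup>2 * D / real N - \<xi> * \<eta>)"
proof -
  define bad where "bad l f \<longleftrightarrow> f \<in> V \<and> nrm f \<le> 1 \<and> \<eta> < s * dev N l f" for l f
  define Y where "Y = insert (\<lambda>_. 0) ((\<lambda>l. SOME f. bad l f) ` {l \<in> samples J N. \<exists>f. bad l f})"
  have Y: "finite Y" "Y \<noteq> {}" unfolding Y_def using finite_samples[OF fin] by auto
  have YV: "f \<in> V \<and> nrm f \<le> 1" if "f \<in> Y" for f
  proof -
    have "bad l (SOME f. bad l f)" if "\<exists>f. bad l f" for l by (rule someI_ex[OF that])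
    then have "f = (\<lambda>_. 0) \<or> (\<exists>l. bad l f)" using that unfolding Y_def by blast
    then show ?thesis using zero by (auto simp: bad_def nrm_def)
  qed
  have "iter_mean J q N (\<lambda>l. if \<exists>f\<in>V. nrm f \<le> 1 \<and> \<eta> < s * dev N l f then 1 else 0)
      \<le> iter_mean J q N (\<lambda>l. exp (- \<xi> * \<eta>) * Max ((\<lambda>f. exp (\<xi> * (s * dev N l f))) ` Y))"
  proof (rule iter_mean_mono)
    fix l assume l: "l \<in> samples J N"
    have pos: "0 \<le> Max ((\<lambda>f. exp (\<xi> * (s * dev N l f))) ` Y)"
      using Y by (subst Max_ge_iff) (auto simp: Y_def)
    show "(if \<exists>f\<in>V. nrm f \<le> 1 \<and> \<eta> < s * dev N l f then 1 else 0)
      \<le> exp (- \<xi> * \<eta>) * Max ((\<lambda>f. exp (\<xi> * (s * dev N l f))) ` Y)"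
    proof (cases "\<exists>f\<in>V. nrm f \<le> 1 \<and> \<eta> < s * dev N l f")
      case True
      then have ex: "\<exists>f. bad l f" by (auto simp: bad_def)
      define g where "g = (SOME f. bad l f)"
      have g: "bad l g" unfolding g_def by (rule someI_ex[OF ex])
      have gY: "g \<in> Y" using ex l unfolding Y_def g_def by blast
      have "\<xi> * \<eta> \<le> \<xi> * (s * dev N l g)" using g \<xi>(1) by (intro mult_left_mono) (auto simp: bad_def)
      then have "exp (\<xi> * \<eta>) \<le> exp (\<xi> * (s * dev N l g))" by simp
      also have "\<dots> \<le> Max ((\<lambda>f. exp (\<xi> * (s * dev N l f))) ` Y)" using Y gY by (intro Max_ge) auto
      finally have le: "exp (- \<xi> * \<eta>) * exp (\<xi> * \<eta>) \<le> exp (- \<xi> * \<eta>) * Max ((\<lambda>f. exp (\<xi> * (s * dev N l f))) ` Y)"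
        by (intro mult_left_mono) auto
      have "1 = exp (- \<xi> * \<eta>) * exp (\<xi> * \<eta>)" by (simp flip: exp_add)
      also note le
      finally show ?thesis unfolding if_P[OF True] .
    next
      case False
      show ?thesis unfolding if_not_P[OF False] using pos by simp
    qed
  qed
  also have "\<dots> = exp (- \<xi> * \<eta>) * iter_mean J q N (\<lambda>l. Max ((\<lambda>f. exp (\<xi> * (s * dev N l f))) ` Y))"
    by (rule iter_mean_cmult)
  also have "\<dots> \<le> exp (- \<xi> * \<eta>) * (2 * real m * exp (64 * \<kappa> * \<xi>\<^sup>2 * D / real N))"
    by (intro mult_left_mono deviation_mgf N s \<xi> m Y YV) auto
  also have "\<dots> = 2 * real m * exp (64 * \<kappa> * \<xi>\<^sup>2 * D / real N - \<xi> * \<eta>)"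
    by (simp add: exp_diff exp_minus field_simps)
  finally show ?thesis .
qed

text \<open>Both signs are added, and homogeneity passes from the unit ball to all of
  \<open>V\<close>; a function of zero norm vanishes on \<open>J\<close> and has no
  deviation.\<close>

lemma deviation_tail:
  assumes N: "0 < N" and \<xi>: "0 < \<xi>" "\<xi> * (8 * \<kappa> * D) \<le> real N"
    and m: "16 * D\<^sup>2 * \<kappa>\<^sup>2 \<le> real m" "0 < m"
  shows "iter_mean J q N (\<lambda>l. if \<forall>f\<in>V. \<bar>dev N l f\<bar> \<le> \<eta> * nrm f then 0 else 1)
    \<le> 4 * real m * exp (64 * \<kappa> * \<xi>\<^sup>2 * D / real N - \<xi> * \<eta>)"
proof -
  define B where "B s l = (if \<exists>f\<in>V. nrm f \<le> 1 \<and> \<eta> < s * dev N l f then 1 else 0 :: real)" for s l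
  have "iter_mean J q N (\<lambda>l. if \<forall>f\<in>V. \<bar>dev N l f\<bar> \<le> \<eta> * nrm f then 0 else 1)
      \<le> iter_mean J q N (\<lambda>l. B 1 l + B (-1) l)"
  proof (rule iter_mean_mono)
    fix l assume l: "l \<in> samples J N"
    show "(if \<forall>f\<in>V. \<bar>dev N l f\<bar> \<le> \<eta> * nrm f then 0 else 1) \<le> B 1 l + B (-1) l"
    proof (cases "\<forall>f\<in>V. \<bar>dev N l f\<bar> \<le> \<eta> * nrm f")
      case True
      then show ?thesis by (simp add: B_def)
    next
      case False
      then obtain f where f: "f \<in> V" "\<eta> * nrm f < \<bar>dev N l f\<bar>" by force
      have "nrm f \<noteq> 0"
      proof
        assume z: "nrm f = 0"
        have "D * \<bar>f i\<bar> / (real N * w i) = 0" if "i \<in> J" for i using nrm_0[OF f(1) z that] by simp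
        then have "sum_list (map (\<lambda>i. D * \<bar>f i\<bar> / (real N * w i)) l) = sum_list (map (\<lambda>i. 0) l)"
          by (rule sum_list_samples[OF l])
        then show False using f(2) z by (simp add: dev_def)
      qed
      then have n: "0 < nrm f" using nrm_nonneg[of f] by simp
      define g where "g = (\<lambda>i. (1 / nrm f) * f i)"
      have g: "g \<in> V" unfolding g_def by (rule scale[OF f(1)])
      have g1: "nrm g \<le> 1" unfolding g_def nrm_scale using n by simp
      have "dev N l g = dev N l f / nrm f"
      proof -
        have "sum_list (map (\<lambda>i. D * \<bar>g i\<bar> / (real N * w i)) l) =
            sum_list (map (\<lambda>i. D * \<bar>f i\<bar> / (real N * w i)) l) / nrm f"
          using n by (induction l) (simp_all add: g_def abs_mult add_divide_distrib)
        then show ?thesis using n unfolding dev_def g_def nrm_scale by (simp add: diff_divide_distrib)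
      qed
      then have "\<eta> < \<bar>dev N l g\<bar>" using f(2) n by (simp add: pos_less_divide_eq)
      then have "\<eta> < 1 * dev N l g \<or> \<eta> < -1 * dev N l g" by linarith
      then have "B 1 l = 1 \<or> B (-1) l = 1" using g g1 by (auto simp: B_def)
      moreover have "0 \<le> B 1 l" "0 \<le> B (-1) l" by (auto simp: B_def)
      ultimately show ?thesis using False by auto
    qed
  qed
  also have "\<dots> = iter_mean J q N (B 1) + iter_mean J q N (B (-1))" by (rule iter_mean_add)
  also have "\<dots> \<le> 2 * real m * exp (64 * \<kappa> * \<xi>\<^sup>2 * D / real N - \<xi> * \<eta>) +
      2 * real m * exp (64 * \<kappa> * \<xi>\<^sup>2 * D / real N - \<xi> * \<eta>)"
    unfolding B_def by (intro add_mono deviation_tail_one_sided N \<xi> m) auto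
  finally show ?thesis by simp
qed

text \<open>The budget of the exponent in units of \<open>L\<close>:
  \<open>ln (68 * \<kappa> ^ 4) / ln 2 + 2\<close> pays for the number of points, 1 for the
  quadratic term, and \<open>c\<close> remains as failure exponent. Their sum is \<open>a\<close>,
  and \<open>\<xi>\<close> is chosen with \<open>\<xi> * \<eta> = a * L\<close>.\<close>

lemma sampling_failure:
  fixes c \<eta> :: real and d N :: nat
  defines "a \<equiv> ln (68 * \<kappa> ^ 4) / ln 2 + 3 + c" and "L \<equiv> ln (real (max 2 d))"
  assumes D: "D \<le> \<kappa> * real d" and c: "0 < c" and \<eta>: "0 < \<eta>" "\<eta> \<le> 1"
    and N: "64 * a\<^sup>2 * \<kappa>\<^sup>2 * real d * L / \<eta>\<^sup>2 \<le> real N"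
  shows "iter_mean J q N (\<lambda>l. if \<forall>f\<in>V. \<bar>dev N l f\<bar> \<le> \<eta> * nrm f then 0 else 1) \<le> real (max 2 d) powr (- c)"
proof -
  have d: "0 < d" using D D_pos \<kappa> by (cases d) auto
  have \<kappa>4: "1 \<le> \<kappa> ^ 4" using \<kappa> by (rule one_le_power)
  have L2: "ln 2 \<le> L" unfolding L_def by (intro ln_le_cancel_iff[THEN iffD2]) auto
  have ln2: "0 < ln (2::real)" by simp
  have L: "0 < L" using L2 ln2 by linarith
  have lnk: "0 \<le> ln (68 * \<kappa> ^ 4)" using \<kappa>4 by (intro ln_ge_zero) auto
  then have a: "3 \<le> a" using c ln2 by (simp add: a_def)
  define \<xi> where "\<xi> = a * L / \<eta>"
  have \<xi>: "0 < \<xi>" using a L \<eta> by (simp add: \<xi>_def)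
  have Nk: "64 * a\<^sup>2 * \<kappa> * D * L / \<eta>\<^sup>2 \<le> real N"
  proof -
    have "64 * a\<^sup>2 * \<kappa> * D * L / \<eta>\<^sup>2 = 64 * a\<^sup>2 * \<kappa> * L / \<eta>\<^sup>2 * D" by simp
    also have "\<dots> \<le> 64 * a\<^sup>2 * \<kappa> * L / \<eta>\<^sup>2 * (\<kappa> * real d)"
      using D L \<kappa> by (intro mult_left_mono) auto
    also have "\<dots> = 64 * a\<^sup>2 * \<kappa>\<^sup>2 * real d * L / \<eta>\<^sup>2" by (simp add: power2_eq_square)
    finally show ?thesis using N by linarith
  qed
  have pos: "0 < 64 * a\<^sup>2 * \<kappa> * D * L / \<eta>\<^sup>2" using a \<kappa> D_pos L \<eta> by simp
  then have Np: "0 < real N" using Nk by linarith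
  define m where "m = nat \<lceil>16 * \<kappa> ^ 4 * (real d)\<^sup>2\<rceil>"
  have m1: "16 * \<kappa> ^ 4 * (real d)\<^sup>2 \<le> real m" unfolding m_def by (rule real_nat_ceiling_ge)
  have mD: "16 * D\<^sup>2 * \<kappa>\<^sup>2 \<le> real m"
  proof -
    have "D\<^sup>2 \<le> (\<kappa> * real d)\<^sup>2" using D D_pos by (intro power_mono) auto
    then have "16 * D\<^sup>2 * \<kappa>\<^sup>2 \<le> 16 * (\<kappa> * real d)\<^sup>2 * \<kappa>\<^sup>2" by (intro mult_right_mono mult_left_mono) auto
    also have "\<dots> = 16 * \<kappa> ^ 4 * (real d)\<^sup>2" by (simp add: power2_eq_square power4_eq_xxxx)
    finally show ?thesis using m1 by linarith
  qed
  have "0 < 16 * \<kappa> ^ 4 * (real d)\<^sup>2" using d \<kappa> by simp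
  then have m0: "0 < m" using m1 by linarith
  define R where "R = real (max 2 d)"
  have R: "2 \<le> R" "real d \<le> R" by (auto simp: R_def)
  \<comment> \<open>\<open>68 = 4 * (16 + 1)\<close>, where the 1 absorbs the ceiling. The constant
    becomes a multiple of \<open>L\<close> through \<open>ln 2 \<le> L\<close>, since the final
    bound is to be a pure power of \<open>max 2 d\<close>.\<close>
  have mR: "4 * real m \<le> exp (ln (68 * \<kappa> ^ 4) / ln 2 * L + 2 * L)"
  proof -
    have "0 \<le> \<lceil>16 * \<kappa> ^ 4 * (real d)\<^sup>2\<rceil>"
      using ceiling_mono[of 0 "16 * \<kappa> ^ 4 * (real d)\<^sup>2"] \<kappa> by simp
    then have "real m \<le> 16 * \<kappa> ^ 4 * (real d)\<^sup>2 + 1"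
      unfolding m_def by (simp add: of_int_ceiling_le_add_one)
    also have "1 \<le> \<kappa> ^ 4 * (real d)\<^sup>2"
      using mult_mono[OF \<kappa>4, of 1 "(real d)\<^sup>2"] d \<kappa> by (simp add: one_le_power)
    finally have "4 * real m \<le> 68 * \<kappa> ^ 4 * (real d)\<^sup>2" by simp
    also have "\<dots> \<le> 68 * \<kappa> ^ 4 * R\<^sup>2" using R \<kappa>4 by (intro mult_left_mono power_mono) auto
    also have "\<dots> = exp (ln (68 * \<kappa> ^ 4)) * exp (2 * L)"
    proof -
      have "exp (2 * L) = (exp L)\<^sup>2" by (simp add: power2_eq_square flip: exp_add)
      also have "exp L = R" unfolding L_def R_def by simp
      finally have "exp (2 * L) = R\<^sup>2" .
      moreover have "0 < 68 * \<kappa> ^ 4" using \<kappa>4 by linarith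
      ultimately show ?thesis by (simp only: exp_ln)
    qed
    also have "\<dots> = exp (ln (68 * \<kappa> ^ 4) / ln 2 * ln 2 + 2 * L)" by (simp add: exp_add)
    also have "\<dots> \<le> exp (ln (68 * \<kappa> ^ 4) / ln 2 * L + 2 * L)"
      using L2 lnk ln2 by (intro exp_le_cancel_iff[THEN iffD2] add_right_mono mult_left_mono divide_nonneg_nonneg) auto
    finally show ?thesis .
  qed
  have \<xi>N: "\<xi> * (8 * \<kappa> * D) \<le> real N"
  proof -
    have "8 * (a * 1) * \<eta> \<le> 64 * (a * a)"
    proof -
      have "a * 1 \<le> a * a" using a by (intro mult_left_mono) auto
      moreover have "8 * (a * 1) * \<eta> \<le> 8 * (a * 1) * 1" using a \<eta> by (intro mult_left_mono) auto
      ultimately show ?thesis using a by linarith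
    qed
    then have "(8 * a * \<eta>) * (\<kappa> * D * L / \<eta>\<^sup>2) \<le> (64 * (a * a)) * (\<kappa> * D * L / \<eta>\<^sup>2)"
      using \<kappa> D_pos L by (intro mult_right_mono) auto
    also have "\<dots> = 64 * a\<^sup>2 * \<kappa> * D * L / \<eta>\<^sup>2" by (simp add: power2_eq_square)
    also have "\<dots> \<le> real N" by (rule Nk)
    finally show ?thesis using \<eta> by (simp add: \<xi>_def power2_eq_square mult_ac)
  qed
  have ex: "64 * \<kappa> * \<xi>\<^sup>2 * D / real N \<le> L"
  proof -
    have "64 * \<kappa> * \<xi>\<^sup>2 * D = L * (64 * a\<^sup>2 * \<kappa> * D * L / \<eta>\<^sup>2)"
      by (simp add: \<xi>_def power_divide power_mult_distrib power2_eq_square)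
    also have "\<dots> \<le> L * real N" using Nk L by (intro mult_left_mono) auto
    finally show ?thesis using Np by (simp add: pos_divide_le_eq)
  qed
  have "iter_mean J q N (\<lambda>l. if \<forall>f\<in>V. \<bar>dev N l f\<bar> \<le> \<eta> * nrm f then 0 else 1)
      \<le> 4 * real m * exp (64 * \<kappa> * \<xi>\<^sup>2 * D / real N - \<xi> * \<eta>)"
    using Np by (intro deviation_tail \<xi> \<xi>N mD m0) auto
  also have "\<dots> \<le> exp (ln (68 * \<kappa> ^ 4) / ln 2 * L + 2 * L) * exp (L - a * L)"
    using ex \<eta> by (intro mult_mono mR) (auto simp: \<xi>_def)
  also have "\<dots> = exp (- c * L)" unfolding exp_add[symmetric] by (simp add: a_def algebra_simps)
  also have "\<dots> = real (max 2 d) powr (- c)" by (simp add: powr_def L_def)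
  finally show ?thesis .
qed

end

section \<open>Iterating leverage scores\<close>

text \<open>The vector \<open>A x\<close> continued by 0 to all of \<open>nat\<close>, the form in
  which \<open>lewis_space\<close> expects its functions.\<close>

definition image_fun :: "real mat \<Rightarrow> real vec \<Rightarrow> nat \<Rightarrow> real" where
  "image_fun A x i = (if i < dim_row A then row A i \<bullet> x else 0)"

definition image_space :: "real mat \<Rightarrow> (nat \<Rightarrow> real) set" where
  "image_space A = image_fun A ` carrier_vec (dim_col A)"

lemma image_space_lin:
  assumes "f \<in> image_space A" "g \<in> image_space A"
  shows "(\<lambda>i. a * f i + b * g i) \<in> image_space A"
proof -
  obtain x y where x: "x \<in> carrier_vec (dim_col A)" "f = image_fun A x"
    and y: "y \<in> carrier_vec (dim_col A)" "g = image_fun A y"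
    using assms by (auto simp: image_space_def)
  have "(\<lambda>i. a * f i + b * g i) = image_fun A (a \<cdot>\<^sub>v x + b \<cdot>\<^sub>v y)"
  proof
    fix i
    have "row A i \<in> carrier_vec (dim_col A)" by simp
    then show "a * f i + b * g i = image_fun A (a \<cdot>\<^sub>v x + b \<cdot>\<^sub>v y) i"
      using x y scalar_prod_add_distrib[of "row A i" "dim_col A" "a \<cdot>\<^sub>v x" "b \<cdot>\<^sub>v y"]
      by (simp add: image_fun_def)
  qed
  then show ?thesis using x y by (auto simp: image_space_def)
qed

lemma image_space_zero: "(\<lambda>i. 0) \<in> image_space A"
proof -
  have "(\<lambda>i. 0) = image_fun A (0\<^sub>v (dim_col A))"
    by (auto simp: image_fun_def)
  then show ?thesis by (auto simp: image_space_def)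
qed

text \<open>\<open>M\<close> has the rows \<open>c k\<close> times row \<open>idx k\<close> of
  \<open>A\<close>. The functions \<open>\<mu> l\<close> are the columns of its hat matrix before
  scaling, extended from the selected rows to all rows of \<open>A\<close>.\<close>

lemma image_space_reproducing:
  fixes c :: "nat \<Rightarrow> real" and idx :: "nat \<Rightarrow> nat"
  shows "\<exists>\<mu>. (\<forall>k<m. \<mu> k \<in> image_space A) \<and>
      (\<forall>f\<in>image_space A. \<forall>k<m. c k * f (idx k) = (\<Sum>l<m. (c k * \<mu> l (idx k)) * (c l * f (idx l)))) \<and>
      (\<forall>k<m. \<forall>l<m. c k * \<mu> l (idx k) = c l * \<mu> k (idx l))"
proof -
  define d where "d = dim_col A"
  define M where "M = mat m d (\<lambda>(k,j). c k * (if idx k < dim_row A then A $$ (idx k, j) else 0))"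
  have M: "M \<in> carrier_mat m d" by (simp add: M_def)
  have rowM: "row M k \<bullet> x = c k * image_fun A x (idx k)" if "k < m" "x \<in> carrier_vec d" for k x
    using that by (simp add: M_def image_fun_def scalar_prod_def d_def sum_distrib_left mult.assoc)
  define v where "v l = pseudo_inverse (transpose_mat M * M) *\<^sub>v row M l" for l
  have v: "v l \<in> carrier_vec d" for l unfolding v_def by (rule kern_vec[OF M])
  define \<mu> where "\<mu> l = image_fun A (v l)" for l
  have K: "kern M k l = c k * \<mu> l (idx k)" if "k < m" for k l
    using rowM[OF that v[of l]] by (simp add: kern_def v_def \<mu>_def)
  have "\<mu> k \<in> image_space A" for k using v by (auto simp: \<mu>_def image_space_def d_def)
  moreover have "c k * f (idx k) = (\<Sum>l<m. (c k * \<mu> l (idx k)) * (c l * f (idx l)))"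
    if f: "f \<in> image_space A" and k: "k < m" for f k
  proof -
    obtain x where x: "x \<in> carrier_vec d" "f = image_fun A x" using f by (auto simp: image_space_def d_def)
    show ?thesis using kern_reproducing[OF M k x(1)] k by (simp add: rowM x K)
  qed
  moreover have "c k * \<mu> l (idx k) = c l * \<mu> k (idx l)" if "k < m" "l < m" for k l
    using kern_sym[OF M that] that by (simp add: K)
  ultimately show ?thesis by blast
qed

text \<open>Rows of weight 0 get the entry \<open>1 / sqrt 0 = 0\<close>; for admissible weights they are zero rows of \<open>A\<close>.\<close>

definition weight_matrix :: "nat \<Rightarrow> (nat \<Rightarrow> real) \<Rightarrow> real mat" where
  "weight_matrix n w = mat n n (\<lambda>(i,j). if i = j then 1 / sqrt (w i) else 0)"

lemma weight_matrix_nonneg_diagonal: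
  "(\<And>i. i < n \<Longrightarrow> 0 \<le> w i) \<Longrightarrow> nonneg_diagonal n (weight_matrix n w)"
  by (auto simp: nonneg_diagonal_def weight_matrix_def diagonal_mat_def)

text \<open>The invariant of the iteration. A weight may be 0 only at a zero row of
  \<open>A\<close>, so the convention \<open>x / 0 = 0\<close> loses nothing in
  \<open>energy\<close>.\<close>

definition admissible :: "real mat \<Rightarrow> nat \<Rightarrow> (nat \<Rightarrow> real) \<Rightarrow> bool" where
  "admissible A n w \<longleftrightarrow> (\<forall>i<n. 0 \<le> w i \<and> (w i = 0 \<longrightarrow> (\<forall>f\<in>image_space A. f i = 0)))"

definition energy :: "nat \<Rightarrow> (nat \<Rightarrow> real) \<Rightarrow> (nat \<Rightarrow> real) \<Rightarrow> real" where
  "energy n w f = (\<Sum>j<n. (f j)\<^sup>2 / w j)"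

text \<open>The leverage score of row \<open>i\<close> of \<open>W\<^sup>-\<^sup>1\<^sup>/\<^sup>2 A\<close> times \<open>w i\<close>, that is
  \<open>a\<^sub>i\<^sup>T (A\<^sup>T W\<^sup>-\<^sup>1 A)\<^sup>+ a\<^sub>i\<close>.\<close>

definition quad :: "real mat \<Rightarrow> nat \<Rightarrow> (nat \<Rightarrow> real) \<Rightarrow> nat \<Rightarrow> real" where
  "quad A n w i = w i * leverage_score (weight_matrix n w * A) i"

definition update :: "nat \<Rightarrow> (real mat \<Rightarrow> real vec) \<Rightarrow> (nat \<Rightarrow> real) \<Rightarrow> nat \<Rightarrow> real" where
  "update n T w i = sqrt (w i * T (weight_matrix n w) $ i)"

definition weights :: "nat \<Rightarrow> (real mat \<Rightarrow> real vec) \<Rightarrow> nat \<Rightarrow> nat \<Rightarrow> real" where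
  "weights n T k = (update n T ^^ k) (\<lambda>_. 1)"

context
  fixes A :: "real mat" and n d :: nat
  assumes A: "A \<in> carrier_mat n d"
begin

lemma weighted_row:
  assumes w: "admissible A n w" and j: "j < n" and x: "x \<in> carrier_vec d"
  shows "row (weight_matrix n w * A) j \<bullet> x = image_fun A x j / sqrt (w j)"
proof -
  have "row (weight_matrix n w * A) j = (1 / sqrt (w j)) \<cdot>\<^sub>v row A j"
  proof (rule eq_vecI)
    fix k assume "k < dim_vec ((1 / sqrt (w j)) \<cdot>\<^sub>v row A j)"
    then have k: "k < d" using A by simp
    have "row (weight_matrix n w * A) j $ k = (\<Sum>i<n. (if j = i then 1 / sqrt (w j) else 0) * A $$ (i, k))"
      using A j k by (simp add: weight_matrix_def scalar_prod_def lessThan_atLeast0)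
    also have "\<dots> = (\<Sum>i<n. if j = i then 1 / sqrt (w j) * A $$ (i, k) else 0)"
      by (intro sum.cong) auto
    finally show "row (weight_matrix n w * A) j $ k = ((1 / sqrt (w j)) \<cdot>\<^sub>v row A j) $ k"
      using A j k by simp
  qed (use A in simp)
  then show ?thesis using A j x by (simp add: image_fun_def)
qed

text \<open>The variational description of \<open>quad\<close>: the inequality is Cauchy-Schwarz
  applied to the reproducing formula, and the rescaled kernel column attains it. Comparisons between
  different weights rest on these two facts.\<close>

lemma leverage_facts:
  assumes w: "admissible A n w" and i: "i < n"
  shows "f \<in> image_space A \<Longrightarrow> (f i)\<^sup>2 \<le> quad A n w i * energy n w f"
    and "\<exists>g\<in>image_space A. g i = quad A n w i \<and> energy n w g = quad A n w i"
    and "0 \<le> leverage_score (weight_matrix n w * A) i"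
proof -
  define M where "M = weight_matrix n w * A"
  have M: "M \<in> carrier_mat n d"
    unfolding M_def by (rule mult_carrier_mat[OF _ A]) (simp add: weight_matrix_def)
  have sq: "(row M j \<bullet> x)\<^sup>2 = (image_fun A x j)\<^sup>2 / w j" if "j < n" "x \<in> carrier_vec d" for j x
    using weighted_row[OF w that] w that by (simp add: M_def power_divide admissible_def)
  have vanish: "image_fun A x i = 0" if "w i = 0" "x \<in> carrier_vec d" for x
    using w i that A by (auto simp: admissible_def image_space_def)
  define v where "v = pseudo_inverse (transpose_mat M * M) *\<^sub>v row M i"
  have v: "v \<in> carrier_vec d" unfolding v_def by (rule kern_vec[OF M])
  have Kv: "row M j \<bullet> v = kern M j i" for j by (simp add: v_def kern_def)
  have KK: "(\<Sum>j<n. (kern M i j)\<^sup>2) = kern M i i"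
  proof -
    have "(\<Sum>j<n. (kern M i j)\<^sup>2) = (\<Sum>j<n. kern M i j * (row M j \<bullet> v))"
    proof (intro sum.cong refl)
      fix j assume "j \<in> {..<n}"
      then have "kern M j i = kern M i j" by (intro kern_sym[OF M _ i]) simp
      then show "(kern M i j)\<^sup>2 = kern M i j * (row M j \<bullet> v)" by (simp add: Kv power2_eq_square)
    qed
    also have "\<dots> = kern M i i" unfolding kern_reproducing[OF M i v, symmetric] by (rule Kv)
    finally show ?thesis .
  qed
  show "0 \<le> leverage_score (weight_matrix n w * A) i"
    unfolding leverage_score_kern M_def[symmetric] by (subst KK[symmetric]) (simp add: sum_nonneg)
  have wi: "0 \<le> w i" using w i by (simp add: admissible_def)
  show "(f i)\<^sup>2 \<le> quad A n w i * energy n w f" if f: "f \<in> image_space A"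
  proof (cases "w i = 0")
    case True
    then show ?thesis using w i f by (simp add: admissible_def quad_def)
  next
    case False
    then have wi: "0 < w i" using wi by simp
    obtain x where x: "x \<in> carrier_vec d" "f = image_fun A x" using f A by (auto simp: image_space_def)
    have "(f i)\<^sup>2 / w i = (\<Sum>j<n. kern M i j * (row M j \<bullet> x))\<^sup>2"
      using sq[OF i x(1)] kern_reproducing[OF M i x(1)] x by simp
    also have "\<dots> \<le> (\<Sum>j<n. (kern M i j)\<^sup>2) * (\<Sum>j<n. (row M j \<bullet> x)\<^sup>2)"
      by (rule Cauchy_Schwarz_ineq_sum)
    also have "\<dots> = kern M i i * energy n w f" by (simp add: KK sq x energy_def)
    finally show ?thesis using wi
      by (simp add: quad_def leverage_score_kern M_def[symmetric] pos_divide_le_eq mult_ac)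
  qed
  show "\<exists>g\<in>image_space A. g i = quad A n w i \<and> energy n w g = quad A n w i"
  \<comment> \<open>The summand with factor 0 gives the witness the shape required by
    \<open>image_space_lin\<close>.\<close>
  proof (intro bexI[of _ "\<lambda>j. sqrt (w i) * image_fun A v j + 0 * image_fun A v j"] conjI)
    show "(\<lambda>j. sqrt (w i) * image_fun A v j + 0 * image_fun A v j) \<in> image_space A"
      using v A by (intro image_space_lin) (auto simp: image_space_def)
    have "sqrt (w i) * image_fun A v i = w i * kern M i i"
    proof (cases "w i = 0")
      case False
      have "image_fun A v i / sqrt (w i) = kern M i i"
        using weighted_row[OF w i v] Kv[of i] by (simp add: M_def)
      then have "image_fun A v i = kern M i i * sqrt (w i)"
        using False wi by (simp add: field_simps)
      then show ?thesis using wi by simp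
    qed simp
    then show "sqrt (w i) * image_fun A v i + 0 * image_fun A v i = quad A n w i"
      by (simp add: quad_def leverage_score_kern M_def)
    have "energy n w (\<lambda>j. sqrt (w i) * image_fun A v j) = w i * (\<Sum>j<n. (row M j \<bullet> v)\<^sup>2)"
      using wi by (simp add: energy_def sq v power_mult_distrib sum_distrib_left)
    also have "(\<Sum>j<n. (row M j \<bullet> v)\<^sup>2) = kern M i i"
      unfolding Kv KK[symmetric] by (intro sum.cong refl) (simp add: kern_sym[OF M _ i])
    finally show "energy n w (\<lambda>j. sqrt (w i) * image_fun A v j + 0 * image_fun A v j) = quad A n w i"
      by (simp add: quad_def leverage_score_kern M_def)
  qed
qed

lemma quad_nonneg: "admissible A n w \<Longrightarrow> i < n \<Longrightarrow> 0 \<le> quad A n w i"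
  using leverage_facts(3)[of w i] by (simp add: quad_def admissible_def)

lemma leverage_sum:
  "admissible A n w \<Longrightarrow> (\<Sum>i<n. leverage_score (weight_matrix n w * A) i) \<le> real d"
  unfolding leverage_score_kern using A by (intro kern_trace) (auto simp: weight_matrix_def)

lemma energy_nonneg: "admissible A n w \<Longrightarrow> 0 \<le> energy n w f"
  unfolding energy_def admissible_def by (intro sum_nonneg divide_nonneg_nonneg) auto

text \<open>Stands in for the fact that inversion reverses the order of semidefinite matrices: the
  extremal function for \<open>w'\<close> is tested against \<open>w\<close>.\<close>

lemma quad_le_of_energy_le:
  assumes w: "admissible A n w" and w': "admissible A n w'" and i: "i < n"
    and le: "\<And>f. f \<in> image_space A \<Longrightarrow> energy n w f \<le> \<rho> * energy n w' f"
  shows "quad A n w' i \<le> \<rho> * quad A n w i"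
proof -
  obtain g where g: "g \<in> image_space A" "g i = quad A n w' i" "energy n w' g = quad A n w' i"
    using leverage_facts(2)[OF w' i] by blast
  have "(quad A n w' i)\<^sup>2 \<le> quad A n w i * energy n w g" using leverage_facts(1)[OF w i g(1)] g(2) by simp
  also have "\<dots> \<le> quad A n w i * (\<rho> * quad A n w' i)"
    using le[OF g(1)] g(3) quad_nonneg[OF w i] by (intro mult_left_mono) auto
  finally have *: "quad A n w' i * quad A n w' i \<le> (\<rho> * quad A n w i) * quad A n w' i"
    by (simp add: power2_eq_square mult_ac)
  show ?thesis
  proof (cases "quad A n w' i = 0")
    case False
    then have "0 < quad A n w' i" using quad_nonneg[OF w' i] by simp
    with * show ?thesis by (rule mult_right_le_imp_le)
  next
    case True
    \<comment> \<open>A negative \<open>\<rho>\<close> makes every energy for \<open>w\<close>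
      nonpositive, and the extremal function for \<open>w\<close> then gives
      \<open>quad A n w i = 0\<close>.\<close>
    have "0 \<le> \<rho> \<or> quad A n w i = 0"
    proof (rule ccontr)
      assume "\<not> ?thesis"
      then have \<rho>: "\<rho> < 0" and "0 < quad A n w i" using quad_nonneg[OF w i] by auto
      obtain g where g: "g \<in> image_space A" "energy n w g = quad A n w i"
        using leverage_facts(2)[OF w i] by blast
      have "\<rho> * energy n w' g \<le> 0" using \<rho> energy_nonneg[OF w'] by (intro mult_nonpos_nonneg) auto
      then show False using le[OF g(1)] g(2) \<open>0 < quad A n w i\<close> by linarith
    qed
    then show ?thesis using True quad_nonneg[OF w i] by auto
  qed
qed

lemma energy_le_of_weights_le:
  assumes w: "admissible A n w" and w': "admissible A n w'" and le: "\<And>j. j < n \<Longrightarrow> w' j \<le> \<rho> * w j"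
    and f: "f \<in> image_space A"
  shows "energy n w f \<le> \<rho> * energy n w' f"
  unfolding energy_def sum_distrib_left
proof (rule sum_mono)
  fix j assume "j \<in> {..<n}"
  then have j: "j < n" by simp
  show "(f j)\<^sup>2 / w j \<le> \<rho> * ((f j)\<^sup>2 / w' j)"
  proof (cases "f j = 0")
    case False
    then have "w j \<noteq> 0" using w f j unfolding admissible_def by blast
    moreover have "w' j \<noteq> 0" using False w' f j unfolding admissible_def by blast
    moreover have "0 \<le> w j" "0 \<le> w' j" using w w' j by (auto simp: admissible_def)
    ultimately have "0 < w j" "0 < w' j" by auto
    then show ?thesis using mult_right_mono[OF le[OF j], of "(f j)\<^sup>2"] by (simp add: field_simps)
  qed simp
qed

section \<open>Contraction of the iteration for an arbitrary routine\<close>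

context
  fixes T assumes T: "leverage_routine A T"
begin

lemma routine_bounds:
  assumes w: "admissible A n w" and i: "i < n"
  shows "leverage_score (weight_matrix n w * A) i \<le> 2 * T (weight_matrix n w) $ i"
    and "T (weight_matrix n w) $ i \<le> 2 * leverage_score (weight_matrix n w * A) i"
proof -
  have "nonneg_diagonal n (weight_matrix n w)"
    using w by (intro weight_matrix_nonneg_diagonal) (auto simp: admissible_def)
  then have "leverage_approx2 (weight_matrix n w * A) (T (weight_matrix n w))"
    using T A by (simp add: leverage_routine_def)
  then have "approx_factor 2 (T (weight_matrix n w) $ i) (leverage_score (weight_matrix n w * A) i)"
    using i by (simp add: leverage_approx2_def weight_matrix_def)
  then show "leverage_score (weight_matrix n w * A) i \<le> 2 * T (weight_matrix n w) $ i"
    and "T (weight_matrix n w) $ i \<le> 2 * leverage_score (weight_matrix n w * A) i"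
    by (auto simp: approx_factor_def)
qed

lemma update_sq:
  assumes w: "admissible A n w" and i: "i < n"
  shows "0 \<le> update n T w i" "(update n T w i)\<^sup>2 = w i * T (weight_matrix n w) $ i"
    "quad A n w i \<le> 2 * (update n T w i)\<^sup>2" "(update n T w i)\<^sup>2 \<le> 2 * quad A n w i"
proof -
  have wi: "0 \<le> w i" using w i by (simp add: admissible_def)
  have t: "0 \<le> T (weight_matrix n w) $ i"
    using routine_bounds(1)[OF w i] leverage_facts(3)[OF w i] by linarith
  show "0 \<le> update n T w i" using wi t by (simp add: update_def)
  show sq: "(update n T w i)\<^sup>2 = w i * T (weight_matrix n w) $ i"
    using wi t by (simp add: update_def)
  show "quad A n w i \<le> 2 * (update n T w i)\<^sup>2" "(update n T w i)\<^sup>2 \<le> 2 * quad A n w i"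
    unfolding sq using mult_left_mono[OF routine_bounds(1)[OF w i] wi]
      mult_left_mono[OF routine_bounds(2)[OF w i] wi] by (simp_all add: quad_def)
qed

lemma admissible_update:
  assumes w: "admissible A n w"
  shows "admissible A n (update n T w)"
  unfolding admissible_def
proof (intro allI impI conjI ballI)
  fix i assume i: "i < n"
  show "0 \<le> update n T w i" by (rule update_sq(1)[OF w i])
  fix f assume z: "update n T w i = 0" and f: "f \<in> image_space A"
  have "quad A n w i = 0" using update_sq(3)[OF w i] quad_nonneg[OF w i] z by simp
  then show "f i = 0" using leverage_facts(1)[OF w i f] by simp
qed

text \<open>A ratio \<open>\<rho>\<close> of weights passes to the energies and to
  \<open>quad\<close>, and the square root halves its logarithm. The factor 2 is
  \<open>sqrt (2 * 2)\<close>, from the unrelated errors of the routine at \<open>w\<close> and at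
  \<open>w'\<close>.\<close>

lemma update_contraction:
  assumes w: "admissible A n w" "admissible A n w'" and \<rho>: "0 \<le> \<rho>"
    and le: "\<And>j. j < n \<Longrightarrow> w' j \<le> \<rho> * w j" and i: "i < n"
  shows "update n T w' i \<le> 2 * sqrt \<rho> * update n T w i"
proof (rule power2_le_imp_le)
  have "(update n T w' i)\<^sup>2 \<le> 2 * quad A n w' i" by (rule update_sq(4)[OF w(2) i])
  also have "\<dots> \<le> 2 * (\<rho> * quad A n w i)"
    by (intro mult_left_mono quad_le_of_energy_le[OF w i] energy_le_of_weights_le[OF w le]) auto
  also have "\<dots> \<le> 2 * (\<rho> * (2 * (update n T w i)\<^sup>2))"
    using \<rho> by (intro mult_left_mono update_sq(3)[OF w(1) i]) auto
  also have "\<dots> = (2 * sqrt \<rho> * update n T w i)\<^sup>2" using \<rho> by (simp add: power_mult_distrib)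
  finally show "(update n T w' i)\<^sup>2 \<le> (2 * sqrt \<rho> * update n T w i)\<^sup>2" .
  show "0 \<le> 2 * sqrt \<rho> * update n T w i" using \<rho> update_sq(1)[OF w(1) i] by simp
qed

lemma weights_Suc: "weights n T (Suc k) = update n T (weights n T k)"
  by (simp add: weights_def)

lemma admissible_weights: "admissible A n (weights n T k)"
proof (induction k)
  case 0
  show ?case by (simp add: weights_def admissible_def)
next
  case (Suc k)
  then show ?case unfolding weights_Suc by (rule admissible_update)
qed

text \<open>Starting from weight 1 the first update may shrink a weight arbitrarily, but from then on
  successive weights differ by at most a factor \<open>O(\<surd>n)\<close>.\<close>

lemma weights_ratio_base:
  assumes i: "i < n"
  shows "weights n T 2 i \<le> 4 * sqrt n * weights n T 1 i" and "weights n T 1 i \<le> 4 * sqrt n * weights n T 2 i"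
proof -
  have w: "admissible A n (weights n T 0)" "admissible A n (weights n T 1)" by (rule admissible_weights)+
  have w0: "weights n T 0 = (\<lambda>_. 1)" by (simp add: weights_def)
  have W: "weights n T 1 = update n T (weights n T 0)" "weights n T 2 = update n T (weights n T 1)"
    using weights_Suc[of 0] weights_Suc[of 1] by (simp_all add: numeral_2_eq_2)
  have n: "1 \<le> real n" using i by simp
  \<comment> \<open>For unit weights \<open>quad\<close> is an ordinary leverage score, at most 1
    because the extremal function satisfies \<open>(g j)\<^sup>2 \<le> g j\<close>.\<close>
  have q1: "quad A n (weights n T 0) j \<le> 1" if j: "j < n" for j
  proof -
    obtain g where g: "g j = quad A n (weights n T 0) j" "energy n (weights n T 0) g = quad A n (weights n T 0) j"
      using leverage_facts(2)[OF w(1) j] by blast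
    have "(g j)\<^sup>2 / 1 \<le> energy n (weights n T 0) g"
      unfolding energy_def w0 using j by (intro member_le_sum) auto
    then have "(quad A n (weights n T 0) j)\<^sup>2 \<le> quad A n (weights n T 0) j" using g by simp
    then show ?thesis by (rule power2_le_self_imp_le_one)
  qed
  have w1: "weights n T 1 j \<le> 2" if j: "j < n" for j
  proof (rule power2_le_imp_le)
    show "(weights n T 1 j)\<^sup>2 \<le> 2\<^sup>2" unfolding W(1) using update_sq(4)[OF w(1) j] q1[OF j] by simp
  qed simp
  have w1_nonneg: "0 \<le> weights n T 1 j" if j: "j < n" for j using w(2) j by (simp add: admissible_def)
  show "weights n T 2 i \<le> 4 * sqrt n * weights n T 1 i"
  proof (rule power2_le_imp_le)
    have "(weights n T 2 i)\<^sup>2 \<le> 2 * quad A n (weights n T 1) i" unfolding W(2) by (rule update_sq(4)[OF w(2) i])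
    also have "\<dots> \<le> 2 * (2 * quad A n (weights n T 0) i)"
    proof (intro mult_left_mono quad_le_of_energy_le[OF w i] energy_le_of_weights_le[OF w])
      fix j assume "j < n"
      then show "weights n T 1 j \<le> 2 * weights n T 0 j" using w1 by (simp add: w0)
    qed auto
    also have "\<dots> \<le> 2 * (2 * (2 * (weights n T 1 i)\<^sup>2))"
      unfolding W(1) by (intro mult_left_mono update_sq(3)[OF w(1) i]) auto
    also have "\<dots> \<le> 16 * real n * (weights n T 1 i)\<^sup>2"
    proof -
      have "8 * (weights n T 1 i)\<^sup>2 \<le> 16 * (real n * (weights n T 1 i)\<^sup>2)"
        using mult_right_mono[of 1 "real n" "(weights n T 1 i)\<^sup>2"] n zero_le_power2[of "weights n T 1 i"] by linarith
      then show ?thesis by (simp add: mult.assoc)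
    qed
    also have "\<dots> = (4 * sqrt n * weights n T 1 i)\<^sup>2" by (simp add: power_mult_distrib)
    finally show "(weights n T 2 i)\<^sup>2 \<le> (4 * sqrt n * weights n T 1 i)\<^sup>2" .
  qed (use w1_nonneg[OF i] in simp)
  \<comment> \<open>Here \<open>n\<close> enters. The leverage bound on \<open>(f j)\<^sup>2\<close>
    cancels the division by a possibly tiny weight, so each of the \<open>n\<close> summands is at
    most 4 times the energy for unit weights.\<close>
  have en: "energy n (weights n T 1) f \<le> 4 * real n * energy n (weights n T 0) f" if f: "f \<in> image_space A" for f
  proof -
    have "energy n (weights n T 1) f \<le> (\<Sum>j<n. 4 * energy n (weights n T 0) f)"
      unfolding energy_def[of n "weights n T 1"]
    proof (rule sum_mono)
      fix j assume "j \<in> {..<n}"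
      then have j: "j < n" by simp
      have e0: "0 \<le> energy n (weights n T 0) f" by (rule energy_nonneg[OF w(1)])
      show "(f j)\<^sup>2 / weights n T 1 j \<le> 4 * energy n (weights n T 0) f"
      proof (cases "weights n T 1 j = 0")
        case False
        then have p: "0 < weights n T 1 j" using w1_nonneg[OF j] by simp
        have "(f j)\<^sup>2 \<le> quad A n (weights n T 0) j * energy n (weights n T 0) f" by (rule leverage_facts(1)[OF w(1) j f])
        also have "\<dots> \<le> 2 * (weights n T 1 j)\<^sup>2 * energy n (weights n T 0) f"
          unfolding W(1) by (intro mult_right_mono update_sq(3)[OF w(1) j] e0)
        finally have "(f j)\<^sup>2 / weights n T 1 j \<le> 2 * weights n T 1 j * energy n (weights n T 0) f"
          using p by (simp add: power2_eq_square field_simps)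
        also have "\<dots> \<le> 2 * 2 * energy n (weights n T 0) f"
          using w1[OF j] e0 by (intro mult_right_mono mult_left_mono) auto
        finally show ?thesis by simp
      qed (use e0 in simp)
    qed
    then show ?thesis by simp
  qed
  show "weights n T 1 i \<le> 4 * sqrt n * weights n T 2 i"
  proof (rule power2_le_imp_le)
    have "(weights n T 1 i)\<^sup>2 \<le> 2 * quad A n (weights n T 0) i" unfolding W(1) by (rule update_sq(4)[OF w(1) i])
    also have "\<dots> \<le> 2 * (4 * real n * quad A n (weights n T 1) i)"
      by (intro mult_left_mono quad_le_of_energy_le[OF w(2,1) i en]) auto
    also have "\<dots> \<le> 2 * (4 * real n * (2 * (weights n T 2 i)\<^sup>2))"
      unfolding W(2) by (intro mult_left_mono update_sq(3)[OF w(2) i]) auto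
    also have "\<dots> = (4 * sqrt n * weights n T 2 i)\<^sup>2" by (simp add: power_mult_distrib)
    finally show "(weights n T 1 i)\<^sup>2 \<le> (4 * sqrt n * weights n T 2 i)\<^sup>2" .
    show "0 \<le> 4 * sqrt n * weights n T 2 i"
      using admissible_weights[of 2] i by (simp add: admissible_def)
  qed
qed

text \<open>4 is the fixed point of \<open>2 * sqrt \<rho>\<close>, so the constant stays as it is
  and each round only halves the exponent of \<open>n\<close>.\<close>

lemma weights_ratio:
  assumes i: "i < n"
  shows "weights n T (k + 2) i \<le> 4 * sqrt (n powr (1 / 2 ^ k)) * weights n T (k + 1) i
    \<and> weights n T (k + 1) i \<le> 4 * sqrt (n powr (1 / 2 ^ k)) * weights n T (k + 2) i"
  using i
proof (induction k arbitrary: i)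
  case 0
  then show ?case using weights_ratio_base[of i] by (simp add: numeral_2_eq_2)
next
  case (Suc k)
  let ?r = "4 * sqrt (n powr (1 / 2 ^ k))"
  have s: "sqrt (n powr (1 / 2 ^ k)) = n powr (1 / 2 ^ Suc k)"
    by (simp add: powr_half_sqrt[symmetric] powr_powr mult.commute)
  have r: "2 * sqrt ?r = 4 * sqrt (n powr (1 / 2 ^ Suc k))"
    unfolding s[symmetric] by (simp add: real_sqrt_mult)
  have r0: "0 \<le> ?r" by simp
  have "update n T (weights n T (k + 2)) i \<le> 2 * sqrt ?r * update n T (weights n T (k + 1)) i"
    by (rule update_contraction[OF admissible_weights admissible_weights r0 _ Suc.prems]) (use Suc.IH in blast)
  moreover have "update n T (weights n T (k + 1)) i \<le> 2 * sqrt ?r * update n T (weights n T (k + 2)) i"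
    by (rule update_contraction[OF admissible_weights admissible_weights r0 _ Suc.prems]) (use Suc.IH in blast)
  ultimately show ?case unfolding r weights_Suc[symmetric] by simp
qed

end
end

section \<open>The sampler\<close>

definition support :: "nat \<Rightarrow> (nat \<Rightarrow> real) \<Rightarrow> nat set" where
  "support n w = {i. i < n \<and> 0 < w i}"

lemma finite_support: "finite (support n w)"
  by (simp add: support_def)

text \<open>\<open>ln n \<le> 2 ^ r\<close> brings \<open>n powr (1 / 2 ^ r)\<close> below 4, so
  \<open>w\<close> and its update \<open>w'\<close> agree within \<open>4 * 2 = 8\<close>. Since
  \<open>w'\<close> squared is within 2 of \<open>quad\<close> at \<open>w\<close>, the constant is
  \<open>2 * 8\<^sup>2\<close>. The same comparison bounds \<open>w i\<close> by its leverage score,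
  whence the total weight. \<open>w'\<close> belongs to the analysis only; the program stops at
  \<open>w\<close>.\<close>

lemma weights_lewis_space:
  assumes A: "A \<in> carrier_mat n d" and T: "leverage_routine A T" and r: "ln n \<le> 2 ^ r"
  defines "w \<equiv> weights n T (Suc r)"
  assumes ne: "support n w \<noteq> {}"
  shows "lewis_space (support n w) w (image_space A) 128" and "sum w (support n w) \<le> 128 * real d"
proof -
  define w' where "w' = weights n T (r + 2)"
  have ad: "admissible A n w" "admissible A n w'"
    unfolding w_def w'_def by (rule admissible_weights[OF A T])+
  have w': "w' = update n T w" unfolding w_def w'_def using weights_Suc[OF A T, of "Suc r"] by simp
  have \<rho>: "4 * sqrt (n powr (1 / 2 ^ r)) \<le> 8" if "i < n" for i
  proof -
    have n: "0 < real n" using that by simp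
    have "n powr (1 / 2 ^ r) = exp (ln n / 2 ^ r)" using n by (simp add: powr_def)
    also have "\<dots> \<le> exp 1" using r by simp
    also have "\<dots> \<le> 3" by (rule exp_le)
    also have "\<dots> \<le> 2\<^sup>2" by simp
    finally have "sqrt (n powr (1 / 2 ^ r)) \<le> 2" by (intro real_le_lsqrt) auto
    then show ?thesis by simp
  qed
  have wnn: "0 \<le> w i" "0 \<le> w' i" if "i < n" for i
    using ad that unfolding admissible_def by auto
  have le: "w' i \<le> 8 * w i" "w i \<le> 8 * w' i" if i: "i < n" for i
  proof -
    have "w' i \<le> 4 * sqrt (n powr (1 / 2 ^ r)) * w i" "w i \<le> 4 * sqrt (n powr (1 / 2 ^ r)) * w' i"
      using weights_ratio[OF A T i, of r] by (auto simp: w_def w'_def)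
    then show "w' i \<le> 8 * w i" "w i \<le> 8 * w' i"
      using mult_right_mono[OF \<rho>[OF i] wnn(1)[OF i]] mult_right_mono[OF \<rho>[OF i] wnn(2)[OF i]] by linarith+
  qed
  have en: "energy n w f = (\<Sum>j\<in>support n w. (f j)\<^sup>2 / w j)" if "f \<in> image_space A" for f
    unfolding energy_def
  proof (rule sum.mono_neutral_right)
    show "\<forall>i\<in>{..<n} - support n w. (f i)\<^sup>2 / w i = 0"
    proof
      fix i assume "i \<in> {..<n} - support n w"
      then have "w i = 0" using wnn[of i] by (auto simp: support_def)
      then show "(f i)\<^sup>2 / w i = 0" by simp
    qed
  qed (auto simp: support_def)
  show "lewis_space (support n w) w (image_space A) 128"
  proof
    show "(f i)\<^sup>2 \<le> 128 * (w i)\<^sup>2 * (\<Sum>j\<in>support n w. (f j)\<^sup>2 / w j)"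
      if f: "f \<in> image_space A" and i: "i \<in> support n w" for f i
    proof -
      have i: "i < n" using i by (simp add: support_def)
      have "(f i)\<^sup>2 \<le> quad A n w i * energy n w f" by (rule leverage_facts(1)[OF A ad(1) i f])
      also have "\<dots> \<le> 128 * (w i)\<^sup>2 * energy n w f"
      proof (rule mult_right_mono)
        have "quad A n w i \<le> 2 * (w' i)\<^sup>2" unfolding w' by (rule update_sq(3)[OF A T ad(1) i])
        also have "\<dots> \<le> 2 * (8 * w i)\<^sup>2" using le[OF i] wnn[OF i] by (intro mult_left_mono power_mono) auto
        finally show "quad A n w i \<le> 128 * (w i)\<^sup>2" by (simp add: power_mult_distrib)
      qed (rule energy_nonneg[OF A ad(1)])
      finally show ?thesis unfolding en[OF f] .
    qed
  qed (use ne in \<open>auto simp: support_def image_space_zero image_space_lin image_space_reproducing\<close>)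
  have "w i \<le> 128 * leverage_score (weight_matrix n w * A) i" if i: "i \<in> support n w" for i
  proof -
    have i: "i < n" "0 < w i" using i by (auto simp: support_def)
    let ?t = "T (weight_matrix n w) $ i"
    have "w i * w i = (w i)\<^sup>2" by (simp add: power2_eq_square)
    also have "\<dots> \<le> (8 * w' i)\<^sup>2" using le(2)[OF i(1)] i(2) by (intro power_mono) auto
    also have "\<dots> = 64 * (w i * ?t)"
      unfolding w' power_mult_distrib update_sq(2)[OF A T ad(1) i(1)] by simp
    finally have "w i * w i \<le> w i * (64 * ?t)" by simp
    then have "w i \<le> 64 * ?t" using i(2) by simp
    then show ?thesis using routine_bounds(2)[OF A T ad(1) i(1)] by simp
  qed
  then have "sum w (support n w) \<le> (\<Sum>i\<in>support n w. 128 * leverage_score (weight_matrix n w * A) i)"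
    by (intro sum_mono) auto
  also have "\<dots> \<le> (\<Sum>i<n. 128 * leverage_score (weight_matrix n w * A) i)"
    using leverage_facts(3)[OF A ad(1)] by (intro sum_mono2) (auto simp: support_def)
  also have "\<dots> = 128 * (\<Sum>i<n. leverage_score (weight_matrix n w * A) i)" by (simp add: sum_distrib_left)
  also have "\<dots> \<le> 128 * real d" using leverage_sum[OF A ad(1)] by simp
  finally show "sum w (support n w) \<le> 128 * real d" .
qed

definition sampling_matrix :: "nat \<Rightarrow> nat \<Rightarrow> (nat \<Rightarrow> real) \<Rightarrow> nat list \<Rightarrow> real mat" where
  "sampling_matrix n N w l =
     mat (length l) n (\<lambda>(k,j). if j = l ! k then sum w (support n w) / (real N * w j) else 0)"

lemma sampling_matrix_one_nonzero:
  assumes "l \<in> samples (support n w) N"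
  shows "one_nonzero_per_row (sampling_matrix n N w l)"
  unfolding one_nonzero_per_row_def
proof (intro allI impI)
  fix k assume "k < dim_row (sampling_matrix n N w l)"
  then have k: "k < length l" by (simp add: sampling_matrix_def)
  then have lk: "l ! k \<in> support n w" and N: "0 < N" using assms by (auto simp: samples_def)
  have "0 < sum w (support n w)"
    using lk finite_support[of n w] by (intro sum_pos) (auto simp: support_def)
  then have "sum w (support n w) / (real N * w (l ! k)) \<noteq> 0" using lk N by (auto simp: support_def)
  then show "\<exists>!j. j < dim_col (sampling_matrix n N w l) \<and> sampling_matrix n N w l $$ (k, j) \<noteq> 0"
    using k lk by (intro ex1I[of _ "l ! k"]) (auto simp: sampling_matrix_def support_def split: if_splits)
qed

text \<open>The lower side needs \<open>(1 + \<epsilon>) * (1 - \<eta>) \<ge> 1\<close>. For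
  \<open>\<epsilon> \<le> 1\<close> both bounds on \<open>\<eta>\<close> combine to give it; for
  larger \<open>\<epsilon>\<close> it follows from \<open>\<eta> \<le> 1 / 2\<close>.\<close>

lemma approx_factor_of_deviation:
  assumes s: "\<bar>s - t\<bar> \<le> \<eta> * t" and t: "0 \<le> t" and \<epsilon>: "0 < \<epsilon>" "\<eta> \<le> \<epsilon> / 2" "\<eta> \<le> 1 / 2"
  shows "approx_factor (1 + \<epsilon>) s t"
proof -
  have "s \<le> (1 + \<eta>) * t" using s by (simp add: algebra_simps abs_le_iff)
  also have "\<dots> \<le> (1 + \<epsilon>) * t" using \<epsilon> t by (intro mult_right_mono) auto
  finally have 1: "s \<le> (1 + \<epsilon>) * t" .
  have "1 \<le> (1 + \<epsilon>) * (1 - \<eta>)"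
  proof (cases "\<epsilon> \<le> 1")
    case True
    have "\<epsilon> * \<eta> \<le> \<epsilon> * (1 / 2)" using \<epsilon> by (intro mult_left_mono) auto
    then have "\<eta> + \<epsilon> * \<eta> \<le> \<epsilon>" using \<epsilon> by linarith
    then show ?thesis by (simp add: algebra_simps)
  next
    case False
    have "2 * (1 / 2) \<le> (1 + \<epsilon>) * (1 - \<eta>)" using False \<epsilon> by (intro mult_mono) auto
    then show ?thesis by simp
  qed
  then have "1 * t \<le> (1 + \<epsilon>) * (1 - \<eta>) * t" using t by (intro mult_right_mono) auto
  also have "\<dots> = (1 + \<epsilon>) * ((1 - \<eta>) * t)" by simp
  also have "\<dots> \<le> (1 + \<epsilon>) * s"
    using s \<epsilon> by (intro mult_left_mono) (auto simp: algebra_simps abs_le_iff)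
  finally have 2: "t \<le> (1 + \<epsilon>) * s" by simp
  show ?thesis using 1 2 \<epsilon> by (simp add: approx_factor_def pos_divide_le_eq mult.commute)
qed

text \<open>The bridge from nested sums to probability mass functions, through which the failure
  bound is transferred.\<close>

lemma expectation_replicate_pmf:
  assumes J: "finite J" "set_pmf P \<subseteq> J"
  shows "measure_pmf.expectation (replicate_pmf N P) F = iter_mean J (pmf P) N F"
proof (induction N arbitrary: F)
  case (Suc N)
  have fin: "finite (set_pmf (replicate_pmf M P))" for M
    using finite_lists_length_eq[OF finite_subset[OF J(2,1)], of M]
    by (simp add: set_replicate_pmf lists_eq_set)
  have eq: "replicate_pmf (Suc N) P = bind_pmf P (\<lambda>x. map_pmf ((#) x) (replicate_pmf N P))"
    by (simp add: map_pmf_def)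
  have "measure_pmf.expectation (replicate_pmf (Suc N) P) F =
      (\<Sum>i\<in>J. pmf P i *\<^sub>R measure_pmf.expectation (map_pmf ((#) i) (replicate_pmf N P)) F)"
    unfolding eq by (rule pmf_expectation_bind[OF J(1) _ J(2)]) (simp add: fin)
  then show ?case by (simp add: Suc.IH del: replicate_pmf.simps)
qed simp

lemma iter_mean_cong_weights:
  "(\<And>i. i \<in> J \<Longrightarrow> q i = q' i) \<Longrightarrow> iter_mean J q N F = iter_mean J q' N F"
  by (induction N arbitrary: F) (auto intro!: sum.cong)

section \<open>Sampling as a program with calls to a routine\<close>

definition weight_pmf :: "nat \<Rightarrow> (nat \<Rightarrow> real) \<Rightarrow> nat pmf" where
  "weight_pmf n w = embed_pmf (\<lambda>i. if i \<in> support n w then w i / sum w (support n w) else 0)"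

lemma pmf_weight_pmf:
  assumes "support n w \<noteq> {}"
  shows "pmf (weight_pmf n w) i = (if i \<in> support n w then w i / sum w (support n w) else 0)"
proof -
  let ?J = "support n w"
  let ?g = "\<lambda>i. if i \<in> ?J then w i / sum w ?J else 0"
  have pos: "0 < w i" if "i \<in> ?J" for i using that by (simp add: support_def)
  have D: "0 < sum w ?J" using assms pos finite_support by (intro sum_pos) auto
  have nn: "0 \<le> ?g i" for i by (cases "i \<in> ?J") (use pos[of i] D in simp_all)
  have "(\<integral>\<^sup>+ i. ennreal (?g i) \<partial>count_space UNIV) = (\<Sum>i\<in>?J. ennreal (?g i))"
    by (rule nn_integral_count_space'[OF finite_support]) auto
  also have "\<dots> = ennreal (\<Sum>i\<in>?J. ?g i)" by (intro sum_ennreal nn)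
  also have "(\<Sum>i\<in>?J. ?g i) = 1" using D by (simp flip: sum_divide_distrib)
  finally have "(\<integral>\<^sup>+ i. ennreal (?g i) \<partial>count_space UNIV) = 1" by simp
  from pmf_embed_pmf[OF nn this] show ?thesis by (simp only: weight_pmf_def)
qed

lemma set_weight_pmf:
  assumes "support n w \<noteq> {}"
  shows "set_pmf (weight_pmf n w) \<subseteq> support n w"
  by (auto simp: set_pmf_iff pmf_weight_pmf[OF assms] split: if_splits)

text \<open>For admissible weights an empty support means that every \<open>A x\<close> vanishes.
  The matrix without rows then preserves the norm, and there is no row to draw.\<close>

definition sampling_program :: "nat \<Rightarrow> nat \<Rightarrow> (nat \<Rightarrow> real) \<Rightarrow> (real mat, real vec, real mat) routine_program" where
  "sampling_program n N w =
     (if support n w = {} then Return (mat 0 n (\<lambda>_. 0))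
      else Random (map_pmf (\<lambda>l. Return (sampling_matrix n N w l)) (replicate_pmf N (weight_pmf n w))))"

lemma output_sampling_program:
  "output_distribution T (sampling_program n N w) =
     (if support n w = {} then return_pmf (mat 0 n (\<lambda>_. 0))
      else map_pmf (sampling_matrix n N w) (replicate_pmf N (weight_pmf n w)))"
  by (simp add: sampling_program_def pmf.map_comp o_def join_pmf_def bind_map_pmf)
    (simp add: map_pmf_def)

lemma calls_sampling_program: "calls_at_most P T k (sampling_program n N w)"
  by (auto simp: sampling_program_def intro!: calls_at_most.intros)

text \<open>In continuation-passing form: the program sees only the current weights and the answers,
  so neither \<open>A\<close> nor \<open>T\<close> occurs in it. Run against \<open>T\<close>, one
  call performs \<open>update n T\<close>.\<close>

primrec weight_program :: "nat \<Rightarrow> nat \<Rightarrow> (nat \<Rightarrow> real) \<Rightarrow>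
    ((nat \<Rightarrow> real) \<Rightarrow> (real mat, real vec, 'a) routine_program) \<Rightarrow> (real mat, real vec, 'a) routine_program" where
  "weight_program n 0 w F = F w"
| "weight_program n (Suc k) w F =
     Call (weight_matrix n w) (\<lambda>\<tau>. weight_program n k (\<lambda>i. sqrt (w i * \<tau> $ i)) F)"

lemma output_weight_program:
  "output_distribution T (weight_program n k w F) = output_distribution T (F ((update n T ^^ k) w))"
proof (induction k arbitrary: w)
  case (Suc k)
  have "(\<lambda>i. sqrt (w i * T (weight_matrix n w) $ i)) = update n T w"
    by (simp add: fun_eq_iff update_def)
  then show ?case using Suc.IH[of "update n T w"] by (simp add: funpow_swap1)
qed simp

lemma calls_weight_program:
  assumes "\<And>j. j < k \<Longrightarrow> P (weight_matrix n ((update n T ^^ j) w))"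
    and "calls_at_most P T 0 (F ((update n T ^^ k) w))"
  shows "calls_at_most P T k (weight_program n k w F)"
  using assms
proof (induction k arbitrary: w)
  case (Suc k)
  have "calls_at_most P T k (weight_program n k (update n T w) F)"
  proof (rule Suc.IH)
    show "P (weight_matrix n ((update n T ^^ j) (update n T w)))" if "j < k" for j
      using Suc.prems(1)[of "Suc j"] that by (simp add: funpow_swap1)
    show "calls_at_most P T 0 (F ((update n T ^^ k) (update n T w)))"
      using Suc.prems(2) by (simp add: funpow_swap1)
  qed
  then show ?case using Suc.prems(1)[of 0] by (auto intro!: calls_at_most.intros simp: update_def[abs_def])
qed simp

section \<open>Number of calls and number of rows\<close>

definition rounds :: "nat \<Rightarrow> nat" where
  "rounds n = nat \<lceil>log 2 (max 1 (ln (real n)))\<rceil>"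

lemma ln_le_rounds: "ln (real n) \<le> 2 ^ rounds n"
proof -
  let ?x = "max 1 (ln (real n))"
  have "log 2 ?x \<le> real (rounds n)" unfolding rounds_def by (rule real_nat_ceiling_ge)
  then have "?x \<le> 2 powr real (rounds n)" by (simp add: log_le_iff)
  then show ?thesis by (simp add: powr_realpow)
qed

lemma lnln3_pos: "0 < ln (ln (3::real))"
proof -
  have "exp 1 < (3::real)" using e_less_272 by simp
  then have "1 < ln (3::real)" by (metis exp_gt_zero ln_exp ln_less_cancel_iff zero_less_numeral)
  then show ?thesis by simp
qed

text \<open>Rounding and the extra call contribute an additive 2. It is absorbed because
  \<open>ln (ln (max 3 n))\<close> is at least the positive constant
  \<open>ln (ln 3)\<close>.\<close>

lemma rounds_le: "real (Suc (rounds n)) \<le> (2 / ln (ln 3) + 1 / ln 2) * ln (ln (real (max 3 n)))"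
proof -
  let ?x = "max 1 (ln (real n))"
  let ?y = "ln (real (max 3 n))"
  have y3: "ln 3 \<le> ?y" by (intro ln_le_cancel_iff[THEN iffD2]) auto
  have l3: "1 < ln (3::real)" using lnln3_pos by (metis ln_gt_zero_iff ln_gt_zero zero_less_numeral less_trans one_less_numeral_iff semiring_norm(77) ln_gt_zero_iff)
  have xy: "?x \<le> ?y"
  proof (cases "n = 0")
    case False
    then have "ln (real n) \<le> ?y" by (intro ln_le_cancel_iff[THEN iffD2]) auto
    moreover have "1 \<le> ?y" using y3 l3 by linarith
    ultimately show ?thesis by (intro max.boundedI)
  qed (use y3 l3 in simp)
  have "real (rounds n) \<le> log 2 ?x + 1"
    unfolding rounds_def by (simp add: of_int_ceiling_le_add_one)
  also have "log 2 ?x \<le> log 2 ?y" using xy by (intro log_mono) auto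
  also have "log 2 ?y = ln ?y / ln 2" by (simp add: log_def)
  finally have 1: "real (Suc (rounds n)) \<le> 2 + ln ?y / ln 2" by simp
  have "ln (ln 3) \<le> ln ?y" using y3 l3 by (intro ln_le_cancel_iff[THEN iffD2]) auto
  then have "2 \<le> 2 / ln (ln 3) * ln ?y" using lnln3_pos by (simp add: field_simps)
  then show ?thesis using 1 by (simp add: algebra_simps)
qed

lemma image_fun_mult: "i < dim_row A \<Longrightarrow> image_fun A x i = (A *\<^sub>v x) $ i"
  by (simp add: image_fun_def)

lemma l1_norm_sampled:
  assumes A: "A \<in> carrier_mat n d" and x: "x \<in> carrier_vec d"
    and l: "l \<in> samples (support n w) N"
  shows "l1_norm ((sampling_matrix n N w l * A) *\<^sub>v x) =
    sum_list (map (\<lambda>i. sum w (support n w) * \<bar>image_fun A x i\<bar> / (real N * w i)) l)"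
proof -
  let ?D = "sum w (support n w)"
  have D: "0 \<le> ?D" by (intro sum_nonneg) (simp add: support_def)
  let ?S = "sampling_matrix n N w l"
  have S: "?S \<in> carrier_mat (length l) n" by (simp add: sampling_matrix_def)
  have e: "(?S *\<^sub>v (A *\<^sub>v x)) $ k = ?D / (real N * w (l ! k)) * image_fun A x (l ! k)"
    if k: "k < length l" for k
  proof -
    have lk: "l ! k < n" using l nth_mem[OF k] by (auto simp: samples_def support_def)
    have "(?S *\<^sub>v (A *\<^sub>v x)) $ k = (\<Sum>j<n. (if j = l ! k then ?D / (real N * w j) else 0) * (A *\<^sub>v x) $ j)"
      using k A by (simp add: sampling_matrix_def scalar_prod_def lessThan_atLeast0)
    also have "\<dots> = (\<Sum>j<n. if j = l ! k then ?D / (real N * w j) * (A *\<^sub>v x) $ j else 0)"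
      by (intro sum.cong) auto
    also have "\<dots> = ?D / (real N * w (l ! k)) * (A *\<^sub>v x) $ (l ! k)" using lk by simp
    finally show ?thesis using lk A by (simp add: image_fun_mult)
  qed
  have "l1_norm ((?S * A) *\<^sub>v x) = (\<Sum>k<length l. \<bar>(?S *\<^sub>v (A *\<^sub>v x)) $ k\<bar>)"
    unfolding assoc_mult_mat_vec[OF S A x] l1_norm_def using S by simp
  also have "\<dots> = (\<Sum>k<length l. ?D * \<bar>image_fun A x (l ! k)\<bar> / (real N * w (l ! k)))"
  proof (intro sum.cong refl)
    fix k assume "k \<in> {..<length l}"
    then have k: "k < length l" by simp
    then have "l ! k \<in> support n w" using l by (auto simp: samples_def)
    then have "0 < w (l ! k)" by (simp add: support_def)
    then show "\<bar>(?S *\<^sub>v (A *\<^sub>v x)) $ k\<bar> = ?D * \<bar>image_fun A x (l ! k)\<bar> / (real N * w (l ! k))"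
      unfolding e[OF k] using D by (simp add: abs_mult)
  qed
  also have "\<dots> = sum_list (map (\<lambda>i. ?D * \<bar>image_fun A x i\<bar> / (real N * w i)) l)"
    by (simp add: sum_list_sum_nth lessThan_atLeast0)
  finally show ?thesis .
qed

lemma l1_norm_support:
  assumes A: "A \<in> carrier_mat n d" and x: "x \<in> carrier_vec d"
    and w: "\<And>i f. i < n \<Longrightarrow> i \<notin> support n w \<Longrightarrow> f \<in> image_space A \<Longrightarrow> f i = 0"
  shows "l1_norm (A *\<^sub>v x) = (\<Sum>i\<in>support n w. \<bar>image_fun A x i\<bar>)"
proof -
  have "l1_norm (A *\<^sub>v x) = (\<Sum>i<n. \<bar>image_fun A x i\<bar>)"
    using A by (simp add: l1_norm_def image_fun_mult)
  also have "\<dots> = (\<Sum>i\<in>support n w. \<bar>image_fun A x i\<bar>)"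
  proof (rule sum.mono_neutral_right)
    show "\<forall>i\<in>{..<n} - support n w. \<bar>image_fun A x i\<bar> = 0"
      using w[of _ "image_fun A x"] x A by (auto simp: image_space_def)
  qed (auto simp: support_def)
  finally show ?thesis .
qed

text \<open>The requirement of \<open>sampling_failure\<close> for \<open>\<kappa> = 128\<close> and
  \<open>\<eta> = min \<epsilon> 1 / 2\<close>.\<close>

definition sample_size :: "real \<Rightarrow> nat \<Rightarrow> real \<Rightarrow> nat" where
  "sample_size c d \<epsilon> = nat \<lceil>64 * (ln (68 * 128 ^ 4) / ln 2 + 3 + c)\<^sup>2 * 128\<^sup>2 * real d *
     ln (real (max 2 d)) / (min \<epsilon> 1 / 2)\<^sup>2\<rceil>"

text \<open>Here \<open>1 / \<eta>\<^sup>2\<close> is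
  \<open>4 * max 1 (1 / \<epsilon>\<^sup>2)\<close>, which turns 64 into 256. The ceiling costs 1,
  at most \<open>1 / ln 2\<close> times the product since \<open>d\<close> is positive and the
  logarithm is at least \<open>ln 2\<close>.\<close>

lemma sample_size_bound:
  assumes \<epsilon>: "0 < \<epsilon>" and d: "0 < d"
  shows "real (sample_size c d \<epsilon>) \<le> (256 * (ln (68 * 128 ^ 4) / ln 2 + 3 + c)\<^sup>2 * 128\<^sup>2 + 1 / ln 2) *
    (real d * ln (real (max 2 d)) * max 1 (1 / \<epsilon>\<^sup>2))"
proof -
  let ?B = "(ln (68 * 128 ^ 4) / ln 2 + 3 + c)\<^sup>2"
  let ?L = "ln (real (max 2 d))"
  let ?M = "max 1 (1 / \<epsilon>\<^sup>2)"
  have L2: "ln 2 \<le> ?L" by (intro ln_le_cancel_iff[THEN iffD2]) auto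
  have ln2: "0 < ln (2::real)" by simp
  have L0: "0 < ?L" using L2 ln2 by linarith
  have e: "1 / (min \<epsilon> 1 / 2)\<^sup>2 = 4 * ?M"
  proof (cases "\<epsilon> \<le> 1")
    case True
    have "\<epsilon>\<^sup>2 \<le> 1" using True \<epsilon> by (simp add: power_le_one)
    then have "1 \<le> 1 / \<epsilon>\<^sup>2" using \<epsilon> by simp
    then show ?thesis using True by (simp add: power_divide max_def)
  next
    case False
    then have "1 \<le> \<epsilon>\<^sup>2" by (intro one_le_power) simp
    then have "?M = 1" using \<epsilon> by (intro max_absorb1) simp
    then show ?thesis using False by (simp add: power_divide)
  qed
  let ?x = "64 * ?B * 128\<^sup>2 * real d * ?L / (min \<epsilon> 1 / 2)\<^sup>2"
  have "0 \<le> ?x" using L0 by (intro divide_nonneg_nonneg mult_nonneg_nonneg) auto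
  then have "real (nat \<lceil>?x\<rceil>) \<le> ?x + 1"
    using ceiling_mono[of 0 ?x] by (simp add: of_int_ceiling_le_add_one)
  then have 1: "real (sample_size c d \<epsilon>) \<le> ?x + 1" by (simp only: sample_size_def)
  define Y where "Y = real d * ?L * ?M"
  have "?x = 64 * ?B * 128\<^sup>2 * real d * ?L * (1 / (min \<epsilon> 1 / 2)\<^sup>2)" by simp
  also have "\<dots> = 256 * ?B * 128\<^sup>2 * Y" unfolding e Y_def by simp
  finally have 2: "?x = 256 * ?B * 128\<^sup>2 * Y" .
  have "1 * ln 2 * 1 \<le> Y" unfolding Y_def using d L2 ln2 by (intro mult_mono) auto
  then have "1 \<le> 1 / ln 2 * Y" using ln2 by (simp add: pos_le_divide_eq)
  then have "real (sample_size c d \<epsilon>) \<le> 256 * ?B * 128\<^sup>2 * Y + 1 / ln 2 * Y" using 1 unfolding 2 by linarith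
  then show ?thesis by (simp only: distrib_right Y_def)
qed

lemma sampling_success:
  assumes A: "A \<in> carrier_mat n d" and T: "leverage_routine A T" and c: "0 < c" and \<epsilon>: "0 < \<epsilon>"
  defines "w \<equiv> weights n T (Suc (rounds n))" and "N \<equiv> sample_size c d \<epsilon>"
  assumes ne: "support n w \<noteq> {}"
  shows "0 < d"
    and "1 - real (max 2 d) powr (- c) \<le>
      measure_pmf.prob (map_pmf (sampling_matrix n N w) (replicate_pmf N (weight_pmf n w))) {S. l1_preserving \<epsilon> A S}"
proof -
  let ?J = "support n w"
  interpret lewis_space ?J w "image_space A" 128
    unfolding w_def by (rule weights_lewis_space(1)[OF A T ln_le_rounds]) (use ne in \<open>simp add: w_def\<close>)
  have Dd: "D \<le> 128 * real d"
    unfolding D_def unfolding w_def by (rule weights_lewis_space(2)[OF A T ln_le_rounds]) (use ne in \<open>simp add: w_def\<close>)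
  show "0 < d" using Dd D_pos by (cases d) auto
  define \<eta> where "\<eta> = min \<epsilon> 1 / 2"
  have \<eta>: "0 < \<eta>" "\<eta> \<le> 1" "\<eta> \<le> \<epsilon> / 2" "\<eta> \<le> 1 / 2" using \<epsilon> by (auto simp: \<eta>_def)
  have ad: "admissible A n w" unfolding w_def by (rule admissible_weights[OF A T])
  have vanish: "f i = 0" if "i < n" "i \<notin> ?J" "f \<in> image_space A" for i f
    using ad that unfolding admissible_def by (force simp: support_def)
  have good: "l1_preserving \<epsilon> A (sampling_matrix n N w l)"
    if l: "l \<in> samples ?J N" and dv: "\<forall>f\<in>image_space A. \<bar>dev N l f\<bar> \<le> \<eta> * nrm f" for l
    unfolding l1_preserving_def
  proof
    fix x :: "real vec" assume x: "x \<in> carrier_vec (dim_col A)"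
    then have xd: "x \<in> carrier_vec d" using A by simp
    have f: "image_fun A x \<in> image_space A" using x by (simp add: image_space_def)
    have nA: "l1_norm (A *\<^sub>v x) = nrm (image_fun A x)"
      unfolding nrm_def by (rule l1_norm_support[OF A xd]) (use vanish in blast)
    have nS: "l1_norm ((sampling_matrix n N w l * A) *\<^sub>v x) = nrm (image_fun A x) + dev N l (image_fun A x)"
      unfolding l1_norm_sampled[OF A xd l] dev_def D_def by simp
    show "approx_factor (1 + \<epsilon>) (l1_norm ((sampling_matrix n N w l * A) *\<^sub>v x)) (l1_norm (A *\<^sub>v x))"
      unfolding nA nS
      by (rule approx_factor_of_deviation[OF _ nrm_nonneg \<epsilon> \<eta>(3,4)]) (use dv f in auto)
  qed
  let ?bad = "\<lambda>l. if \<forall>f\<in>image_space A. \<bar>dev N l f\<bar> \<le> \<eta> * nrm f then 0 else 1 :: real"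
  let ?P = "replicate_pmf N (weight_pmf n w)"
  let ?G = "{S. l1_preserving \<epsilon> A S}"
  have "measure_pmf.prob (map_pmf (sampling_matrix n N w) ?P) ?G = measure_pmf.prob ?P (sampling_matrix n N w -` ?G)"
    by simp
  also have "\<dots> = measure_pmf.expectation ?P (indicator (sampling_matrix n N w -` ?G))" by simp
  also have "\<dots> = iter_mean ?J (pmf (weight_pmf n w)) N (indicator (sampling_matrix n N w -` ?G))"
    by (rule expectation_replicate_pmf[OF finite_support set_weight_pmf[OF ne]])
  also have "\<dots> = iter_mean ?J q N (indicator (sampling_matrix n N w -` ?G))"
    by (rule iter_mean_cong_weights) (simp add: pmf_weight_pmf[OF ne] q_def D_def)
  finally have pr: "measure_pmf.prob (map_pmf (sampling_matrix n N w) ?P) ?G =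
      iter_mean ?J q N (indicator (sampling_matrix n N w -` ?G))" .
  \<comment> \<open>Every sample is norm preserving or counted by \<open>?bad\<close>, so the
    constant 1 is at most the sum of the two indicators.\<close>
  have "1 = iter_mean ?J q N (\<lambda>l. 1)" by (rule iter_mean_const[symmetric])
  also have "\<dots> \<le> iter_mean ?J q N (\<lambda>l. indicator (sampling_matrix n N w -` ?G) l + ?bad l)"
    by (rule iter_mean_mono) (use good in \<open>auto simp: indicator_def\<close>)
  also have "\<dots> = iter_mean ?J q N (indicator (sampling_matrix n N w -` ?G)) + iter_mean ?J q N ?bad"
    by (rule iter_mean_add)
  also have "iter_mean ?J q N ?bad \<le> real (max 2 d) powr (- c)"
  proof (rule sampling_failure[OF Dd c \<eta>(1,2)])
    show "64 * (ln (68 * 128 ^ 4) / ln 2 + 3 + c)\<^sup>2 * 128\<^sup>2 * real d * ln (real (max 2 d)) / \<eta>\<^sup>2 \<le> real N"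
      unfolding N_def sample_size_def \<eta>_def by (rule real_nat_ceiling_ge)
  qed
  finally show "1 - real (max 2 d) powr (- c) \<le>
      measure_pmf.prob (map_pmf (sampling_matrix n N w) ?P) ?G"
    unfolding pr by simp
qed

definition sampler :: "real \<Rightarrow> nat \<Rightarrow> nat \<Rightarrow> real \<Rightarrow> (real mat, real vec, real mat) routine_program" where
  "sampler c n d \<epsilon> = weight_program n (Suc (rounds n)) (\<lambda>_. 1) (sampling_program n (sample_size c d \<epsilon>))"

lemma sampler_correct:
  assumes A: "A \<in> carrier_mat n d" and T: "leverage_routine A T" and c: "0 < c" and \<epsilon>: "0 < \<epsilon>"
  defines "D \<equiv> output_distribution T (sampler c n d \<epsilon>)"
  shows "S \<in> set_pmf D \<Longrightarrow> dim_col S = n \<and>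
      real (dim_row S) \<le> (256 * (ln (68 * 128 ^ 4) / ln 2 + 3 + c)\<^sup>2 * 128\<^sup>2 + 1 / ln 2) *
        (real d * ln (real (max 2 d)) * max 1 (1 / \<epsilon>\<^sup>2)) \<and> one_nonzero_per_row S"
    and "1 - real (max 2 d) powr (- c) \<le> measure_pmf.prob D {S. l1_preserving \<epsilon> A S}"
    and "calls_at_most (nonneg_diagonal n) T (Suc (rounds n)) (sampler c n d \<epsilon>)"
proof -
  define w where "w = weights n T (Suc (rounds n))"
  define N where "N = sample_size c d \<epsilon>"
  have D: "D = (if support n w = {} then return_pmf (mat 0 n (\<lambda>_. 0))
      else map_pmf (sampling_matrix n N w) (replicate_pmf N (weight_pmf n w)))"
    unfolding D_def sampler_def output_weight_program output_sampling_program
    by (simp only: weights_def[symmetric] w_def N_def)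
  let ?C = "256 * (ln (68 * 128 ^ 4) / ln 2 + 3 + c)\<^sup>2 * 128\<^sup>2 + 1 / ln 2 :: real"
  show "dim_col S = n \<and> real (dim_row S) \<le> ?C * (real d * ln (real (max 2 d)) * max 1 (1 / \<epsilon>\<^sup>2)) \<and>
      one_nonzero_per_row S" if S: "S \<in> set_pmf D"
  proof (cases "support n w = {}")
    case True
    then have "S = mat 0 n (\<lambda>_. 0)" using S by (simp add: D)
    moreover have "0 \<le> ?C * (real d * ln (real (max 2 d)) * max 1 (1 / \<epsilon>\<^sup>2))"
      by (intro mult_nonneg_nonneg add_nonneg_nonneg) (auto simp: le_max_iff_disj)
    ultimately show ?thesis by (simp add: one_nonzero_per_row_def)
  next
    case False
    then obtain l where l: "l \<in> set_pmf (replicate_pmf N (weight_pmf n w))" "S = sampling_matrix n N w l"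
      using S by (auto simp: D)
    have ls: "l \<in> samples (support n w) N"
      using l(1) set_weight_pmf[OF False] by (auto simp: set_replicate_pmf samples_def)
    have "0 < d" using sampling_success(1)[OF A T c \<epsilon>] False by (simp add: w_def)
    from sample_size_bound[OF \<epsilon> this, of c] sampling_matrix_one_nonzero[OF ls]
    show ?thesis using ls by (simp add: l(2) sampling_matrix_def samples_def N_def)
  qed
  show "1 - real (max 2 d) powr (- c) \<le> measure_pmf.prob D {S. l1_preserving \<epsilon> A S}"
  proof (cases "support n w = {}")
    case True
    have ad: "admissible A n w" unfolding w_def by (rule admissible_weights[OF A T])
    have z: "l1_norm (A *\<^sub>v x) = 0" if "x \<in> carrier_vec d" for x
    proof -
      have "l1_norm (A *\<^sub>v x) = (\<Sum>i\<in>support n w. \<bar>image_fun A x i\<bar>)"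
      proof (rule l1_norm_support[OF A that])
        fix i f assume i: "i < n" "i \<notin> support n w" and f: "f \<in> image_space A"
        then have "w i = 0" using ad unfolding admissible_def by (force simp: support_def)
        then show "f i = 0" using ad i f unfolding admissible_def by blast
      qed
      then show ?thesis by (simp add: True)
    qed
    have "l1_preserving \<epsilon> A (mat 0 n (\<lambda>_. 0))"
      unfolding l1_preserving_def using A z by (auto simp: approx_factor_def l1_norm_def)
    then have "measure_pmf.prob D {S. l1_preserving \<epsilon> A S} = 1"
      unfolding D using True by (simp add: measure_return_pmf)
    then show ?thesis by simp
  next
    case False
    then show ?thesis using sampling_success(2)[OF A T c \<epsilon>] by (simp add: D w_def N_def)
  qed
  show "calls_at_most (nonneg_diagonal n) T (Suc (rounds n)) (sampler c n d \<epsilon>)"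
    unfolding sampler_def
  proof (rule calls_weight_program)
    fix j
    have "admissible A n (weights n T j)" by (rule admissible_weights[OF A T])
    then show "nonneg_diagonal n (weight_matrix n ((update n T ^^ j) (\<lambda>_. 1)))"
      unfolding weights_def admissible_def by (intro weight_matrix_nonneg_diagonal) blast
  qed (rule calls_sampling_program)
qed

theorem theorem1p1:
  shows "\<exists>K>0::real. \<forall>c>0::real. \<exists>C>0::real.
    \<exists>sampler :: nat \<Rightarrow> nat \<Rightarrow> real \<Rightarrow> (real mat, real vec, real mat) routine_program.
    \<forall>(n::nat) (d::nat) (\<epsilon>::real) (A::real mat) (T::real mat \<Rightarrow> real vec).
      \<epsilon> > 0 \<longrightarrow> A \<in> carrier_mat n d \<longrightarrow> leverage_routine A T \<longrightarrow>
      (\<exists>D :: real mat pmf.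
        (\<forall>S\<in>set_pmf D. dim_col S = n \<and>
            real (dim_row S) \<le> C * (real d * ln (real (max 2 d)) * max 1 (1 / \<epsilon>\<^sup>2)) \<and>
            one_nonzero_per_row S) \<and>
        measure_pmf.prob D {S. l1_preserving \<epsilon> A S} \<ge> 1 - real (max 2 d) powr (- c) \<and>
        output_distribution T (sampler n d \<epsilon>) = D \<and>
        (\<exists>k. real k \<le> K * ln (ln (real (max 3 n))) \<and>
             calls_at_most (nonneg_diagonal n) T k (sampler n d \<epsilon>)))"
proof (rule exI[of _ "2 / ln (ln 3) + 1 / ln 2"], intro conjI allI impI)
  show "0 < 2 / ln (ln 3) + 1 / ln (2::real)"
    using lnln3_pos by (intro add_pos_pos) auto
  \<comment> \<open>\<open>K\<close> has been chosen before \<open>c\<close>: the failure exponent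
    affects the number of sampled rows, not the number of rounds.\<close>
  fix c :: real assume c: "0 < c"
  let ?C = "256 * (ln (68 * 128 ^ 4) / ln 2 + 3 + c)\<^sup>2 * 128\<^sup>2 + 1 / ln 2 :: real"
  have C: "0 < ?C" by (intro add_nonneg_pos) auto
  show "\<exists>C>0::real.
    \<exists>sampler :: nat \<Rightarrow> nat \<Rightarrow> real \<Rightarrow> (real mat, real vec, real mat) routine_program.
    \<forall>(n::nat) (d::nat) (\<epsilon>::real) (A::real mat) (T::real mat \<Rightarrow> real vec).
      \<epsilon> > 0 \<longrightarrow> A \<in> carrier_mat n d \<longrightarrow> leverage_routine A T \<longrightarrow>
      (\<exists>D :: real mat pmf.
        (\<forall>S\<in>set_pmf D. dim_col S = n \<and>
            real (dim_row S) \<le> C * (real d * ln (real (max 2 d)) * max 1 (1 / \<epsilon>\<^sup>2)) \<and>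
            one_nonzero_per_row S) \<and>
        measure_pmf.prob D {S. l1_preserving \<epsilon> A S} \<ge> 1 - real (max 2 d) powr (- c) \<and>
        output_distribution T (sampler n d \<epsilon>) = D \<and>
        (\<exists>k. real k \<le> (2 / ln (ln 3) + 1 / ln 2) * ln (ln (real (max 3 n))) \<and>
             calls_at_most (nonneg_diagonal n) T k (sampler n d \<epsilon>)))"
  proof (intro exI[of _ ?C] conjI exI[of _ "sampler c"] allI impI)
    show "0 < ?C" by (rule C)
    fix n d :: nat and \<epsilon> :: real and A :: "real mat" and T :: "real mat \<Rightarrow> real vec"
    assume "0 < \<epsilon>" "A \<in> carrier_mat n d" "leverage_routine A T"
    note correct = sampler_correct[OF this(2,3) c this(1)]
    show "\<exists>D :: real mat pmf.
        (\<forall>S\<in>set_pmf D. dim_col S = n \<and>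
            real (dim_row S) \<le> ?C * (real d * ln (real (max 2 d)) * max 1 (1 / \<epsilon>\<^sup>2)) \<and>
            one_nonzero_per_row S) \<and>
        measure_pmf.prob D {S. l1_preserving \<epsilon> A S} \<ge> 1 - real (max 2 d) powr (- c) \<and>
        output_distribution T (sampler c n d \<epsilon>) = D \<and>
        (\<exists>k. real k \<le> (2 / ln (ln 3) + 1 / ln 2) * ln (ln (real (max 3 n))) \<and>
             calls_at_most (nonneg_diagonal n) T k (sampler c n d \<epsilon>))"
      by (rule exI, intro conjI ballI, erule correct(1)[THEN conjunct1], erule correct(1)[THEN conjunct2, THEN conjunct1],
          erule correct(1)[THEN conjunct2, THEN conjunct2], rule correct(2), rule refl,
          rule exI, rule conjI, rule rounds_le, rule correct(3))
  qed
qed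

end
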